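(* Fix $\bar\delta>0$. For every box $B\subseteq\mathbb R^d$ of positive measure, every $\delta\in(0,\bar\delta]$ and every $L\in\mathbb N$ there exists a linear operator $C_{B,\delta,L}:V_{\mathrm{harm}}(B^{\delta L})\to V_{\mathrm{harm}}(B)$ with (1) $\operatorname{rank}C_{B,\delta,L}\le C\,(L+\operatorname{diam}B/\delta)^{d+1}$; (2) for all $u\in V_{\mathrm{harm}}(B^{\delta L})$: $\|u-C_{B,\delta,L}u\|_{H^k(B)}\le C\,\delta^{-k}2^{-L}\|u\|_{H^k(B^{\delta L})}$, where $C$ depends only on $d,k,k_{\min}$, the $\sigma_l$ and $\bar\delta$.
   Context: Setting: $d,k\in\mathbb N$, $k>d/2$, $k_{\min}\in\{0,\dots,k\}$, $\sigma_{k_{\min}},\dots,\sigma_k\ge0$ with $\sigma_{k_{\min}},\sigma_k>0$; $V=\{v\in L^1_{\mathrm{loc}}(\mathbb R^d):\partial^\alpha v\in L^2(\mathbb R^d)\ \forall|\alpha|\in\{k_{\min},\dots,k\}\}$ (elements continuous, in $H^k_{\mathrm{loc}}$); $a(u,v)=\sum_{l=k_{\min}}^k\sigma_l\sum_{|\alpha|=l}\frac{l!}{\alpha!}(\partial^\alpha u,\partial^\alpha v)_{L^2(\mathbb R^d)}$. Pairwise distinct points $x_1,\dots,x_N$; $V_0=\{v\in V:v(x_n)=0\ \forall n\}$. For open $B$, $V_{\mathrm{harm}}(B)=\{u\in V:u(x_n)=0\text{ whenever }x_n\in B,\ a(u,v)=0\ \forall v\in V_0\text{ with }\operatorname{supp}v\subseteq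 B\}$. A box is $B=\prod_{i=1}^d(a_i,b_i)$; $B^\delta=\prod_i(a_i-\delta,b_i+\delta)$. The rank of a linear operator is the dimension of its range. *)

theory Defs
  imports "HOL-Analysis.Analysis" "HOL-Library.Extended_Nat"
begin

definition mi_abs :: "('n::finite \<Rightarrow> nat) \<Rightarrow> nat" where
  "mi_abs \<alpha> = (\<Sum>i\<in>UNIV. \<alpha> i)"

definition mi_fact :: "('n::finite \<Rightarrow> nat) \<Rightarrow> nat" where
  "mi_fact \<alpha> = (\<Prod>i\<in>UNIV. fact (\<alpha> i))"

definition pd :: "'n::finite \<Rightarrow> (real^'n \<Rightarrow> real) \<Rightarrow> real^'n \<Rightarrow> real" where
  "pd i f x = frechet_derivative f (at x) (axis i 1)"

fun iter_pd :: "'n::finite list \<Rightarrow> (real^'n \<Rightarrow> real) \<Rightarrow> real^'n \<Rightarrow> real" where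
  "iter_pd [] f = f"
| "iter_pd (i # is) f = pd i (iter_pd is f)"

definition smooth_fn :: "(real^'n::finite \<Rightarrow> real) \<Rightarrow> bool" where
  "smooth_fn f \<longleftrightarrow> (\<forall>is x. iter_pd is f differentiable (at x))"

text \<open>Classical derivative of multi-index alpha (for smooth functions the order is irrelevant).\<close>
definition cderiv :: "('n::finite \<Rightarrow> nat) \<Rightarrow> (real^'n \<Rightarrow> real) \<Rightarrow> real^'n \<Rightarrow> real" where
  "cderiv \<alpha> f = iter_pd (SOME is. \<forall>i. count_list is i = \<alpha> i) f"

definition tsupp :: "(real^'n::finite \<Rightarrow> real) \<Rightarrow> (real^'n) set" where
  "tsupp f = closure {x. f x \<noteq> 0}"

definition test_fn :: "(real^'n::finite) set \<Rightarrow> (real^'n \<Rightarrow> real) \<Rightarrow> bool" where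
  "test_fn U \<phi> \<longleftrightarrow> smooth_fn \<phi> \<and> compact (tsupp \<phi>) \<and> tsupp \<phi> \<subseteq> U"

definition loc_int :: "(real^'n::finite) set \<Rightarrow> (real^'n \<Rightarrow> real) \<Rightarrow> bool" where
  "loc_int U f \<longleftrightarrow> (\<forall>K. compact K \<and> K \<subseteq> U \<longrightarrow> set_integrable lebesgue K f)"

definition has_weak_deriv ::
  "(real^'n::finite) set \<Rightarrow> ('n \<Rightarrow> nat) \<Rightarrow> (real^'n \<Rightarrow> real) \<Rightarrow> (real^'n \<Rightarrow> real) \<Rightarrow> bool" where
  "has_weak_deriv U \<alpha> v g \<longleftrightarrow> loc_int U v \<and> loc_int U g \<and>
     (\<forall>\<phi>. test_fn U \<phi> \<longrightarrow>
        (LINT x:U|lebesgue. v x * cderiv \<alpha> \<phi> x) = (-1) ^ mi_abs \<alpha> * (LINT x:U|lebesgue. g x * \<phi> x))"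

definition weak_deriv :: "(real^'n::finite) set \<Rightarrow> ('n \<Rightarrow> nat) \<Rightarrow> (real^'n \<Rightarrow> real) \<Rightarrow> real^'n \<Rightarrow> real" where
  "weak_deriv U \<alpha> v = (SOME g. has_weak_deriv U \<alpha> v g)"

definition L2_on :: "(real^'n::finite) set \<Rightarrow> (real^'n \<Rightarrow> real) \<Rightarrow> bool" where
  "L2_on U f \<longleftrightarrow> set_borel_measurable lebesgue U f \<and> set_integrable lebesgue U (\<lambda>x. (f x)^2)"

definition l2inner :: "(real^'n::finite) set \<Rightarrow> (real^'n \<Rightarrow> real) \<Rightarrow> (real^'n \<Rightarrow> real) \<Rightarrow> real" where
  "l2inner U f g = (LINT x:U|lebesgue. f x * g x)"

text \<open>The space V (continuous representatives; they exist since k > d/2).\<close>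
definition V_space :: "nat \<Rightarrow> nat \<Rightarrow> (real^'n::finite \<Rightarrow> real) set" where
  "V_space kmin k = {v. continuous_on UNIV v \<and> loc_int UNIV v \<and>
     (\<forall>\<alpha>::'n \<Rightarrow> nat. kmin \<le> mi_abs \<alpha> \<and> mi_abs \<alpha> \<le> k \<longrightarrow>
        (\<exists>g. has_weak_deriv UNIV \<alpha> v g \<and> L2_on UNIV g))}"

definition a_form :: "nat \<Rightarrow> nat \<Rightarrow> (nat \<Rightarrow> real) \<Rightarrow> (real^'n::finite \<Rightarrow> real) \<Rightarrow> (real^'n \<Rightarrow> real) \<Rightarrow> real" where
  "a_form kmin k \<sigma> u v = (\<Sum>l\<in>{kmin..k}. \<sigma> l *
     (\<Sum>\<alpha>\<in>{\<alpha>::'n \<Rightarrow> nat. mi_abs \<alpha> = l}. (fact l / real (mi_fact \<alpha>)) *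
        l2inner UNIV (weak_deriv UNIV \<alpha> u) (weak_deriv UNIV \<alpha> v)))"

definition V0_space :: "nat \<Rightarrow> nat \<Rightarrow> (real^'n::finite) set \<Rightarrow> (real^'n \<Rightarrow> real) set" where
  "V0_space kmin k P = {v \<in> V_space kmin k. \<forall>x\<in>P. v x = 0}"

definition V_harm :: "nat \<Rightarrow> nat \<Rightarrow> (nat \<Rightarrow> real) \<Rightarrow> (real^'n::finite) set \<Rightarrow> (real^'n) set \<Rightarrow> (real^'n \<Rightarrow> real) set" where
  "V_harm kmin k \<sigma> P B = {u \<in> V_space kmin k. (\<forall>x\<in>P. x \<in> B \<longrightarrow> u x = 0) \<and>
     (\<forall>v \<in> V0_space kmin k P. tsupp v \<subseteq> B \<longrightarrow> a_form kmin k \<sigma> u v = 0)}"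

definition hk_norm :: "nat \<Rightarrow> (real^'n::finite) set \<Rightarrow> (real^'n \<Rightarrow> real) \<Rightarrow> real" where
  "hk_norm k U u = sqrt (\<Sum>\<alpha>\<in>{\<alpha>::'n \<Rightarrow> nat. mi_abs \<alpha> \<le> k}.
      l2inner U (weak_deriv U \<alpha> u) (weak_deriv U \<alpha> u))"

definition box_ext :: "real^'n::finite \<Rightarrow> real^'n \<Rightarrow> real \<Rightarrow> (real^'n) set" where
  "box_ext a b t = box (a - (\<chi> i. t)) (b + (\<chi> i. t))"

definition lin_op_on :: "((real^'n::finite \<Rightarrow> real) \<Rightarrow> (real^'n \<Rightarrow> real)) \<Rightarrow> (real^'n \<Rightarrow> real) set \<Rightarrow> (real^'n \<Rightarrow> real) set \<Rightarrow> bool" where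
  "lin_op_on T S1 S2 \<longleftrightarrow> (\<forall>u\<in>S1. T u \<in> S2) \<and>
     (\<forall>u\<in>S1. \<forall>v\<in>S1. T (\<lambda>x. u x + v x) = (\<lambda>x. T u x + T v x)) \<and>
     (\<forall>u\<in>S1. \<forall>c::real. T (\<lambda>x. c * u x) = (\<lambda>x. c * T u x))"

definition fspan :: "(real^'n::finite \<Rightarrow> real) set \<Rightarrow> (real^'n \<Rightarrow> real) set" where
  "fspan F = {g. \<exists>c. g = (\<lambda>x. \<Sum>f\<in>F. c f * f x)}"

text \<open>Rank = dimension of the range = least size of a finite spanning set of it (infinity if none).\<close>
definition op_rank :: "((real^'n::finite \<Rightarrow> real) \<Rightarrow> (real^'n \<Rightarrow> real)) \<Rightarrow> (real^'n \<Rightarrow> real) set \<Rightarrow> enat" where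
  "op_rank T S = Inf {enat (card F) | F. finite F \<and> T ` S \<subseteq> fspan F}"

end

theory Submission
  imports Defs "HOL-Computational_Algebra.Polynomial"
begin

text \<open>The operator maps the space X of functions harmonic on the largest box into X itself. Cut each of
  the boxes enlarged by \<open>m \<delta>\<close>, \<open>1 \<le> m \<le> L\<close>, into cells of side at most \<open>\<theta> \<delta>\<close> and take as functionals the cell
  means of all derivatives of order below k. If they all vanish on a harmonic function, then the Poincare
  inequality makes its lower order energies on each enlarged box small, and testing
  the equation with \<open>\<eta> u\<close> for a cutoff \<open>\<eta>\<close> bounds the top order energy by products with a lower order
  factor; for small \<open>\<theta>\<close> the weighted energy drops by the factor 4 from each box to the next smaller one.
  It remains to choose T of finite rank such that \<open>u - T u\<close> is annihilated by all functionals and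
  is controlled by u in the norm on the largest box.\<close>

subsection \<open>Smooth functions\<close>

text \<open>One operator serves all L boxes. As \<open>T u\<close> stays in the space of the largest
  box, \<open>u - T u\<close> is harmonic on every intermediate box, and this one function passes
  through all L decay steps. The functionals of the boxes add up: L boxes with at most a constant
  times (L + diam B / \<delta>)^d cells each give the exponent d + 1. The energy weights derivatives
  of order j by \<delta>^(2j), matching the size \<delta>^(-j) of the j-th derivatives of a cutoff.
  So the decay constant \<open>C0\<close>, and with it \<theta>, depends neither on the box nor on
  the points nor on \<delta>. Terms of order l < k of the form leave a factor \<delta>^(2(k-l));
  this is where the bound \<open>\<delta>bar\<close> enters. Going back from the energy to the H^k
  norm costs \<delta>^(-k), and the energy factor 4 becomes 2 in the norm. Weak derivatives are
  treated by duality with averages along segments instead of mollification. Such averages have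
  explicit adjoints, so difference formulas for test functions carry over to weak derivatives
  without a limit.\<close>

lemma has_derivative_imp_pd: "(f has_derivative f') (at x) \<Longrightarrow> pd i f x = f' (axis i 1)"
  unfolding pd_def using frechet_derivative_at by metis

lemma DERIV_along_line:
  assumes "f differentiable (at (x + s *\<^sub>R z))"
  shows "((\<lambda>s. f (x + s *\<^sub>R z)) has_real_derivative (\<Sum>i\<in>UNIV. z $ i * pd i f (x + s *\<^sub>R z))) (at s)"
proof -
  let ?y = "x + s *\<^sub>R z" and ?D = "frechet_derivative f (at (x + s *\<^sub>R z))"
  have D: "(f has_derivative ?D) (at ?y)"
    using assms frechet_derivative_works by blast
  have lin: "linear ?D" using D has_derivative_linear by blast
  have "z = (\<Sum>i\<in>UNIV. z $ i *\<^sub>R axis i 1)"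
    by (simp add: basis_expansion scalar_mult_eq_scaleR[symmetric])
  then have "?D z = ?D (\<Sum>i\<in>UNIV. z $ i *\<^sub>R axis i 1)" by simp
  also have "\<dots> = (\<Sum>i\<in>UNIV. z $ i * pd i f ?y)"
    by (simp add: linear_sum[OF lin] linear_scale[OF lin] pd_def)
  finally have e: "?D z = (\<Sum>i\<in>UNIV. z $ i * pd i f ?y)" .
  have "((\<lambda>s. x + s *\<^sub>R z) has_derivative (\<lambda>t. t *\<^sub>R z)) (at s)"
    by (auto intro!: derivative_eq_intros)
  from diff_chain_at[OF this D]
  have "((\<lambda>s. f (x + s *\<^sub>R z)) has_derivative (\<lambda>t. ?D (t *\<^sub>R z))) (at s)"
    by (simp add: o_def)
  moreover have "(\<lambda>t. ?D (t *\<^sub>R z)) = (*) (?D z)"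
    by (simp add: linear_scale[OF lin] fun_eq_iff mult.commute)
  ultimately show ?thesis unfolding has_field_derivative_def e by simp
qed

lemma DERIV_along_axis:
  assumes "f differentiable (at (x + s *\<^sub>R axis i 1))"
  shows "((\<lambda>s. f (x + s *\<^sub>R axis i 1)) has_real_derivative pd i f (x + s *\<^sub>R axis i 1)) (at s)"
proof -
  have "(\<Sum>j\<in>UNIV. (axis i (1::real)) $ j * pd j f (x + s *\<^sub>R axis i 1)) = pd i f (x + s *\<^sub>R axis i 1)"
    by (simp add: axis_def if_distrib if_distribR cong: if_cong)
  with DERIV_along_line[OF assms] show ?thesis by simp
qed

lemma iter_pd_append: "iter_pd (xs @ ys) f = iter_pd xs (iter_pd ys f)"
  by (induction xs) auto

lemma smooth_fnD: "smooth_fn f \<Longrightarrow> f differentiable (at x)"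
  unfolding smooth_fn_def by (metis iter_pd.simps(1))

lemma smooth_fn_iter_pd: "smooth_fn f \<Longrightarrow> smooth_fn (iter_pd is f)"
  unfolding smooth_fn_def by (metis iter_pd_append)

lemma smooth_fn_pd: "smooth_fn f \<Longrightarrow> smooth_fn (pd i f)"
  using smooth_fn_iter_pd[of f "[i]"] by simp

text \<open>For segment averages it is easier to exhibit a class of differentiable functions that
  differentiation does not leave than to compute \<open>iter_pd\<close>.\<close>

lemma smooth_fn_coinduct:
  assumes "f \<in> S" and "\<And>g x. g \<in> S \<Longrightarrow> g differentiable (at x)"
    and "\<And>g i. g \<in> S \<Longrightarrow> pd i g \<in> S"
  shows "smooth_fn f"
proof -
  have "iter_pd is f \<in> S" for "is" using assms by (induction "is") auto
  with assms show ?thesis unfolding smooth_fn_def by blast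
qed

lemma continuous_on_smooth: "smooth_fn f \<Longrightarrow> continuous_on S f"
  by (meson continuous_at_imp_continuous_on differentiable_imp_continuous_within smooth_fnD)

lemma pd_add:
  assumes "f differentiable (at x)" "g differentiable (at x)"
  shows "pd i (\<lambda>x. f x + g x) x = pd i f x + pd i g x"
proof -
  have "((\<lambda>x. f x + g x) has_derivative (\<lambda>h. frechet_derivative f (at x) h + frechet_derivative g (at x) h)) (at x)"
    using assms frechet_derivative_works by (blast intro: has_derivative_add)
  from has_derivative_imp_pd[OF this] show ?thesis by (simp add: pd_def)
qed

lemma pd_mult:
  assumes "f differentiable (at x)" "g differentiable (at x)"
  shows "pd i (\<lambda>x. f x * g x) x = f x * pd i g x + pd i f x * g x"
proof -
  have "((\<lambda>x. f x * g x) has_derivative (\<lambda>h. f x * frechet_derivative g (at x) h + frechet_derivative f (at x) h * g x)) (at x)"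
    using assms frechet_derivative_works by (blast intro: has_derivative_mult)
  from has_derivative_imp_pd[OF this] show ?thesis by (simp add: pd_def)
qed

text \<open>All ways to distribute a list of derivatives over two factors, counted with
  multiplicity: the Leibniz rule without binomial coefficients, hence with 2^m terms for m
  derivatives.\<close>

fun splits :: "'a list \<Rightarrow> ('a list \<times> 'a list) list" where
  "splits [] = [([], [])]"
| "splits (i # is) = map (\<lambda>(A, B). (A, i # B)) (splits is) @ map (\<lambda>(A, B). (i # A, B)) (splits is)"

lemma splits_length: "(A, B) \<in> set (splits is) \<Longrightarrow> length A + length B = length is"
  by (induction "is" arbitrary: A B) auto

text \<open>The head is the term in which no derivative falls on the first factor. With a cutoff as
  first factor it becomes the main term of the energy identity; every other term has at least one
  derivative on the cutoff.\<close>

lemma splits_eq_Cons: "\<exists>r. splits is = ([], is) # r \<and> (\<forall>p\<in>set r. fst p \<noteq> [])"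
proof (induction "is")
  case (Cons i "is")
  then obtain r where r: "splits is = ([], is) # r" "\<forall>p\<in>set r. fst p \<noteq> []" by blast
  show ?case
    by (rule exI[of _ "map (\<lambda>(A, B). (A, i # B)) r @ map (\<lambda>(A, B). (i # A, B)) (splits is)"])
       (use r in auto)
qed simp

lemma differentiable_sum_list:
  assumes "\<And>p. p \<in> set ps \<Longrightarrow> F p differentiable (at x)"
  shows "(\<lambda>x. \<Sum>p\<leftarrow>ps. F p x) differentiable (at x)"
  using assms by (induction ps) auto

lemma pd_sum_list:
  assumes "\<And>p. p \<in> set ps \<Longrightarrow> F p differentiable (at x)"
  shows "pd i (\<lambda>x. \<Sum>p\<leftarrow>ps. F p x) x = (\<Sum>p\<leftarrow>ps. pd i (F p) x)"
  using assms
proof (induction ps)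
  case Nil
  have "((\<lambda>x. 0::real) has_derivative (\<lambda>h. 0)) (at x)" by simp
  from has_derivative_imp_pd[OF this] show ?case by simp
next
  case (Cons p ps)
  then show ?case by (simp add: pd_add differentiable_sum_list)
qed

lemma iter_pd_mult:
  assumes "smooth_fn f" "smooth_fn g"
  shows "iter_pd is (\<lambda>x. f x * g x) = (\<lambda>x. \<Sum>(A, B)\<leftarrow>splits is. iter_pd A f x * iter_pd B g x)"
proof (induction "is")
  case (Cons i "is")
  have d: "iter_pd A f differentiable (at x)" "iter_pd A g differentiable (at x)" for A x
    using assms by (auto simp: smooth_fn_def)
  have "pd i (\<lambda>x. \<Sum>p\<leftarrow>splits is. iter_pd (fst p) f x * iter_pd (snd p) g x) x
     = (\<Sum>p\<leftarrow>splits is. pd i (\<lambda>x. iter_pd (fst p) f x * iter_pd (snd p) g x) x)" for x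
    by (rule pd_sum_list) (auto intro!: d derivative_intros)
  also have "\<dots> x = (\<Sum>p\<leftarrow>splits is. iter_pd (fst p) f x * iter_pd (i # snd p) g x
      + iter_pd (i # fst p) f x * iter_pd (snd p) g x)" for x
    by (simp add: pd_mult d)
  also have "\<dots> x = (\<Sum>(A, B)\<leftarrow>splits (i # is). iter_pd A f x * iter_pd B g x)" for x
    by (simp add: sum_list_addf o_def case_prod_beta)
  finally show ?case by (simp add: Cons case_prod_unfold del: splits.simps)
qed simp

lemma smooth_fn_mult:
  assumes "smooth_fn f" "smooth_fn g" shows "smooth_fn (\<lambda>x. f x * g x)"
  unfolding smooth_fn_def
proof (intro allI)
  fix "is" x
  have d: "iter_pd A f differentiable (at x)" "iter_pd A g differentiable (at x)" for A x
    using assms by (auto simp: smooth_fn_def)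
  show "iter_pd is (\<lambda>x. f x * g x) differentiable (at x)"
    unfolding iter_pd_mult[OF assms] case_prod_beta
    by (rule differentiable_sum_list) (auto intro!: d derivative_intros)
qed

text \<open>The second difference over a square of side h is h^2 times either mixed derivative, each
  taken at some nearby point. Both derivatives are continuous, so letting h tend to 0 identifies
  them at x.\<close>

lemma pd_commute:
  fixes f :: "real^'n::finite \<Rightarrow> real"
  assumes "smooth_fn f"
  shows "pd i (pd j f) x = pd j (pd i f) x"
proof -
  let ?e = "\<lambda>i::'n. axis i (1::real)"
  \<comment> \<open>The mean value theorem twice: in direction i for the increment of f in direction
    j, then in direction j for the derivative obtained.\<close>
  have dd: "\<exists>s t. 0 \<le> s \<and> s \<le> h \<and> 0 \<le> t \<and> t \<le> h \<and>
     f (x + h *\<^sub>R ?e i + h *\<^sub>R ?e j) - f (x + h *\<^sub>R ?e i) - f (x + h *\<^sub>R ?e j) + f x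
       = h * h * pd j (pd i f) (x + s *\<^sub>R ?e i + t *\<^sub>R ?e j)"
    if h: "h > 0" for h i j
  proof -
    let ?g = "\<lambda>s. f ((x + h *\<^sub>R ?e j) + s *\<^sub>R ?e i) - f (x + s *\<^sub>R ?e i)"
    have "(?g has_real_derivative pd i f ((x + h *\<^sub>R ?e j) + s *\<^sub>R ?e i) - pd i f (x + s *\<^sub>R ?e i)) (at s)" for s
      by (intro DERIV_diff DERIV_along_axis smooth_fnD assms)
    from MVT2[OF h this] obtain s where s: "0 < s" "s < h"
      "?g h - ?g 0 = h * (pd i f ((x + h *\<^sub>R ?e j) + s *\<^sub>R ?e i) - pd i f (x + s *\<^sub>R ?e i))"
      by auto
    have "((\<lambda>t. pd i f ((x + s *\<^sub>R ?e i) + t *\<^sub>R ?e j)) has_real_derivative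
       pd j (pd i f) ((x + s *\<^sub>R ?e i) + t *\<^sub>R ?e j)) (at t)" for t
      by (intro DERIV_along_axis smooth_fnD smooth_fn_pd assms)
    from MVT2[OF h this] obtain t where t: "0 < t" "t < h"
      "pd i f ((x + s *\<^sub>R ?e i) + h *\<^sub>R ?e j) - pd i f (x + s *\<^sub>R ?e i)
        = h * pd j (pd i f) ((x + s *\<^sub>R ?e i) + t *\<^sub>R ?e j)" by auto
    have "?g h - ?g 0 = h * h * pd j (pd i f) (x + s *\<^sub>R ?e i + t *\<^sub>R ?e j)"
      using s(3) t(3) by (simp add: algebra_simps)
    then show ?thesis using s t
      by (intro exI[of _ s] exI[of _ t]) (simp add: algebra_simps)
  qed
  have ex: "\<exists>p q. dist p x \<le> 2 * h \<and> dist q x \<le> 2 * h \<and> pd i (pd j f) p = pd j (pd i f) q"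
    if h: "h > 0" for h
  proof -
    from dd[OF h, of i j] obtain s t where st: "0 \<le> s" "s \<le> h" "0 \<le> t" "t \<le> h"
     "f (x + h *\<^sub>R ?e i + h *\<^sub>R ?e j) - f (x + h *\<^sub>R ?e i) - f (x + h *\<^sub>R ?e j) + f x
       = h * h * pd j (pd i f) (x + s *\<^sub>R ?e i + t *\<^sub>R ?e j)" by blast
    from dd[OF h, of j i] obtain s' t' where st': "0 \<le> s'" "s' \<le> h" "0 \<le> t'" "t' \<le> h"
     "f (x + h *\<^sub>R ?e j + h *\<^sub>R ?e i) - f (x + h *\<^sub>R ?e j) - f (x + h *\<^sub>R ?e i) + f x
       = h * h * pd i (pd j f) (x + s' *\<^sub>R ?e j + t' *\<^sub>R ?e i)" by blast
    have "h * h * pd j (pd i f) (x + s *\<^sub>R ?e i + t *\<^sub>R ?e j) = h * h * pd i (pd j f) (x + s' *\<^sub>R ?e j + t' *\<^sub>R ?e i)"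
      unfolding st(5)[symmetric] st'(5)[symmetric] by (simp add: algebra_simps)
    then have eq: "pd j (pd i f) (x + s *\<^sub>R ?e i + t *\<^sub>R ?e j) = pd i (pd j f) (x + s' *\<^sub>R ?e j + t' *\<^sub>R ?e i)"
      using h by simp
    have n: "dist (x + s *\<^sub>R ?e i + t *\<^sub>R ?e j) x \<le> 2 * h" if "0 \<le> s" "s \<le> h" "0 \<le> t" "t \<le> h" for s t i j
    proof -
      have "dist (x + s *\<^sub>R ?e i + t *\<^sub>R ?e j) x = norm (s *\<^sub>R ?e i + t *\<^sub>R ?e j)" by (simp add: dist_norm)
      also have "\<dots> \<le> norm (s *\<^sub>R ?e i) + norm (t *\<^sub>R ?e j)" by (rule norm_triangle_ineq)
      also have "\<dots> \<le> 2 * h" using that by simp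
      finally show ?thesis .
    qed
    show ?thesis
      by (rule exI[of _ "x + s' *\<^sub>R ?e j + t' *\<^sub>R ?e i"], rule exI[of _ "x + s *\<^sub>R ?e i + t *\<^sub>R ?e j"])
         (use n st st' eq in auto)
  qed
  let ?h = "\<lambda>n. 1 / real (Suc n)"
  have "\<forall>n. \<exists>p q. dist p x \<le> 2 * ?h n \<and> dist q x \<le> 2 * ?h n \<and> pd i (pd j f) p = pd j (pd i f) q"
    by (intro allI ex) simp
  then obtain p q where pq: "\<And>n. dist (p n) x \<le> 2 * ?h n" "\<And>n. dist (q n) x \<le> 2 * ?h n"
    "\<And>n. pd i (pd j f) (p n) = pd j (pd i f) (q n)" by metis
  have h0: "(\<lambda>n. 2 * ?h n) \<longlonglongrightarrow> 0"
    using tendsto_mult_right_zero[OF LIMSEQ_inverse_real_of_nat, of 2] by (simp add: field_simps)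
  have "(\<lambda>n. dist (p n) x) \<longlonglongrightarrow> 0" "(\<lambda>n. dist (q n) x) \<longlonglongrightarrow> 0"
    by (rule tendsto_sandwich[OF _ _ tendsto_const h0];
        rule always_eventually, rule allI, (rule zero_le_dist | rule pq))+
  then have "p \<longlonglongrightarrow> x" "q \<longlonglongrightarrow> x" by (auto simp: tendsto_dist_iff[symmetric])
  moreover have "isCont (pd i (pd j f)) x" "isCont (pd j (pd i f)) x"
    using assms by (auto intro!: differentiable_imp_continuous_within smooth_fnD smooth_fn_pd)
  ultimately have "(\<lambda>n. pd i (pd j f) (p n)) \<longlonglongrightarrow> pd i (pd j f) x" "(\<lambda>n. pd j (pd i f) (q n)) \<longlonglongrightarrow> pd j (pd i f) x"
    by (auto intro: isCont_tendsto_compose)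
  then show ?thesis unfolding pq(3) using LIMSEQ_unique by blast
qed

section \<open>Independence of the order of differentiation, and multi-indices\<close>

lemma iter_pd_move:
  assumes "smooth_fn f" shows "iter_pd (xs @ i # ys) f = iter_pd (i # xs @ ys) f"
proof (induction xs)
  case (Cons j xs)
  have "smooth_fn (iter_pd (xs @ ys) f)" by (rule smooth_fn_iter_pd[OF assms])
  from pd_commute[OF this, of j i] show ?case by (simp add: Cons fun_eq_iff)
qed simp

lemma iter_pd_mset_cong:
  assumes "smooth_fn f" "mset xs = mset ys" shows "iter_pd xs f = iter_pd ys f"
  using assms(2)
proof (induction xs arbitrary: ys)
  case (Cons i xs)
  then have "i \<in> set ys" by (metis list.set_intros(1) set_mset_mset)
  then obtain a b where ys: "ys = a @ i # b" by (meson split_list)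
  with Cons.prems have "mset xs = mset (a @ b)" by simp
  with Cons.IH have "iter_pd xs f = iter_pd (a @ b) f" by blast
  then show ?case using iter_pd_move[OF assms(1), of a i b] by (simp add: ys)
qed simp

lemma mset_eq_iff_count_list: "mset xs = mset ys \<longleftrightarrow> (\<forall>i. count_list xs i = count_list ys i)"
  by (simp add: multiset_eq_iff count_mset)

lemma ex_list_counts: "\<exists>is. \<forall>i::'n::finite. count_list is i = \<alpha> i"
proof -
  have "finite {x. 0 < \<alpha> x}" by simp
  then have "count (Abs_multiset \<alpha>) = \<alpha>" by (simp add: Abs_multiset_inverse)
  moreover obtain "is" where "mset is = Abs_multiset \<alpha>" using ex_mset by blast
  ultimately show ?thesis by (metis count_mset)
qed

text \<open>\<open>cderiv\<close> selects some list with the right counts; two such lists are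
  permutations of each other, so for smooth f the selection is immaterial.\<close>

lemma cderiv_eq:
  assumes "smooth_fn f" "\<And>i. count_list is i = \<alpha> i"
  shows "cderiv \<alpha> f = iter_pd is f"
proof -
  have "\<forall>i. count_list (SOME is. \<forall>i. count_list is i = \<alpha> i) i = \<alpha> i"
    by (rule someI[of "\<lambda>is. \<forall>i. count_list is i = \<alpha> i"]) (use assms in blast)
  then show ?thesis unfolding cderiv_def
    by (intro iter_pd_mset_cong assms) (simp add: mset_eq_iff_count_list assms)
qed

lemma mi_abs_count_list: "mi_abs (count_list is) = length is"
proof -
  have "mi_abs (count_list is) = (\<Sum>i\<in>set is. count_list is i)"
    unfolding mi_abs_def by (rule sum.mono_neutral_right) (auto simp: count_list_0_iff)
  then show ?thesis by (simp add: sum_count_set)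
qed

lemma finite_mi_abs_le: "finite {\<alpha>::'n::finite \<Rightarrow> nat. mi_abs \<alpha> \<le> m}"
proof (rule finite_subset)
  show "{\<alpha>::'n \<Rightarrow> nat. mi_abs \<alpha> \<le> m} \<subseteq> (\<Pi>\<^sub>E i\<in>UNIV. {..m})"
  proof
    fix \<alpha> :: "'n \<Rightarrow> nat" assume "\<alpha> \<in> {\<alpha>. mi_abs \<alpha> \<le> m}"
    moreover have "\<alpha> i \<le> mi_abs \<alpha>" for i
      unfolding mi_abs_def by (rule member_le_sum) auto
    ultimately have "\<alpha> i \<le> m" for i using le_trans[of "\<alpha> i" "mi_abs \<alpha>" m] by simp
    then show "\<alpha> \<in> (\<Pi>\<^sub>E i\<in>UNIV. {..m})" by auto
  qed
qed (rule finite_PiE, simp_all)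

section \<open>Supports and test functions\<close>

lemma iter_pd_zero_outside: "x \<notin> tsupp f \<Longrightarrow> iter_pd is f x = 0"
proof (induction "is" arbitrary: x)
  case Nil
  then show ?case using closure_subset[of "{x. f x \<noteq> 0}"] by (auto simp: tsupp_def)
next
  case (Cons i "is")
  have "open (- tsupp f)" by (simp add: tsupp_def open_Compl)
  moreover have "((\<lambda>x. 0) has_derivative (\<lambda>h. 0)) (at x)" by simp
  ultimately have "(iter_pd is f has_derivative (\<lambda>h. 0)) (at x)"
    using has_derivative_transform_within_open[of "\<lambda>x. 0" "\<lambda>h. 0" x UNIV "- tsupp f" "iter_pd is f"] Cons by auto
  from has_derivative_imp_pd[OF this] show ?case by simp
qed

lemma tsupp_subset: "closed S \<Longrightarrow> (\<And>x. x \<notin> S \<Longrightarrow> f x = 0) \<Longrightarrow> tsupp f \<subseteq> S"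
  unfolding tsupp_def by (rule closure_minimal) auto

lemma test_fnI:
  assumes "smooth_fn f" "compact K" "K \<subseteq> U" "\<And>x. x \<notin> K \<Longrightarrow> f x = 0"
  shows "test_fn U f"
proof -
  have "tsupp f \<subseteq> K" by (rule tsupp_subset) (use assms compact_imp_closed in auto)
  moreover have "closed (tsupp f)" by (simp add: tsupp_def)
  ultimately show ?thesis using assms unfolding test_fn_def
    by (metis closed_Int_compact inf.absorb_iff1 subset_trans)
qed

lemma test_fn_iter_pd: "test_fn U f \<Longrightarrow> test_fn U (iter_pd is f)"
  by (rule test_fnI[where K = "tsupp f"]) (auto simp: test_fn_def smooth_fn_iter_pd iter_pd_zero_outside)

lemma test_fn_pd: "test_fn U f \<Longrightarrow> test_fn U (pd i f)"
  using test_fn_iter_pd[of U f "[i]"] by simp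

lemma test_fn_mult: "smooth_fn g \<Longrightarrow> test_fn U f \<Longrightarrow> test_fn U (\<lambda>x. g x * f x)"
  by (rule test_fnI[where K = "tsupp f"])
     (auto simp: test_fn_def smooth_fn_mult, metis iter_pd.simps(1) iter_pd_zero_outside)

lemma test_fn_mono: "test_fn U f \<Longrightarrow> U \<subseteq> W \<Longrightarrow> test_fn W f"
  by (auto simp: test_fn_def)

lemma test_fn_bounded_support:
  assumes "test_fn U f"
  obtains a b where "\<And>is x. x \<notin> cbox a b \<Longrightarrow> iter_pd is f x = 0"
proof -
  have "bounded (tsupp f)" using assms compact_imp_bounded by (auto simp: test_fn_def)
  then obtain a b where "tsupp f \<subseteq> cbox a b" using bounded_subset_cbox_symmetric by metis
  then show ?thesis using that iter_pd_zero_outside by blast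
qed

subsection \<open>Tensor products\<close>

lemma tensor_has_derivative:
  fixes f g :: "'n::finite \<Rightarrow> real \<Rightarrow> real"
  assumes "\<And>i t. (f i has_real_derivative g i t) (at t)"
  shows "((\<lambda>x::real^'n. \<Prod>i\<in>UNIV. f i (x $ i)) has_derivative
     (\<lambda>h. \<Sum>i\<in>UNIV. (g i (x $ i) * h $ i) * (\<Prod>j\<in>UNIV - {i}. f j (x $ j)))) (at x)"
proof (rule has_derivative_prod)
  fix i :: 'n
  have "((\<lambda>x::real^'n. x $ i) has_derivative (\<lambda>h. h $ i)) (at x)"
    using bounded_linear_vec_nth bounded_linear_imp_has_derivative by blast
  moreover have "(f i has_derivative (*) (g i (x $ i))) (at (x $ i))"
    using assms by (simp add: has_field_derivative_def)
  ultimately show "((\<lambda>x. f i (x $ i)) has_derivative (\<lambda>h. g i (x $ i) * h $ i)) (at x)"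
    using diff_chain_at[of "\<lambda>x. x $ i" "\<lambda>h. h $ i" x "f i"] by (simp add: o_def)
qed

text \<open>\<open>f i m\<close> stands for the m-th derivative of the i-th factor, so that
  differentiating in direction j only raises the index \<open>m j\<close>.\<close>

lemma pd_tensor:
  fixes f :: "'n::finite \<Rightarrow> nat \<Rightarrow> real \<Rightarrow> real"
  assumes "\<And>i m t. (f i m has_real_derivative f i (Suc m) t) (at t)"
  shows "pd j (\<lambda>x::real^'n. \<Prod>i\<in>UNIV. f i (m i) (x $ i)) x
      = (\<Prod>i\<in>UNIV. f i ((m(j := Suc (m j))) i) (x $ i))"
proof -
  have "pd j (\<lambda>x::real^'n. \<Prod>i\<in>UNIV. f i (m i) (x $ i)) x
    = (\<Sum>i\<in>UNIV. (f i (Suc (m i)) (x $ i) * axis j 1 $ i) * (\<Prod>j\<in>UNIV - {i}. f j (m j) (x $ j)))"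
    by (rule has_derivative_imp_pd[OF tensor_has_derivative]) (rule assms)
  also have "\<dots> = f j (Suc (m j)) (x $ j) * (\<Prod>i\<in>UNIV - {j}. f i (m i) (x $ i))"
    by (simp add: axis_def if_distrib if_distribR cong: if_cong)
  also have "\<dots> = f j ((m(j := Suc (m j))) j) (x $ j) * (\<Prod>i\<in>UNIV - {j}. f i ((m(j := Suc (m j))) i) (x $ i))"
    by simp
  also have "\<dots> = (\<Prod>i\<in>UNIV. f i ((m(j := Suc (m j))) i) (x $ i))"
    by (rule prod.remove[symmetric]) auto
  finally show ?thesis .
qed

lemma iter_pd_tensor:
  fixes f :: "'n::finite \<Rightarrow> nat \<Rightarrow> real \<Rightarrow> real"
  assumes "\<And>i m t. (f i m has_real_derivative f i (Suc m) t) (at t)"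
  shows "iter_pd is (\<lambda>x::real^'n. \<Prod>i\<in>UNIV. f i 0 (x $ i)) = (\<lambda>x. \<Prod>i\<in>UNIV. f i (count_list is i) (x $ i))"
proof (induction "is")
  case (Cons j "is")
  have "(count_list is)(j := Suc (count_list is j)) = count_list (j # is)" by auto
  then show ?case using pd_tensor[of f j "count_list is", OF assms] by (simp add: Cons)
qed simp

lemma smooth_fn_tensor:
  fixes f :: "'n::finite \<Rightarrow> nat \<Rightarrow> real \<Rightarrow> real"
  assumes "\<And>i m t. (f i m has_real_derivative f i (Suc m) t) (at t)"
  shows "smooth_fn (\<lambda>x::real^'n. \<Prod>i\<in>UNIV. f i 0 (x $ i))"
  unfolding smooth_fn_def iter_pd_tensor[of f, OF assms]
proof (intro allI)
  fix "is" and x :: "real^'n"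
  show "(\<lambda>x::real^'n. \<Prod>i\<in>UNIV. f i (count_list is i) (x $ i)) differentiable (at x)"
    by (rule differentiableI[OF tensor_has_derivative[of "\<lambda>i. f i (count_list is i)" "\<lambda>i. f i (Suc (count_list is i))"]])
       (rule assms)
qed

subsection \<open>A smooth step and cutoff functions\<close>

text \<open>The functions p(1/t) exp(-1/t), extended by 0 to t \<le> 0; all derivatives of exp(-1/t)
  are of this form.\<close>

definition exp_flat :: "real poly \<Rightarrow> real \<Rightarrow> real" where
  "exp_flat p t = (if t > 0 then poly p (1 / t) * exp (- (1 / t)) else 0)"

lemma poly_times_exp_tendsto_0: "((\<lambda>x::real. poly p x * exp (- x)) \<longlongrightarrow> 0) at_top"
proof -
  have "((\<lambda>x. \<Sum>i\<le>degree p. coeff p i * (x ^ i / exp x)) \<longlongrightarrow> (\<Sum>i\<le>degree p. coeff p i * 0)) at_top"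
    by (intro tendsto_intros tendsto_power_div_exp_0)
  moreover have "(\<lambda>x. \<Sum>i\<le>degree p. coeff p i * (x ^ i / exp x)) = (\<lambda>x. poly p x * exp (- x))"
    by (simp add: poly_altdef fun_eq_iff sum_distrib_right exp_minus divide_inverse mult.assoc)
  ultimately show ?thesis by simp
qed

lemma exp_flat_at_right_0: "((\<lambda>t. poly p (1 / t) * exp (- (1 / t))) \<longlongrightarrow> (0::real)) (at_right 0)"
proof -
  have "filterlim (\<lambda>t::real. 1 / t) at_top (at_right 0)"
    using filterlim_inverse_at_top_right by (simp add: inverse_eq_divide)
  from filterlim_compose[OF poly_times_exp_tendsto_0 this] show ?thesis .
qed

text \<open>For t > 0 the derivative of p(1/t) exp(-1/t) is (1/t)^2 (p - p')(1/t) exp(-1/t), and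
  \<open>[:0, 0, 1:]\<close> is the square of the variable.\<close>

lemma DERIV_exp_flat:
  "(exp_flat p has_real_derivative exp_flat ([:0, 0, 1:] * (p - pderiv p)) t) (at t)"
proof -
  consider "t > 0" | "t < 0" | "t = 0" by linarith
  then show ?thesis
  proof cases
    case 1
    have "((\<lambda>t. poly p (1 / t) * exp (- (1 / t))) has_real_derivative
       exp_flat ([:0, 0, 1:] * (p - pderiv p)) t) (at t)"
      using 1 by (auto intro!: derivative_eq_intros DERIV_chain2[OF poly_DERIV]
        simp: exp_flat_def power2_eq_square field_simps)
    then show ?thesis
      by (rule has_field_derivative_transform_within_open[where S = "{0<..}"])
         (use 1 in \<open>auto simp: exp_flat_def\<close>)
  next
    case 2
    have "((\<lambda>t. 0) has_real_derivative exp_flat ([:0, 0, 1:] * (p - pderiv p)) t) (at t)"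
      using 2 by (simp add: exp_flat_def)
    then show ?thesis
      by (rule has_field_derivative_transform_within_open[where S = "{..<0}"])
         (use 2 in \<open>auto simp: exp_flat_def\<close>)
  next
    case 3
    \<comment> \<open>Dividing by h multiplies the polynomial in 1/h by its variable, hence
      \<open>pCons 0 p\<close>; the exponential still wins.\<close>
    have "((\<lambda>h. exp_flat p h / h) \<longlongrightarrow> 0) (at_right 0)"
    proof (rule tendsto_cong[THEN iffD1, OF _ exp_flat_at_right_0[of "pCons 0 p"]])
      show "\<forall>\<^sub>F x in at_right 0. poly (pCons 0 p) (1 / x) * exp (- (1 / x)) = exp_flat p x / x"
        by (rule eventually_at_right_less[THEN eventually_mono]) (simp add: exp_flat_def)
    qed
    moreover have "((\<lambda>h. exp_flat p h / h) \<longlongrightarrow> 0) (at_left 0)"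
    proof (rule tendsto_cong[THEN iffD1, OF _ tendsto_const])
      show "\<forall>\<^sub>F x in at_left 0. 0 = exp_flat p x / x"
        unfolding eventually_at_filter by (simp add: exp_flat_def)
    qed
    ultimately show ?thesis
      by (simp add: 3 DERIV_def filterlim_split_at exp_flat_def[of _ 0])
  qed
qed

text \<open>A class closed under differentiation whose members vanish outside (0,1). Derivatives of
  any order of the basic bump are therefore bounded, without formulas for them.\<close>

inductive_set bumps :: "(real \<Rightarrow> real) set" where
  "(\<lambda>t. exp_flat p t * exp_flat q (1 - t)) \<in> bumps"
| "f \<in> bumps \<Longrightarrow> g \<in> bumps \<Longrightarrow> (\<lambda>t. f t + g t) \<in> bumps"

lemma bumps_deriv: "f \<in> bumps \<Longrightarrow> \<exists>g\<in>bumps. \<forall>t. (f has_real_derivative g t) (at t)"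
proof (induction rule: bumps.induct)
  case (1 p q)
  define p' where "p' = [:0, 0, 1:] * (p - pderiv p)"
  define q' where "q' = [:0, 0, 1:] * (q - pderiv q)"
  have D: "((\<lambda>t. exp_flat q (1 - t)) has_real_derivative - exp_flat q' (1 - t)) (at t)" for t
  proof -
    have "((\<lambda>t. 1 - t) has_real_derivative -1) (at t)" by (auto intro!: derivative_eq_intros)
    with DERIV_chain2[of "exp_flat q" "exp_flat q' (1 - t)" "\<lambda>t. 1 - t" t "-1"] show ?thesis
      using DERIV_exp_flat[of q "1 - t"] by (simp add: q'_def)
  qed
  have n: "exp_flat (- q') s = - exp_flat q' s" for s by (simp add: exp_flat_def)
  have "((\<lambda>t. exp_flat p t * exp_flat q (1 - t)) has_real_derivative
    exp_flat p' t * exp_flat q (1 - t) + exp_flat p t * exp_flat (- q') (1 - t)) (at t)" for t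
    using DERIV_mult[OF DERIV_exp_flat[of p t, folded p'_def] D[of t]] by (simp add: n algebra_simps)
  moreover have "(\<lambda>t. exp_flat p' t * exp_flat q (1 - t) + exp_flat p t * exp_flat (- q') (1 - t)) \<in> bumps"
    by (intro bumps.intros)
  ultimately show ?case
    by (intro bexI[of _ "\<lambda>t. exp_flat p' t * exp_flat q (1 - t) + exp_flat p t * exp_flat (- q') (1 - t)"] allI)
next
  case (2 f g)
  then obtain f' g' where "f' \<in> bumps" "g' \<in> bumps"
    "\<And>t. (f has_real_derivative f' t) (at t)" "\<And>t. (g has_real_derivative g' t) (at t)" by blast
  then show ?case
    by (intro bexI[of _ "\<lambda>t. f' t + g' t"]) (auto intro: bumps.intros DERIV_add)
qed

lemma bumps_zero: "f \<in> bumps \<Longrightarrow> t \<le> 0 \<or> 1 \<le> t \<Longrightarrow> f t = 0"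
  by (induction rule: bumps.induct) (auto simp: exp_flat_def)

lemma bumps_bounded:
  assumes "f \<in> bumps" shows "\<exists>B. \<forall>t. \<bar>f t\<bar> \<le> B"
proof -
  have "continuous_on {0..1} f"
    using bumps_deriv[OF assms] DERIV_isCont continuous_at_imp_continuous_on by blast
  then have "bounded (f ` {0..1})" by (intro compact_imp_bounded compact_continuous_image) auto
  then obtain B where B: "\<And>t. t \<in> {0..1} \<Longrightarrow> \<bar>f t\<bar> \<le> B"
    unfolding bounded_iff by (metis imageI real_norm_def)
  have "\<bar>f t\<bar> \<le> max B 0" for t
    using B[of t] bumps_zero[OF assms, of t] by (cases "t \<in> {0..1}") auto
  then show ?thesis by blast
qed

text \<open>The step is the normalised primitive of exp(-1/t) exp(-1/(1-t)), and \<open>X m\<close>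
  is its m-th derivative.\<close>

lemma smooth_step_exists:
  "\<exists>X :: nat \<Rightarrow> real \<Rightarrow> real. (\<forall>m t. (X m has_real_derivative X (Suc m) t) (at t)) \<and>
     (\<forall>t\<le>0. X 0 t = 0) \<and> (\<forall>t\<ge>1. X 0 t = 1) \<and> (\<forall>t. 0 \<le> X 0 t \<and> X 0 t \<le> 1) \<and>
     (\<forall>m. \<exists>B. \<forall>t. \<bar>X m t\<bar> \<le> B) \<and> (\<forall>m t. t \<le> 0 \<or> 1 \<le> t \<longrightarrow> X (Suc m) t = 0)"
proof -
  define g where "g = (\<lambda>t. exp_flat 1 t * exp_flat 1 (1 - t))"
  have gb: "g \<in> bumps" unfolding g_def by (rule bumps.intros)
  have gpos: "g t > 0" if "0 < t" "t < 1" for t using that by (simp add: g_def exp_flat_def)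
  have gnn: "g t \<ge> 0" for t by (simp add: g_def exp_flat_def)
  have "isCont g t" for t using bumps_deriv[OF gb] DERIV_isCont by blast
  then obtain G where "\<And>t. (G has_vector_derivative g t) (at t)"
    using einterval_antiderivative[of "-\<infinity>" \<infinity> g] by auto
  then have G: "(G has_real_derivative g t) (at t)" for t
    by (simp add: has_real_derivative_iff_has_vector_derivative)
  define I where "I = G 1 - G 0"
  have "G 0 < G 1"
    by (rule DERIV_pos_imp_increasing_open) (use G gpos DERIV_continuous_on[of "{0..1}" G g] in \<open>auto intro: DERIV_subset\<close>)
  then have I: "I > 0" by (simp add: I_def)
  have mono: "G s \<le> G t" if "s \<le> t" for s t
    by (rule DERIV_nonneg_imp_nondecreasing[OF that]) (use G gnn in blast)
  have c0: "G t = G 0" if "t \<le> 0" for t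
  proof (cases "t = 0")
    case False
    with that have "t < 0" by simp
    then show ?thesis
      using DERIV_isconst_end[of t 0 G] G bumps_zero[OF gb] DERIV_continuous_on[of "{t..0}" G g]
      by (metis DERIV_isconst2 DERIV_subset less_eq_real_def that top_greatest order.strict_implies_order)
  qed simp
  have c1: "G t = G 1" if "t \<ge> 1" for t
  proof (cases "t = 1")
    case False
    with that have "1 < t" by simp
    then show ?thesis
      using G bumps_zero[OF gb] DERIV_continuous_on[of "{1..t}" G g]
      by (metis DERIV_isconst2 DERIV_subset less_eq_real_def that top_greatest order.strict_implies_order)
  qed simp
  \<comment> \<open>Derivatives are chosen inside \<open>bumps\<close>, so that iterating the choice
    never leaves the class.\<close>
  have "\<forall>f\<in>bumps. \<exists>g. g \<in> bumps \<and> (\<forall>t. (f has_real_derivative g t) (at t))"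
    using bumps_deriv by blast
  from bchoice[OF this] obtain d where
    d: "\<And>f. f \<in> bumps \<Longrightarrow> d f \<in> bumps \<and> (\<forall>t. (f has_real_derivative d f t) (at t))" by blast
  define X where "X m = (case m of 0 \<Rightarrow> (\<lambda>t. (G t - G 0) / I) | Suc j \<Rightarrow> (\<lambda>t. (d ^^ j) g t / I))" for m
  have db: "(d ^^ j) g \<in> bumps" for j by (induction j) (auto simp: gb d)
  have X0: "X 0 t = (G t - G 0) / I" "X (Suc j) t = (d ^^ j) g t / I" for t j
    by (auto simp: X_def)
  have Xf: "X 0 = (\<lambda>t. (G t - G 0) / I)" "X (Suc j) = (\<lambda>t. (d ^^ j) g t / I)" for j
    by (auto simp: X_def)
  have r1: "(X m has_real_derivative X (Suc m) t) (at t)" for m t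
  proof (cases m)
    case 0
    then show ?thesis using G[of t] I by (auto simp: Xf intro!: derivative_eq_intros)
  next
    case (Suc j)
    have "((d ^^ j) g has_real_derivative (d ^^ Suc j) g t) (at t)" using d[OF db[of j]] by simp
    then show ?thesis unfolding Suc Xf by (rule DERIV_cdivide)
  qed
  have b01: "0 \<le> X 0 t \<and> X 0 t \<le> 1" for t
  proof -
    have "G 0 \<le> G t" using c0[of t] mono[of 0 t] by (cases "t \<le> 0") auto
    moreover have "G t \<le> G 1" using c1[of t] mono[of t 1] by (cases "t \<ge> 1") auto
    ultimately show ?thesis using I by (simp add: X0 I_def)
  qed
  have r2: "\<exists>B. \<forall>t. \<bar>X m t\<bar> \<le> B" for m
  proof (cases m)
    case 0
    have "\<bar>X 0 t\<bar> \<le> 1" for t using b01[of t] by auto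
    then show ?thesis using 0 by blast
  next
    case (Suc j)
    obtain B where "\<And>t. \<bar>(d ^^ j) g t\<bar> \<le> B" using bumps_bounded[OF db[of j]] by blast
    then have "\<bar>X m t\<bar> \<le> B / I" for t using I by (simp add: Suc X0 divide_right_mono)
    then show ?thesis by blast
  qed
  have r3: "X (Suc m) t = 0" if "t \<le> 0 \<or> 1 \<le> t" for m t
    using bumps_zero[OF db that] by (simp add: X0)
  have r4: "X 0 t = 0" if "t \<le> 0" for t using c0[OF that] by (simp add: X0)
  have r5: "X 0 t = 1" if "t \<ge> 1" for t using c1[OF that] I by (simp add: X0 I_def)
  show ?thesis
  proof (rule exI[of _ X], intro conjI allI impI)
    fix m t
    show "(X m has_real_derivative X (Suc m) t) (at t)" by (rule r1)
    show "0 \<le> X 0 t" "X 0 t \<le> 1" using b01 by auto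
    show "\<exists>B. \<forall>t. \<bar>X m t\<bar> \<le> B" by (rule r2)
    show "X 0 t = 0" if "t \<le> 0" using r4[OF that] .
    show "X 0 t = 1" if "1 \<le> t" using r5[OF that] .
    show "X (Suc m) t = 0" if "t \<le> 0 \<or> 1 \<le> t" using r3[OF that] .
  qed
qed

text \<open>The sequence \<open>K\<close> is meant to be the same for all boxes and all \<delta>.
  The transition layer has width \<delta>/2 instead of \<delta>, so that the support is a compact
  subset of the open box enlarged by \<delta>.\<close>

definition is_cutoff :: "(nat \<Rightarrow> real) \<Rightarrow> real^'n::finite \<Rightarrow> real^'n \<Rightarrow> real \<Rightarrow> (real^'n \<Rightarrow> real) \<Rightarrow> bool" where
  "is_cutoff K a b \<delta> \<eta> \<longleftrightarrow> smooth_fn \<eta> \<and> (\<forall>x. 0 \<le> \<eta> x \<and> \<eta> x \<le> 1) \<and> (\<forall>x\<in>cbox a b. \<eta> x = 1) \<and>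
        (\<forall>x. x \<notin> cbox (a - (\<chi> i. \<delta> / 2)) (b + (\<chi> i. \<delta> / 2)) \<longrightarrow> \<eta> x = 0) \<and>
        (\<forall>is x. \<bar>iter_pd is \<eta> x\<bar> \<le> K (length is) / \<delta> ^ length is)"

text \<open>In each coordinate, the product of the rising and the falling step equals their sum minus 1, because
  one of the two factors is always 1; so no Leibniz rule is needed to bound the derivatives.\<close>

lemma cutoff_exists:
  "\<exists>K :: nat \<Rightarrow> real. (\<forall>m. 1 \<le> K m) \<and> (\<forall>(a :: real^'n::finite) b \<delta>. 0 < \<delta> \<longrightarrow> (\<forall>i. a $ i \<le> b $ i) \<longrightarrow>
     (\<exists>\<eta>. is_cutoff K a b \<delta> \<eta>))"
proof -
  obtain X :: "nat \<Rightarrow> real \<Rightarrow> real" where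
    X: "\<And>m t. (X m has_real_derivative X (Suc m) t) (at t)"
    and X0: "\<And>t. t \<le> 0 \<Longrightarrow> X 0 t = 0" and X1: "\<And>t. t \<ge> 1 \<Longrightarrow> X 0 t = 1"
    and X01: "\<And>t. 0 \<le> X 0 t \<and> X 0 t \<le> 1" and XB: "\<And>m. \<exists>B. \<forall>t. \<bar>X m t\<bar> \<le> B"
    using smooth_step_exists by blast
  obtain B where B: "\<And>m t. \<bar>X m t\<bar> \<le> B m" using XB by metis
  \<comment> \<open>The power 2^m comes from the slope 2/\<delta> of the rescaled arguments, the
    other 2 from the two steps. Values of at least 1 let the product in \<open>K\<close> dominate
    each of its factors.\<close>
  define c where "c m = max 1 (2 ^ Suc m * B m)" for m
  define K where "K n = (\<Prod>j\<le>n. c j) ^ CARD('n)" for n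
  have c1: "1 \<le> c m" for m by (simp add: c_def)
  have K1: "1 \<le> K m" for m unfolding K_def by (intro one_le_power prod_ge_1 c1)
  have cP: "c m \<le> (\<Prod>j\<le>n. c j)" if "m \<le> n" for m n
  proof -
    have "c m * 1 \<le> c m * (\<Prod>j\<in>{..n} - {m}. c j)"
      by (intro mult_left_mono prod_ge_1 c1) (use c1[of m] in linarith)
    also have "\<dots> = (\<Prod>j\<le>n. c j)" using that by (subst prod.remove[of _ m]) auto
    finally show ?thesis by simp
  qed
  have "\<exists>\<eta>. is_cutoff K a b \<delta> \<eta>"
    if \<delta>: "0 < \<delta>" and ab: "\<And>i. a $ i \<le> b $ i" for a b :: "real^'n" and \<delta> :: real
  proof -
    \<comment> \<open>A rising step on [a_i - \<delta>/2, a_i] plus a falling step on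
      [b_i, b_i + \<delta>/2] minus 1, differentiated m times; the constant survives only for m =
      0.\<close>
    define f where "f i m t = (2 / \<delta>) ^ m * (X m (2 * (t - a $ i) / \<delta> + 1) + (-1) ^ m * X m (2 * (b $ i - t) / \<delta> + 1))
      - (if m = 0 then 1 else 0)" for i :: 'n and m t
    have fD: "(f i m has_real_derivative f i (Suc m) t) (at t)" for i m t
    proof -
      have 1: "((\<lambda>t. X m (2 * (t - a $ i) / \<delta> + 1)) has_real_derivative X (Suc m) (2 * (t - a $ i) / \<delta> + 1) * (2 / \<delta>)) (at t)"
        by (rule DERIV_chain2[OF X]) (use \<delta> in \<open>auto intro!: derivative_eq_intros\<close>)
      have 2: "((\<lambda>t. X m (2 * (b $ i - t) / \<delta> + 1)) has_real_derivative X (Suc m) (2 * (b $ i - t) / \<delta> + 1) * (- 2 / \<delta>)) (at t)"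
        by (rule DERIV_chain2[OF X]) (use \<delta> in \<open>auto intro!: derivative_eq_intros\<close>)
      show ?thesis unfolding f_def
        by (rule derivative_eq_intros 1 2 refl)+ (simp add: algebra_simps)
    qed
    have f01: "0 \<le> f i 0 t \<and> f i 0 t \<le> 1" for i t
    proof -
      have "2 * (t - a $ i) / \<delta> + 1 \<ge> 1 \<or> 2 * (b $ i - t) / \<delta> + 1 \<ge> 1"
        using ab[of i] \<delta> by (cases "t \<ge> a $ i") auto
      then show ?thesis unfolding f_def using X1 X01 by auto
    qed
    have f1: "f i 0 t = 1" if "a $ i \<le> t" "t \<le> b $ i" for i t
      using that \<delta> by (simp add: f_def X1)
    have f0: "f i 0 t = 0" if "t < a $ i - \<delta> / 2 \<or> b $ i + \<delta> / 2 < t" for i t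
    proof (cases "t < a $ i - \<delta> / 2")
      case True
      have "2 * (t - a $ i) / \<delta> + 1 \<le> 0" using True \<delta> by (simp add: field_simps)
      moreover have "2 * (b $ i - t) / \<delta> + 1 \<ge> 1" using True \<delta> ab[of i] by (simp add: field_simps)
      ultimately show ?thesis by (simp add: f_def X0 X1)
    next
      case False
      with that have "b $ i + \<delta> / 2 < t" by simp
      then have "2 * (b $ i - t) / \<delta> + 1 \<le> 0" "2 * (t - a $ i) / \<delta> + 1 \<ge> 1"
        using \<delta> ab[of i] by (simp_all add: field_simps)
      then show ?thesis by (simp add: f_def X0 X1)
    qed
    have fB: "\<bar>f i m t\<bar> \<le> c m / \<delta> ^ m" for i m t
    proof (cases "m = 0")
      case True
      then show ?thesis using f01[of i t] c1[of 0] by simp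
    next
      case False
      have "\<bar>f i m t\<bar> = (2 / \<delta>) ^ m * \<bar>X m (2 * (t - a $ i) / \<delta> + 1) + (-1) ^ m * X m (2 * (b $ i - t) / \<delta> + 1)\<bar>"
        using False \<delta> by (simp add: f_def abs_mult)
      also have "\<dots> \<le> (2 / \<delta>) ^ m * (B m + B m)"
      proof (rule mult_left_mono)
        have "\<bar>(-1) ^ m * X m (2 * (b $ i - t) / \<delta> + 1)\<bar> \<le> B m"
          using B by (simp add: abs_mult power_abs)
        with B[of m "2 * (t - a $ i) / \<delta> + 1"]
        show "\<bar>X m (2 * (t - a $ i) / \<delta> + 1) + (-1) ^ m * X m (2 * (b $ i - t) / \<delta> + 1)\<bar> \<le> B m + B m"
          by linarith
      qed (use \<delta> in simp)
      also have "\<dots> = (2 ^ Suc m * B m) / \<delta> ^ m" by (simp add: power_divide)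
      also have "\<dots> \<le> c m / \<delta> ^ m" using \<delta> by (simp add: c_def divide_right_mono)
      finally show ?thesis .
    qed
    define \<eta> where "\<eta> = (\<lambda>x::real^'n. \<Prod>i\<in>UNIV. f i 0 (x $ i))"
    have sm: "smooth_fn \<eta>" unfolding \<eta>_def by (rule smooth_fn_tensor[of f, OF fD])
    have it: "iter_pd is \<eta> = (\<lambda>x. \<Prod>i\<in>UNIV. f i (count_list is i) (x $ i))" for "is"
      unfolding \<eta>_def by (rule iter_pd_tensor[of f, OF fD])
    have itB: "\<bar>iter_pd is \<eta> x\<bar> \<le> K (length is) / \<delta> ^ length is" for "is" x
    proof -
      have "\<bar>iter_pd is \<eta> x\<bar> = (\<Prod>i\<in>UNIV. \<bar>f i (count_list is i) (x $ i)\<bar>)"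
        by (simp add: it abs_prod)
      also have "\<dots> \<le> (\<Prod>i\<in>UNIV. (\<Prod>j\<le>length is. c j) / \<delta> ^ count_list is i)"
      proof (rule prod_mono, intro conjI)
        fix i
        have "\<bar>f i (count_list is i) (x $ i)\<bar> \<le> c (count_list is i) / \<delta> ^ count_list is i" by (rule fB)
        also have "\<dots> \<le> (\<Prod>j\<le>length is. c j) / \<delta> ^ count_list is i"
          using \<delta> by (intro divide_right_mono cP count_le_length) auto
        finally show "\<bar>f i (count_list is i) (x $ i)\<bar> \<le> (\<Prod>j\<le>length is. c j) / \<delta> ^ count_list is i" .
      qed simp
      also have "\<dots> = K (length is) / \<delta> ^ (\<Sum>i\<in>UNIV. count_list is i)"
        by (simp add: prod_dividef K_def power_sum)
      also have "(\<Sum>i\<in>UNIV. count_list is i) = length is"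
        using mi_abs_count_list[of "is"] by (simp add: mi_abs_def)
      finally show ?thesis .
    qed
    have z: "\<eta> x = 0" if "x \<notin> cbox (a - (\<chi> i. \<delta> / 2)) (b + (\<chi> i. \<delta> / 2))" for x
    proof -
      from that obtain i where "x $ i < a $ i - \<delta> / 2 \<or> b $ i + \<delta> / 2 < x $ i"
        by (auto simp: mem_box_cart not_le)
      from f0[OF this] show ?thesis unfolding \<eta>_def by (intro prod_zero) auto
    qed
    show ?thesis
      unfolding is_cutoff_def
      by (rule exI[of _ \<eta>])
         (use sm itB z f01 f1 in \<open>auto simp: \<eta>_def mem_box_cart intro!: prod_nonneg prod_le_1\<close>)
  qed
  then show ?thesis using K1 by blast
qed

subsection \<open>The fundamental lemma of the calculus of variations\<close>

text \<open>Open boxes generate the Borel sets and are stable under intersection, so a Dynkin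
  argument extends the vanishing from boxes to all Borel sets. The vanishing total integral takes
  care of complements.\<close>

lemma AE_zero_if_box_integrals_zero:
  fixes f :: "'a::euclidean_space \<Rightarrow> real"
  assumes int: "integrable lborel f" and tot: "(LINT x|lborel. f x) = 0"
    and box: "\<And>a b. (LINT x:box a b|lborel. f x) = 0"
  shows "AE x in lborel. f x = 0"
proof (rule density_unique_real[OF int])
  show "integrable lborel (\<lambda>x. 0::real)" by simp
  fix A :: "'a set" assume "A \<in> sets lborel"
  then have A: "A \<in> sigma_sets UNIV (range (\<lambda>(a, b). box a b))"
    by (simp add: borel_eq_box)
  have "Int_stable (range (\<lambda>(a, b). box a b :: 'a set))"
    by (auto simp: Int_stable_def box_Int_box)
  moreover have "range (\<lambda>(a, b). box a b :: 'a set) \<subseteq> Pow UNIV" by auto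
  ultimately have "(LINT x:A|lborel. f x) = 0" using A
  proof (induction rule: sigma_sets_induct_disjoint)
    case (compl A)
    then have [measurable]: "A \<in> sets borel" by (simp add: borel_eq_box)
    have i: "integrable lborel (\<lambda>x. indicator A x *\<^sub>R f x)"
      by (rule integrable_mult_indicator[OF _ int]) simp
    have "(LINT x:UNIV - A|lborel. f x) = (LINT x|lborel. f x - indicator A x *\<^sub>R f x)"
      unfolding set_lebesgue_integral_def
      by (rule Bochner_Integration.integral_cong) (auto simp: indicator_def)
    also have "\<dots> = 0"
      using compl i int tot by (simp add: set_lebesgue_integral_def)
    finally show ?case .
  next
    case (union F)
    then have mF [measurable]: "F i \<in> sets lborel" for i
      by (auto simp: borel_eq_box subset_eq)
    have "(LINT x:(\<Union>i. F i)|lborel. f x) = (\<Sum>i. (LINT x:F i|lborel. f x))"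
    proof (rule lebesgue_integral_countable_add)
      show "F i \<inter> F j = {}" if "i \<noteq> j" for i j
        using union(1) that by (auto simp: disjoint_family_on_def)
      show "set_integrable lborel (\<Union>i. F i) f"
        unfolding set_integrable_def by (rule integrable_mult_indicator[OF _ int]) measurable
    qed (rule mF)
    then show ?case using union by simp
  qed (use box in \<open>auto simp: set_lebesgue_integral_def\<close>)
  then show "(LINT x:A|lborel. f x) = (LINT x:A|lborel. 0)" by simp
qed

text \<open>Cutoffs equal to 1 on the box shrunk by a margin that tends to 0, with the transition
  layer inside this margin.\<close>

lemma box_indicator_approx:
  fixes c d :: "real^'n::finite"
  assumes "\<And>i. c $ i < d $ i"
  shows "\<exists>\<phi>. (\<forall>n. test_fn (box c d) (\<phi> n) \<and> (\<forall>x. 0 \<le> \<phi> n x \<and> \<phi> n x \<le> 1)) \<and>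
    (\<forall>x. (\<lambda>n::nat. \<phi> n x) \<longlonglongrightarrow> indicator (box c d) x)"
proof -
  \<comment> \<open>Half the shortest side: shrinking by \<open>e n\<close> \<le> r at both ends
    leaves a nonempty closed box.\<close>
  define r where "r = Min (range (\<lambda>i. d $ i - c $ i)) / 2"
  have r: "0 < r" unfolding r_def using assms by simp
  have r2: "2 * r \<le> d $ i - c $ i" for i unfolding r_def by simp
  define e where "e n = r / real (Suc n)" for n
  have e: "0 < e n" "e n \<le> r" for n using r by (auto simp: e_def divide_le_eq_1 field_simps)
  have e0: "e \<longlonglongrightarrow> 0" unfolding e_def
    using tendsto_mult_right_zero[OF LIMSEQ_inverse_real_of_nat, of r] by (simp add: divide_inverse)
  let ?a = "\<lambda>n. c + (\<chi> i. e n)" and ?b = "\<lambda>n. d - (\<chi> i. e n)"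
  obtain K :: "nat \<Rightarrow> real" where K: "\<And>(a :: real^'n) b \<delta>. 0 < \<delta> \<Longrightarrow> (\<forall>i. a $ i \<le> b $ i) \<Longrightarrow>
     (\<exists>\<eta>. is_cutoff K a b \<delta> \<eta>)"
    using cutoff_exists[where ?'n = 'n] by blast
  have "\<exists>\<eta>. smooth_fn \<eta> \<and> (\<forall>x. 0 \<le> \<eta> x \<and> \<eta> x \<le> 1) \<and> (\<forall>x\<in>cbox (?a n) (?b n). \<eta> x = 1) \<and>
        (\<forall>x. x \<notin> cbox (?a n - (\<chi> i. e n / 2)) (?b n + (\<chi> i. e n / 2)) \<longrightarrow> \<eta> x = 0)" for n
  proof -
    have "\<forall>i. ?a n $ i \<le> ?b n $ i"
    proof
      fix i show "?a n $ i \<le> ?b n $ i" using r2[of i] e(2)[of n] by simp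
    qed
    from K[OF e(1)[of n] this] show ?thesis unfolding is_cutoff_def by blast
  qed
  then obtain \<phi> where \<phi>: "\<And>n. smooth_fn (\<phi> n)" "\<And>n x. 0 \<le> \<phi> n x \<and> \<phi> n x \<le> 1"
    "\<And>n x. x \<in> cbox (?a n) (?b n) \<Longrightarrow> \<phi> n x = 1"
    "\<And>n x. x \<notin> cbox (?a n - (\<chi> i. e n / 2)) (?b n + (\<chi> i. e n / 2)) \<Longrightarrow> \<phi> n x = 0" by metis
  have sub: "cbox (?a n - (\<chi> i. e n / 2)) (?b n + (\<chi> i. e n / 2)) \<subseteq> box c d" for n
  proof
    fix x assume x: "x \<in> cbox (?a n - (\<chi> i. e n / 2)) (?b n + (\<chi> i. e n / 2))"
    have "c $ i < x $ i \<and> x $ i < d $ i" for i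
      using x[unfolded mem_box_cart, rule_format, of i] e(1)[of n] by simp
    then show "x \<in> box c d" by (simp add: mem_box_cart)
  qed
  have "test_fn (box c d) (\<phi> n)" for n
    by (rule test_fnI[OF \<phi>(1) compact_cbox sub \<phi>(4)])
  moreover have "(\<lambda>n. \<phi> n x) \<longlonglongrightarrow> indicator (box c d) x" for x
  proof (cases "x \<in> box c d")
    case False
    then have "\<phi> n x = 0" for n using sub \<phi>(4) by blast
    with False show ?thesis by simp
  next
    case True
    define m where "m = Min (range (\<lambda>i. min (x $ i - c $ i) (d $ i - x $ i)))"
    have m: "0 < m" unfolding m_def using True by (simp add: mem_box_cart)
    have m2: "m \<le> min (x $ i - c $ i) (d $ i - x $ i)" for i unfolding m_def by (rule Min_le) auto
    have "\<forall>\<^sub>F n in sequentially. e n < m" using order_tendstoD(2)[OF e0 m] .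
    then have "\<forall>\<^sub>F n in sequentially. \<phi> n x = indicator (box c d) x"
    proof eventually_elim
      case (elim n)
      have "x \<in> cbox (?a n) (?b n)"
        unfolding mem_box_cart
      proof
        fix i show "?a n $ i \<le> x $ i \<and> x $ i \<le> ?b n $ i" using m2[of i] elim by simp
      qed
      from \<phi>(3)[OF this] True show ?case by simp
    qed
    then show ?thesis by (rule tendsto_eventually)
  qed
  ultimately show ?thesis using \<phi>(2) by blast
qed

lemma cbox_minus_box_null: "AE x in lborel. x \<in> cbox a b \<longrightarrow> x \<in> box a (b::'a::euclidean_space)"
proof -
  have "cbox a b - box a b \<in> null_sets lborel"
  proof (rule null_setsI)
    have "emeasure lborel (cbox a b - box a b) = emeasure lborel (cbox a b) - emeasure lborel (box a b)"
      by (rule emeasure_Diff) (auto simp: emeasure_lborel_box_eq box_subset_cbox)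
    also have "\<dots> = 0"
      by (auto simp: emeasure_lborel_box_eq emeasure_lborel_cbox_eq)
    finally show "emeasure lborel (cbox a b - box a b) = 0" .
  qed simp
  from AE_not_in[OF this] show ?thesis by eventually_elim auto
qed

lemma test_fn_borel: "test_fn U \<phi> \<Longrightarrow> \<phi> \<in> borel_measurable borel"
  by (rule borel_measurable_continuous_onI) (auto simp: test_fn_def continuous_on_smooth)

text \<open>U is a countable union of compact boxes. Inside each of them dominated convergence along
  smooth approximations of box indicators shows that g has integral 0 over every smaller open
  box.\<close>

lemma fundamental_lemma:
  fixes g :: "real^'n::finite \<Rightarrow> real"
  assumes [measurable]: "g \<in> borel_measurable borel" and "open U"
    and int: "\<And>a b. cbox a b \<subseteq> U \<Longrightarrow> set_integrable lborel (cbox a b) g"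
    and zero: "\<And>\<phi>. test_fn U \<phi> \<Longrightarrow> (LINT x|lborel. g x * \<phi> x) = 0"
  shows "AE x in lborel. x \<in> U \<longrightarrow> g x = 0"
proof -
  obtain D where D: "countable D" "\<And>X. X \<in> D \<Longrightarrow> \<exists>a b. X = cbox a b" "\<Union>D = U"
    using open_countable_Union_open_cbox[OF \<open>open U\<close>] by metis
  have "AE x in lborel. x \<in> X \<longrightarrow> g x = 0" if X: "X \<in> D" for X
  proof -
    obtain a b where ab: "X = cbox a b" using D(2)[OF X] by blast
    have sub: "cbox a b \<subseteq> U" using X ab D(3) by blast
    have iC: "integrable lborel (\<lambda>x. indicator (box a b) x * g x)"
      using set_integrable_subset[OF int[OF sub], of "box a b"] box_subset_cbox[of a b]
      by (simp add: set_integrable_def)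
    have bz: "(LINT x|lborel. indicator (box c d) x * g x) = 0" if cd: "box c d \<subseteq> box a b" for c d
    proof (cases "\<forall>i. c $ i < d $ i")
      case False
      then obtain i where "d $ i \<le> c $ i" by (auto simp: not_less)
      then have "x \<notin> box c d" for x by (auto simp: mem_box_cart intro!: exI[of _ i])
      then have "box c d = {}" by blast
      then show ?thesis by simp
    next
      case True
      then obtain \<phi> where \<phi>: "\<And>n. test_fn (box c d) (\<phi> n)" "\<And>n x. 0 \<le> \<phi> n x \<and> \<phi> n x \<le> 1"
        "\<And>x. (\<lambda>n::nat. \<phi> n x) \<longlonglongrightarrow> indicator (box c d) x"
        using box_indicator_approx[of c d] by blast
      have [measurable]: "\<phi> n \<in> borel_measurable borel" for n using \<phi>(1) test_fn_borel by blast
      have "box c d \<subseteq> U" using cd sub box_subset_cbox by blast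
      then have z: "(LINT x|lborel. g x * \<phi> n x) = 0" for n
        using zero test_fn_mono[OF \<phi>(1)] by blast
      have "(\<lambda>n. LINT x|lborel. g x * \<phi> n x) \<longlonglongrightarrow> (LINT x|lborel. indicator (box c d) x * g x)"
      proof (rule integral_dominated_convergence[where w = "\<lambda>x. \<bar>indicator (box a b) x * g x\<bar>"])
        show "AE x in lborel. (\<lambda>n. g x * \<phi> n x) \<longlonglongrightarrow> indicator (box c d) x * g x"
          using tendsto_mult_left[OF \<phi>(3)] by (auto simp: mult.commute)
        show "AE x in lborel. norm (g x * \<phi> n x) \<le> \<bar>indicator (box a b) x * g x\<bar>" for n
        proof (rule AE_I2)
          fix x
          show "norm (g x * \<phi> n x) \<le> \<bar>indicator (box a b) x * g x\<bar>"
          proof (cases "x \<in> box a b")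
            case True
            then show ?thesis using \<phi>(2)[of n x] by (simp add: abs_mult mult_left_le)
          next
            case False
            then have "x \<notin> tsupp (\<phi> n)" using \<phi>(1)[of n] cd by (auto simp: test_fn_def)
            then show ?thesis using iter_pd_zero_outside[of x "\<phi> n" "[]"] by simp
          qed
        qed
      qed (use iC in auto)
      then show ?thesis unfolding z by (simp add: LIMSEQ_const_iff)
    qed
    have "AE x in lborel. indicator (box a b) x * g x = 0"
    proof (rule AE_zero_if_box_integrals_zero[OF iC])
      show "(LINT x|lborel. indicator (box a b) x * g x) = 0" by (rule bz) simp
      fix c d
      have "(LINT x:box c d|lborel. indicator (box a b) x * g x)
          = (LINT x|lborel. indicator (box c d \<inter> box a b) x * g x)"
        by (simp add: set_lebesgue_integral_def indicator_inter_arith mult.assoc)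
      moreover obtain c' d' where "box c d \<inter> box a b = box c' d'"
        using box_Int_box[of c d a b] by blast
      then have "box c d \<inter> box a b = box c' d' \<and> box c' d' \<subseteq> box a b" by auto
      with bz[of c' d'] have "(LINT x|lborel. indicator (box c d \<inter> box a b) x * g x) = 0" by simp
      ultimately show "(LINT x:box c d|lborel. indicator (box a b) x * g x) = 0" by simp
    qed
    then show ?thesis unfolding ab using cbox_minus_box_null[of a b]
      by eventually_elim auto
  qed
  then have "AE x in lborel. \<forall>X\<in>D. x \<in> X \<longrightarrow> g x = 0"
    unfolding AE_ball_countable[OF D(1)] by blast
  then show ?thesis
  proof eventually_elim
    case (elim x)
    then show ?case unfolding D(3)[symmetric] by auto
  qed
qed

subsection \<open>Locally square integrable functions\<close>

text \<open>Borel rather than Lebesgue measurability keeps maps such as (s, x) to g (x + s z)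
  measurable for Fubini. Integrability is local because derivatives of order below kmin of an
  element of V are obtained only locally.\<close>

definition l2loc :: "(real^'n::finite \<Rightarrow> real) \<Rightarrow> bool" where
  "l2loc g \<longleftrightarrow> g \<in> borel_measurable borel \<and> (\<forall>a b. set_integrable lborel (cbox a b) (\<lambda>x. (g x)\<^sup>2))"

lemma l2loc_borel: "l2loc g \<Longrightarrow> g \<in> borel_measurable borel"
  by (simp add: l2loc_def)

lemma set_integrable_mult_squares:
  fixes f g :: "'a \<Rightarrow> real"
  assumes [measurable]: "f \<in> borel_measurable M" "g \<in> borel_measurable M" "S \<in> sets M"
    and "set_integrable M S (\<lambda>x. (f x)\<^sup>2)" "set_integrable M S (\<lambda>x. (g x)\<^sup>2)"
  shows "set_integrable M S (\<lambda>x. f x * g x)"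
proof (rule set_integrable_bound)
  show "set_integrable M S (\<lambda>x. (f x)\<^sup>2 + (g x)\<^sup>2)" using assms by (intro set_integral_add)
  show "AE x in M. x \<in> S \<longrightarrow> norm (f x * g x) \<le> norm ((f x)\<^sup>2 + (g x)\<^sup>2)"
  proof (intro AE_I2 impI)
    fix x
    have "2 * \<bar>f x\<bar> * \<bar>g x\<bar> \<le> \<bar>f x\<bar>\<^sup>2 + \<bar>g x\<bar>\<^sup>2" by (rule sum_squares_bound)
    moreover have "0 \<le> \<bar>f x\<bar> * \<bar>g x\<bar>" by simp
    ultimately have "\<bar>f x\<bar> * \<bar>g x\<bar> \<le> (f x)\<^sup>2 + (g x)\<^sup>2" unfolding power2_abs by linarith
    then show "norm (f x * g x) \<le> norm ((f x)\<^sup>2 + (g x)\<^sup>2)" by (simp add: abs_mult)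
  qed
qed (simp add: set_borel_measurable_def)

lemma set_integrable_continuous_compact:
  fixes f :: "'a::euclidean_space \<Rightarrow> real"
  shows "compact S \<Longrightarrow> continuous_on S f \<Longrightarrow> set_integrable lborel S f"
  unfolding set_integrable_def by (rule borel_integrable_compact)

lemma l2loc_mult_integrable:
  assumes "l2loc f" "l2loc g"
  shows "set_integrable lborel (cbox a b) (\<lambda>x. f x * g x)"
  using assms unfolding l2loc_def by (intro set_integrable_mult_squares) simp_all

lemma l2loc_continuous: "continuous_on UNIV f \<Longrightarrow> l2loc f"
  unfolding l2loc_def
  by (intro conjI allI borel_measurable_continuous_onI set_integrable_continuous_compact
      continuous_on_power compact_cbox) (auto elim: continuous_on_subset)

lemma l2loc_const: "l2loc (\<lambda>x. c)"
  by (rule l2loc_continuous) auto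

lemma l2loc_integrable: "l2loc g \<Longrightarrow> set_integrable lborel (cbox a b) g"
  using l2loc_mult_integrable[OF _ l2loc_const[of 1]] by simp

lemma l2loc_cmult: "l2loc g \<Longrightarrow> l2loc (\<lambda>x. c * g x)"
  unfolding l2loc_def by (auto simp: power_mult_distrib)

lemma l2loc_bound:
  assumes "l2loc h" "g \<in> borel_measurable borel" "\<And>x. \<bar>g x\<bar> \<le> \<bar>h x\<bar>"
  shows "l2loc g"
  unfolding l2loc_def
proof (intro conjI allI)
  fix a b
  show "set_integrable lborel (cbox a b) (\<lambda>x. (g x)\<^sup>2)"
  proof (rule set_integrable_bound)
    show "set_integrable lborel (cbox a b) (\<lambda>x. (h x)\<^sup>2)" using assms by (simp add: l2loc_def)
    show "set_borel_measurable lborel (cbox a b) (\<lambda>x. (g x)\<^sup>2)"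
      using assms(2) by (simp add: set_borel_measurable_def)
    show "AE x in lborel. x \<in> cbox a b \<longrightarrow> norm ((g x)\<^sup>2) \<le> norm ((h x)\<^sup>2)"
      using assms(3) by (auto simp: abs_le_square_iff)
  qed
qed (rule assms)

lemma l2loc_add:
  assumes f: "l2loc f" and g: "l2loc g" shows "l2loc (\<lambda>x. f x + g x)"
  unfolding l2loc_def
proof (intro conjI allI)
  show "(\<lambda>x. f x + g x) \<in> borel_measurable borel"
    using l2loc_borel[OF f] l2loc_borel[OF g] by measurable
  fix a b
  have "set_integrable lborel (cbox a b) (\<lambda>x. (f x)\<^sup>2 + (g x)\<^sup>2 + 2 * (f x * g x))"
    using f g l2loc_mult_integrable[OF f g]
    by (intro set_integral_add set_integrable_mult_right) (auto simp: l2loc_def)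
  then show "set_integrable lborel (cbox a b) (\<lambda>x. (f x + g x)\<^sup>2)"
    by (simp add: power2_sum algebra_simps)
qed

lemma l2loc_sum: "(\<And>i. i \<in> I \<Longrightarrow> l2loc (f i)) \<Longrightarrow> l2loc (\<lambda>x. \<Sum>i\<in>I. f i x)"
  by (induction I rule: infinite_finite_induct) (auto intro: l2loc_add l2loc_const)

lemma l2loc_mult_bounded:
  assumes "l2loc g" "h \<in> borel_measurable borel" "\<And>x. \<bar>h x\<bar> \<le> B"
  shows "l2loc (\<lambda>x. h x * g x)"
proof (rule l2loc_bound)
  show "l2loc (\<lambda>x. B * g x)" by (rule l2loc_cmult[OF assms(1)])
  show "(\<lambda>x. h x * g x) \<in> borel_measurable borel"
    using assms(2) l2loc_borel[OF assms(1)] by measurable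
  show "\<bar>h x * g x\<bar> \<le> \<bar>B * g x\<bar>" for x
    using assms(3)[of x] by (auto simp: abs_mult intro!: mult_right_mono)
qed

lemma l2loc_test_fn: "test_fn U \<phi> \<Longrightarrow> l2loc \<phi>"
  by (rule l2loc_continuous) (auto simp: test_fn_def continuous_on_smooth)

lemma l2loc_test_integrable:
  assumes "l2loc g" "test_fn U \<phi>"
  shows "integrable lborel (\<lambda>x. g x * \<phi> x)"
proof -
  obtain a b where ab: "\<And>is x. x \<notin> cbox a b \<Longrightarrow> iter_pd is \<phi> x = 0"
    using test_fn_bounded_support[OF assms(2)] by blast
  have "(\<lambda>x. indicator (cbox a b) x *\<^sub>R (g x * \<phi> x)) = (\<lambda>x. g x * \<phi> x)"
  proof
    fix x show "indicator (cbox a b) x *\<^sub>R (g x * \<phi> x) = g x * \<phi> x"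
      using ab[of x "[]"] by (cases "x \<in> cbox a b") simp_all
  qed
  then show ?thesis
    using l2loc_mult_integrable[OF assms(1) l2loc_test_fn[OF assms(2)], of a b]
    unfolding set_integrable_def by simp
qed

lemma test_fn_bounded:
  assumes "test_fn U \<phi>" obtains M where "\<And>x. \<bar>\<phi> x\<bar> \<le> M"
proof -
  have "bounded (\<phi> ` tsupp \<phi>)"
    using assms by (intro compact_imp_bounded compact_continuous_image) (auto simp: test_fn_def continuous_on_smooth)
  then obtain M where M: "\<And>x. x \<in> tsupp \<phi> \<Longrightarrow> \<bar>\<phi> x\<bar> \<le> M"
    unfolding bounded_iff by (metis imageI real_norm_def)
  have "\<bar>\<phi> x\<bar> \<le> max M 0" for x
    using M[of x] iter_pd_zero_outside[of x \<phi> "[]"] by (cases "x \<in> tsupp \<phi>") auto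
  then show ?thesis using that by blast
qed

section \<open>Translation invariance, and Jensen's inequality on the unit interval\<close>

lemma nn_integral_translate:
  fixes f :: "'a::euclidean_space \<Rightarrow> ennreal"
  assumes [measurable]: "f \<in> borel_measurable borel"
  shows "(\<integral>\<^sup>+x. f (x + c) \<partial>lborel) = (\<integral>\<^sup>+x. f x \<partial>lborel)"
  by (subst lborel_distr_plus[of c, symmetric]) (simp add: nn_integral_distr add.commute)

lemma integral_translate:
  fixes f :: "'a::euclidean_space \<Rightarrow> real"
  assumes [measurable]: "f \<in> borel_measurable borel"
  shows "(LINT x|lborel. f (x + c)) = (LINT x|lborel. f x)"
  by (subst lborel_distr_plus[of c, symmetric]) (simp add: integral_distr add.commute)

text \<open>Cauchy-Schwarz against the constant 1. If f is not integrable, the integral on the left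
  is 0 by convention.\<close>

lemma nn_integral_unit_interval_square:
  fixes f :: "real \<Rightarrow> real"
  assumes [measurable]: "f \<in> borel_measurable borel"
  shows "ennreal ((LINT s:{0..1}|lborel. f s)\<^sup>2) \<le> (\<integral>\<^sup>+s. indicator {0..1} s * ennreal ((f s)\<^sup>2) \<partial>lborel)"
proof (cases "set_integrable lborel {0..1} f")
  case False
  then show ?thesis by (simp add: set_lebesgue_integral_def set_integrable_def not_integrable_integral_eq)
next
  case True
  let ?I = "LINT s:{0..1}|lborel. f s"
  have "ennreal \<bar>?I\<bar> \<le> (\<integral>\<^sup>+s. ennreal (norm (indicator {0..1} s *\<^sub>R f s)) \<partial>lborel)"
    using integral_norm_bound_ennreal[OF True[unfolded set_integrable_def]]
    by (simp add: set_lebesgue_integral_def)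
  also have "\<dots> = (\<integral>\<^sup>+s. (indicator {0..1} s * ennreal \<bar>f s\<bar>) * indicator {0..1} s \<partial>lborel)"
    by (rule nn_integral_cong) (auto simp: indicator_def)
  finally have "(ennreal \<bar>?I\<bar>)\<^sup>2 \<le> (\<integral>\<^sup>+s. (indicator {0..1} s * ennreal \<bar>f s\<bar>) * indicator {0..1} s \<partial>lborel)\<^sup>2"
    by (rule power_mono) simp
  also have "\<dots> \<le> (\<integral>\<^sup>+s. (indicator {0..1} s * ennreal \<bar>f s\<bar>)\<^sup>2 \<partial>lborel) * (\<integral>\<^sup>+s. (indicator {0..1::real} s)\<^sup>2 \<partial>lborel)"
    by (rule Cauchy_Schwarz_nn_integral) measurable
  also have "(\<integral>\<^sup>+s. (indicator {0..1::real} s)\<^sup>2 \<partial>lborel) = (\<integral>\<^sup>+s. indicator {0..1::real} s \<partial>lborel)"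
    by (rule nn_integral_cong) (auto simp: indicator_def)
  also have "\<dots> = 1" by simp
  also have "(\<integral>\<^sup>+s. (indicator {0..1} s * ennreal \<bar>f s\<bar>)\<^sup>2 \<partial>lborel)
      = (\<integral>\<^sup>+s. indicator {0..1} s * ennreal ((f s)\<^sup>2) \<partial>lborel)"
    by (rule nn_integral_cong) (auto simp: indicator_def ennreal_power)
  finally show ?thesis by (simp add: ennreal_power)
qed

subsection \<open>Averages along segments\<close>

text \<open>The substitute for mollification: it maps test functions to test functions for
  continuous \<kappa>, commutes with derivatives, and its adjoint is the same average in direction
  -z.\<close>

definition line_avg :: "(real \<Rightarrow> real) \<Rightarrow> real^'n::finite \<Rightarrow> (real^'n \<Rightarrow> real) \<Rightarrow> real^'n \<Rightarrow> real" where
  "line_avg \<kappa> z f x = (LINT s:{0..1}|lborel. \<kappa> s * f (x + s *\<^sub>R z))"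

lemma line_avg_eq_integral:
  assumes "continuous_on UNIV \<kappa>" "continuous_on UNIV f"
  shows "(\<lambda>s. \<kappa> s * f (x + s *\<^sub>R z)) integrable_on {0..1}"
    and "line_avg \<kappa> z f x = integral {0..1} (\<lambda>s. \<kappa> s * f (x + s *\<^sub>R z))"
proof -
  have "continuous_on {0..1} (\<lambda>s. f (x + s *\<^sub>R z))"
    by (rule continuous_on_compose2[OF assms(2)]) (auto intro!: continuous_intros)
  then have "set_integrable lborel {0..1} (\<lambda>s. \<kappa> s * f (x + s *\<^sub>R z))"
    by (intro set_integrable_continuous_compact continuous_on_mult
        continuous_on_subset[OF assms(1)]) auto
  from set_borel_integral_eq_integral[OF this]
  show "(\<lambda>s. \<kappa> s * f (x + s *\<^sub>R z)) integrable_on {0..1}"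
    "line_avg \<kappa> z f x = integral {0..1} (\<lambda>s. \<kappa> s * f (x + s *\<^sub>R z))"
    by (simp_all add: line_avg_def)
qed

lemma smooth_has_derivative:
  fixes f :: "real^'n::finite \<Rightarrow> real"
  assumes "f differentiable (at y)"
  shows "(f has_derivative (\<lambda>h. \<Sum>i\<in>UNIV. pd i f y * h $ i)) (at y)"
proof -
  have D: "(f has_derivative frechet_derivative f (at y)) (at y)"
    using assms frechet_derivative_works by blast
  have lin: "linear (frechet_derivative f (at y))" using D has_derivative_linear by blast
  have "frechet_derivative f (at y) h = (\<Sum>i\<in>UNIV. pd i f y * h $ i)" for h
  proof -
    have "h = (\<Sum>i\<in>UNIV. h $ i *\<^sub>R axis i 1)"
      by (simp add: basis_expansion scalar_mult_eq_scaleR[symmetric])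
    then have "frechet_derivative f (at y) h = frechet_derivative f (at y) (\<Sum>i\<in>UNIV. h $ i *\<^sub>R axis i 1)" by simp
    then show ?thesis by (simp add: linear_sum[OF lin] linear_scale[OF lin] pd_def mult.commute)
  qed
  then have "frechet_derivative f (at y) = (\<lambda>h. \<Sum>i\<in>UNIV. pd i f y * h $ i)" by (rule ext)
  with D show ?thesis by simp
qed

lemma line_avg_smooth_derivative:
  fixes f :: "real^'n::finite \<Rightarrow> real"
  assumes \<kappa>: "continuous_on UNIV \<kappa>" and f: "smooth_fn f"
  shows "line_avg \<kappa> z f differentiable (at x)"
    and "pd i (line_avg \<kappa> z f) x = line_avg \<kappa> z (pd i f) x"
proof -
  \<comment> \<open>The derivative in x of the integrand, as a bounded linear functional, for
    differentiation under the integral sign.\<close>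
  define D :: "real^'n \<Rightarrow> real \<Rightarrow> (real^'n) \<Rightarrow>\<^sub>L real" where
    "D x s = (\<Sum>i\<in>UNIV. (\<kappa> s * pd i f (x + s *\<^sub>R z)) *\<^sub>R blinfun_inner_left (axis i 1))" for x s
  have Dapp: "D x s h = (\<Sum>i\<in>UNIV. \<kappa> s * pd i f (x + s *\<^sub>R z) * h $ i)" for x s h
    by (simp add: D_def blinfun.bilinear_simps cart_eq_inner_axis)
  have cpd: "continuous_on A (pd i f)" for i A
    by (rule continuous_on_smooth[OF smooth_fn_pd[OF f]])
  have cf: "continuous_on UNIV f" by (rule continuous_on_smooth[OF f])
  have cD: "continuous_on A (\<lambda>(x, s). D x s)" for A
    unfolding D_def case_prod_beta
    by (intro continuous_intros continuous_on_compose2[OF \<kappa>] continuous_on_compose2[OF cpd[of UNIV]]) auto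
  have "((\<lambda>x. integral (cbox 0 1) (\<lambda>s. \<kappa> s * f (x + s *\<^sub>R z))) has_derivative
     blinfun_apply (integral (cbox 0 1) (D x))) (at x within UNIV)"
  proof (rule leibniz_rule)
    fix y :: "real^'n" and s :: real
    have "((\<lambda>x. x + s *\<^sub>R z) has_derivative (\<lambda>h. h)) (at y)" by (auto intro!: derivative_eq_intros)
    from diff_chain_at[OF this smooth_has_derivative[OF smooth_fnD[OF f]]]
    have "((\<lambda>x. f (x + s *\<^sub>R z)) has_derivative (\<lambda>h. \<Sum>i\<in>UNIV. pd i f (y + s *\<^sub>R z) * h $ i)) (at y)"
      by (simp add: o_def)
    from has_derivative_mult_right[OF this, of "\<kappa> s"]
    show "((\<lambda>x. \<kappa> s * f (x + s *\<^sub>R z)) has_derivative blinfun_apply (D y s)) (at y within UNIV)"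
      by (simp add: Dapp[abs_def] sum_distrib_left mult.assoc)
  next
    show "(\<lambda>s. \<kappa> s * f (y + s *\<^sub>R z)) integrable_on cbox 0 1" for y
      using line_avg_eq_integral(1)[OF \<kappa> cf] by simp
  qed (auto intro: cD)
  moreover have "(\<lambda>x. integral (cbox 0 1) (\<lambda>s. \<kappa> s * f (x + s *\<^sub>R z))) = line_avg \<kappa> z f"
    by (simp add: fun_eq_iff line_avg_eq_integral(2)[OF \<kappa> cf])
  ultimately have *: "(line_avg \<kappa> z f has_derivative blinfun_apply (integral (cbox 0 1) (D x))) (at x)"
    by simp
  then show "line_avg \<kappa> z f differentiable (at x)" by (rule differentiableI)
  have "continuous_on (cbox 0 1) (\<lambda>s. D x s)"
    using continuous_on_compose2[OF cD[of UNIV], of "cbox 0 1" "\<lambda>s. (x, s)"]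
      continuous_on_Pair[OF continuous_on_const[of _ x] continuous_on_id[of "cbox (0::real) 1"]] by simp
  then have "D x integrable_on cbox 0 1" by (rule integrable_continuous)
  then have "pd i (line_avg \<kappa> z f) x = integral (cbox 0 1) (\<lambda>s. D x s (axis i 1))"
    unfolding has_derivative_imp_pd[OF *] by (rule blinfun_apply_integral)
  also have "(\<lambda>s. D x s (axis i 1)) = (\<lambda>s. \<kappa> s * pd i f (x + s *\<^sub>R z))"
    by (simp add: Dapp axis_def fun_eq_iff if_distrib cong: if_cong)
  also have "integral (cbox 0 1) \<dots> = line_avg \<kappa> z (pd i f) x"
    by (simp add: line_avg_eq_integral(2)[OF \<kappa> cpd])
  finally show "pd i (line_avg \<kappa> z f) x = line_avg \<kappa> z (pd i f) x" .
qed

lemma pd_line_avg: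
  "continuous_on UNIV \<kappa> \<Longrightarrow> smooth_fn f \<Longrightarrow> pd i (line_avg \<kappa> z f) = line_avg \<kappa> z (pd i f)"
  by (rule ext) (rule line_avg_smooth_derivative(2))

lemma smooth_fn_line_avg:
  assumes "continuous_on UNIV \<kappa>" "smooth_fn f" shows "smooth_fn (line_avg \<kappa> z f)"
proof (rule smooth_fn_coinduct[where S = "line_avg \<kappa> z ` {f. smooth_fn f}"])
  show "line_avg \<kappa> z f \<in> line_avg \<kappa> z ` {f. smooth_fn f}" using assms by blast
qed (use assms(1) in \<open>auto simp: line_avg_smooth_derivative(1) pd_line_avg smooth_fn_pd\<close>)

lemma cbox_segment:
  fixes a b z :: "real^'n::finite"
  shows "\<bar>s\<bar> \<le> 1 \<Longrightarrow> x + s *\<^sub>R z \<in> cbox a b \<Longrightarrow> x \<in> cbox (a - (\<chi> i. \<bar>z $ i\<bar>)) (b + (\<chi> i. \<bar>z $ i\<bar>))"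
proof -
  assume s: "\<bar>s\<bar> \<le> 1" and x: "x + s *\<^sub>R z \<in> cbox a b"
  have "a $ i - \<bar>z $ i\<bar> \<le> x $ i \<and> x $ i \<le> b $ i + \<bar>z $ i\<bar>" for i
  proof -
    have "\<bar>s * z $ i\<bar> \<le> \<bar>z $ i\<bar>" using s by (simp add: abs_mult mult_left_le_one_le)
    moreover have "a $ i \<le> x $ i + s * z $ i \<and> x $ i + s * z $ i \<le> b $ i"
      using x by (simp add: mem_box_cart)
    ultimately show ?thesis by linarith
  qed
  then show ?thesis by (simp add: mem_box_cart)
qed

lemma test_fn_line_avg:
  assumes "continuous_on UNIV \<kappa>" "test_fn UNIV \<phi>"
  shows "test_fn UNIV (line_avg \<kappa> z \<phi>)"
proof -
  obtain a b where ab: "\<And>is x. x \<notin> cbox a b \<Longrightarrow> iter_pd is \<phi> x = 0"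
    using test_fn_bounded_support[OF assms(2)] by blast
  show ?thesis
  proof (rule test_fnI[OF _ compact_cbox])
    show "smooth_fn (line_avg \<kappa> z \<phi>)" using assms by (simp add: smooth_fn_line_avg test_fn_def)
    fix x assume x: "x \<notin> cbox (a - (\<chi> i. \<bar>z $ i\<bar>)) (b + (\<chi> i. \<bar>z $ i\<bar>))"
    have "indicator {0..1} s *\<^sub>R (\<kappa> s * \<phi> (x + s *\<^sub>R z)) = 0" for s :: real
    proof (cases "s \<in> {0..1}")
      case True
      then have "x + s *\<^sub>R z \<notin> cbox a b" using cbox_segment[of s x z a b] x by auto
      from ab[OF this, of "[]"] show ?thesis by simp
    qed simp
    then show "line_avg \<kappa> z \<phi> x = 0"
      unfolding line_avg_def set_lebesgue_integral_def by (simp only: Bochner_Integration.integral_zero)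
  qed simp
qed

lemma kernel_bounded:
  fixes \<kappa> :: "real \<Rightarrow> real"
  assumes "continuous_on UNIV \<kappa>" obtains K where "0 \<le> K" "\<And>s. s \<in> {0..1} \<Longrightarrow> \<bar>\<kappa> s\<bar> \<le> K"
proof -
  have "bounded (\<kappa> ` {0..1})"
    by (intro compact_imp_bounded compact_continuous_image continuous_on_subset[OF assms]) auto
  then obtain K where K: "\<And>s. s \<in> {0..1} \<Longrightarrow> \<bar>\<kappa> s\<bar> \<le> K"
    unfolding bounded_iff by (metis imageI real_norm_def)
  moreover have "0 \<le> K" using K[of 0] by simp
  ultimately show ?thesis using that by blast
qed

lemma integrable_pair_unit_interval:
  fixes F :: "real \<times> 'a::euclidean_space \<Rightarrow> real"
  assumes [measurable]: "F \<in> borel_measurable (lborel \<Otimes>\<^sub>M lborel)"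
    and b: "\<And>s. (\<integral>\<^sup>+x. ennreal \<bar>F (s, x)\<bar> \<partial>lborel) \<le> C * indicator {0..1} s" and C: "C < \<infinity>"
  shows "integrable (lborel \<Otimes>\<^sub>M lborel) F"
proof (rule integrableI_bounded)
  have "(\<integral>\<^sup>+p. ennreal (norm (F p)) \<partial>(lborel \<Otimes>\<^sub>M lborel)) = (\<integral>\<^sup>+s. \<integral>\<^sup>+x. ennreal \<bar>F (s, x)\<bar> \<partial>lborel \<partial>lborel)"
    by (subst lborel.nn_integral_fst[symmetric]) auto
  also have "\<dots> \<le> (\<integral>\<^sup>+s. C * indicator {0..1} s \<partial>(lborel::real measure))"
    by (rule nn_integral_mono) (rule b)
  also have "\<dots> = C" by (simp add: nn_integral_cmult_indicator)
  also note C
  finally show "(\<integral>\<^sup>+p. ennreal (norm (F p)) \<partial>(lborel \<Otimes>\<^sub>M lborel)) < \<infinity>" .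
qed simp

lemma line_avg_borel:
  assumes "continuous_on UNIV \<kappa>" and [measurable]: "g \<in> borel_measurable borel"
  shows "line_avg \<kappa> z g \<in> borel_measurable borel"
proof -
  have [measurable]: "\<kappa> \<in> borel_measurable borel" using assms(1) by (rule borel_measurable_continuous_onI)
  have "(\<lambda>x. LINT s|lborel. indicator {0..1} s *\<^sub>R (\<kappa> s * g (x + s *\<^sub>R z))) \<in> borel_measurable borel"
    by (rule lborel.borel_measurable_lebesgue_integral) measurable
  then show ?thesis unfolding line_avg_def[abs_def] set_lebesgue_integral_def .
qed

text \<open>Jensen in s, Tonelli, then translation in x for fixed s. Stated with extended integrals,
  it yields finiteness and the estimate at once; B collects the segments that start in A.\<close>

lemma nn_integral_line_avg_square:
  fixes g :: "real^'n::finite \<Rightarrow> real"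
  assumes \<kappa>: "continuous_on UNIV \<kappa>" and [measurable]: "g \<in> borel_measurable borel"
    and K: "\<And>s. s \<in> {0..1} \<Longrightarrow> \<bar>\<kappa> s\<bar> \<le> K" and [measurable]: "A \<in> sets borel" "B \<in> sets borel"
    and AB: "\<And>s x. s \<in> {0..1} \<Longrightarrow> x \<in> A \<Longrightarrow> x + s *\<^sub>R z \<in> B"
  shows "(\<integral>\<^sup>+x. indicator A x * ennreal ((line_avg \<kappa> z g x)\<^sup>2) \<partial>lborel)
     \<le> ennreal (K\<^sup>2) * (\<integral>\<^sup>+x. indicator B x * ennreal ((g x)\<^sup>2) \<partial>lborel)"
proof -
  have [measurable]: "\<kappa> \<in> borel_measurable borel" using \<kappa> by (rule borel_measurable_continuous_onI)
  have "(\<integral>\<^sup>+x. indicator A x * ennreal ((line_avg \<kappa> z g x)\<^sup>2) \<partial>lborel)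
    \<le> (\<integral>\<^sup>+x. indicator A x * (\<integral>\<^sup>+s. indicator {0..1} s * ennreal ((\<kappa> s * g (x + s *\<^sub>R z))\<^sup>2) \<partial>lborel) \<partial>lborel)"
    unfolding line_avg_def
    by (intro nn_integral_mono mult_left_mono nn_integral_unit_interval_square) auto
  also have "\<dots> = (\<integral>\<^sup>+x. (\<integral>\<^sup>+s. indicator A x * (indicator {0..1} s * ennreal ((\<kappa> s * g (x + s *\<^sub>R z))\<^sup>2)) \<partial>lborel) \<partial>lborel)"
    by (intro nn_integral_cong nn_integral_cmult[symmetric]) measurable
  also have "\<dots> = (\<integral>\<^sup>+s. (\<integral>\<^sup>+x. indicator A x * (indicator {0..1} s * ennreal ((\<kappa> s * g (x + s *\<^sub>R z))\<^sup>2)) \<partial>lborel) \<partial>lborel)"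
    by (rule lborel_pair.Fubini') measurable
  also have "\<dots> \<le> (\<integral>\<^sup>+s. (\<integral>\<^sup>+x. (indicator {0..1} s * ennreal (K\<^sup>2)) *
      (indicator B (x + s *\<^sub>R z) * ennreal ((g (x + s *\<^sub>R z))\<^sup>2)) \<partial>lborel) \<partial>lborel)"
  proof (intro nn_integral_mono)
    fix s :: real and x :: "real^'n"
    show "indicator A x * (indicator {0..1} s * ennreal ((\<kappa> s * g (x + s *\<^sub>R z))\<^sup>2))
      \<le> (indicator {0..1} s * ennreal (K\<^sup>2)) * (indicator B (x + s *\<^sub>R z) * ennreal ((g (x + s *\<^sub>R z))\<^sup>2))"
    proof (cases "s \<in> {0..1} \<and> x \<in> A")
      case True
      then have "(\<kappa> s)\<^sup>2 \<le> K\<^sup>2" using K[of s] by (intro abs_le_square_iff[THEN iffD1]) auto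
      then show ?thesis using True AB[of s x]
        by (auto simp: ennreal_mult[symmetric] power_mult_distrib intro!: ennreal_leI mult_right_mono)
    qed (auto simp: indicator_def)
  qed
  also have "\<dots> = (\<integral>\<^sup>+s. (indicator {0..1} s * ennreal (K\<^sup>2)) *
      (\<integral>\<^sup>+x. (indicator B (x + s *\<^sub>R z) * ennreal ((g (x + s *\<^sub>R z))\<^sup>2)) \<partial>lborel) \<partial>lborel)"
    by (intro nn_integral_cong nn_integral_cmult) measurable
  also have "\<dots> = (\<integral>\<^sup>+s. (ennreal (K\<^sup>2) * (\<integral>\<^sup>+x. (indicator B x * ennreal ((g x)\<^sup>2)) \<partial>lborel)) * indicator {0..1} (s::real) \<partial>lborel)"
    by (intro nn_integral_cong)
       (simp add: nn_integral_translate[of "\<lambda>x. indicator B x * ennreal ((g x)\<^sup>2)"] mult_ac)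
  also have "\<dots> = ennreal (K\<^sup>2) * (\<integral>\<^sup>+x. (indicator B x * ennreal ((g x)\<^sup>2)) \<partial>lborel)"
    by (simp add: nn_integral_cmult_indicator)
  finally show ?thesis .
qed

lemma nn_integral_square_finite_iff:
  fixes g :: "'a::euclidean_space \<Rightarrow> real"
  assumes [measurable]: "g \<in> borel_measurable borel" "A \<in> sets borel"
  shows "set_integrable lborel A (\<lambda>x. (g x)\<^sup>2) \<longleftrightarrow> (\<integral>\<^sup>+x. indicator A x * ennreal ((g x)\<^sup>2) \<partial>lborel) < \<infinity>"
proof -
  have "(\<integral>\<^sup>+x. ennreal (norm (indicator A x *\<^sub>R (g x)\<^sup>2)) \<partial>lborel) = (\<integral>\<^sup>+x. indicator A x * ennreal ((g x)\<^sup>2) \<partial>lborel)"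
    by (rule nn_integral_cong) (auto simp: indicator_def)
  then show ?thesis by (simp add: set_integrable_def integrable_iff_bounded)
qed

lemma l2loc_line_avg:
  assumes \<kappa>: "continuous_on UNIV \<kappa>" and g: "l2loc g"
  shows "l2loc (line_avg \<kappa> z g)"
  unfolding l2loc_def
proof (intro conjI allI)
  have gm [measurable]: "g \<in> borel_measurable borel" by (rule l2loc_borel[OF g])
  show m [measurable]: "line_avg \<kappa> z g \<in> borel_measurable borel" by (rule line_avg_borel[OF \<kappa> gm])
  fix a b
  let ?B = "cbox (a - (\<chi> i. \<bar>(-z) $ i\<bar>)) (b + (\<chi> i. \<bar>(-z) $ i\<bar>))"
  obtain K where K: "0 \<le> K" "\<And>s. s \<in> {0..1} \<Longrightarrow> \<bar>\<kappa> s\<bar> \<le> K" using kernel_bounded[OF \<kappa>] by blast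
  have "(\<integral>\<^sup>+x. indicator (cbox a b) x * ennreal ((line_avg \<kappa> z g x)\<^sup>2) \<partial>lborel)
     \<le> ennreal (K\<^sup>2) * (\<integral>\<^sup>+x. indicator ?B x * ennreal ((g x)\<^sup>2) \<partial>lborel)"
  proof (rule nn_integral_line_avg_square[OF \<kappa> gm K(2)])
    fix s :: real and x assume "s \<in> {0..1}" "x \<in> cbox a b"
    then show "x + s *\<^sub>R z \<in> ?B" using cbox_segment[of s "x + s *\<^sub>R z" "-z" a b] by auto
  qed auto
  also have "\<dots> < \<infinity>"
    using g nn_integral_square_finite_iff[OF gm, of ?B] by (simp add: l2loc_def ennreal_mult_less_top)
  finally show "set_integrable lborel (cbox a b) (\<lambda>x. (line_avg \<kappa> z g x)\<^sup>2)"
    by (simp add: nn_integral_square_finite_iff)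
qed

text \<open>Fubini and, for fixed s, the substitution x - s z for x. The compact support of \<phi>
  confines g to one box, where it is integrable.\<close>

lemma line_avg_adjoint:
  fixes g :: "real^'n::finite \<Rightarrow> real"
  assumes \<kappa>: "continuous_on UNIV \<kappa>" and g: "l2loc g" and \<phi>: "test_fn UNIV \<phi>"
  shows "(LINT x|lborel. g x * line_avg \<kappa> z \<phi> x) = (LINT x|lborel. line_avg \<kappa> (-z) g x * \<phi> x)"
proof -
  have [measurable]: "\<kappa> \<in> borel_measurable borel" using \<kappa> by (rule borel_measurable_continuous_onI)
  have [measurable]: "g \<in> borel_measurable borel" by (rule l2loc_borel[OF g])
  have [measurable]: "\<phi> \<in> borel_measurable borel" by (rule test_fn_borel[OF \<phi>])
  obtain K where K: "0 \<le> K" "\<And>s. s \<in> {0..1} \<Longrightarrow> \<bar>\<kappa> s\<bar> \<le> K" using kernel_bounded[OF \<kappa>] by blast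
  obtain M where M: "\<And>x. \<bar>\<phi> x\<bar> \<le> M" using test_fn_bounded[OF \<phi>] by blast
  obtain a b where ab: "\<And>is x. x \<notin> cbox a b \<Longrightarrow> iter_pd is \<phi> x = 0"
    using test_fn_bounded_support[OF \<phi>] by blast
  let ?B = "cbox (a - (\<chi> i. \<bar>z $ i\<bar>)) (b + (\<chi> i. \<bar>z $ i\<bar>))"
  define F1 where "F1 p = indicator {0..1} (fst p) * (\<kappa> (fst p) * (g (snd p) * \<phi> (snd p + fst p *\<^sub>R z)))" for p
  define F2 where "F2 p = indicator {0..1} (fst p) * (\<kappa> (fst p) * (g (snd p - fst p *\<^sub>R z) * \<phi> (snd p)))" for p
  define C where "C = ennreal (K * M) * (\<integral>\<^sup>+x. ennreal (norm (indicator ?B x *\<^sub>R g x)) \<partial>lborel)"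
  have C: "C < \<infinity>"
    using l2loc_integrable[OF g, of "a - (\<chi> i. \<bar>z $ i\<bar>)" "b + (\<chi> i. \<bar>z $ i\<bar>)"]
    unfolding C_def by (simp add: set_integrable_def integrable_iff_bounded ennreal_mult_less_top)
  have [measurable]: "F1 \<in> borel_measurable (lborel \<Otimes>\<^sub>M lborel)" "F2 \<in> borel_measurable (lborel \<Otimes>\<^sub>M lborel)"
    unfolding F1_def[abs_def] F2_def[abs_def] by measurable
  have b1: "(\<integral>\<^sup>+x. ennreal \<bar>F1 (s, x)\<bar> \<partial>lborel) \<le> C * indicator {0..1} s" for s
  proof (cases "s \<in> {0..1}")
    case True
    have "(\<integral>\<^sup>+x. ennreal \<bar>F1 (s, x)\<bar> \<partial>lborel) \<le> (\<integral>\<^sup>+x. ennreal (K * M) * ennreal (norm (indicator ?B x *\<^sub>R g x)) \<partial>lborel)"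
    proof (rule nn_integral_mono)
      fix x
      show "ennreal \<bar>F1 (s, x)\<bar> \<le> ennreal (K * M) * ennreal (norm (indicator ?B x *\<^sub>R g x))"
      proof (cases "x \<in> ?B")
        case False
        then have "x + s *\<^sub>R z \<notin> cbox a b" using cbox_segment[of s x z a b] True by auto
        from ab[OF this, of "[]"] show ?thesis by (simp add: F1_def)
      next
        case inB: True
        have M0: "0 \<le> M" using M[of 0] by linarith
        have "\<bar>F1 (s, x)\<bar> = \<bar>\<kappa> s\<bar> * (\<bar>g x\<bar> * \<bar>\<phi> (x + s *\<^sub>R z)\<bar>)" using True by (simp add: F1_def abs_mult)
        also have "\<dots> \<le> K * (\<bar>g x\<bar> * M)"
          by (intro mult_mono K True mult_left_mono M) (use M0 K in auto)
        finally have "\<bar>F1 (s, x)\<bar> \<le> K * M * \<bar>g x\<bar>" by (simp add: mult_ac)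
        then show ?thesis using inB K(1) M0 by (simp add: ennreal_mult[symmetric] ennreal_leI)
      qed
    qed
    also have "\<dots> = C" unfolding C_def by (rule nn_integral_cmult) measurable
    finally show ?thesis using True by simp
  qed (simp add: F1_def)
  have shift: "F2 (s, x + s *\<^sub>R z) = F1 (s, x)" for s x by (simp add: F1_def F2_def)
  have b2: "(\<integral>\<^sup>+x. ennreal \<bar>F2 (s, x)\<bar> \<partial>lborel) \<le> C * indicator {0..1} s" for s
    using b1[of s] nn_integral_translate[of "\<lambda>x. ennreal \<bar>F2 (s, x)\<bar>" "s *\<^sub>R z"] by (simp add: shift)
  have i1: "integrable (lborel \<Otimes>\<^sub>M lborel) (\<lambda>(s, x). F1 (s, x))"
    using integrable_pair_unit_interval[OF _ b1 C] by simp
  have i2: "integrable (lborel \<Otimes>\<^sub>M lborel) (\<lambda>(s, x). F2 (s, x))"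
    using integrable_pair_unit_interval[OF _ b2 C] by simp
  have "(LINT x|lborel. g x * line_avg \<kappa> z \<phi> x) = (LINT x|lborel. (LINT s|lborel. F1 (s, x)))"
    unfolding line_avg_def set_lebesgue_integral_def F1_def
    by (subst Bochner_Integration.integral_mult_right_zero[symmetric]) (simp add: mult_ac)
  also have "\<dots> = (LINT s|lborel. (LINT x|lborel. F1 (s, x)))"
    by (rule lborel_pair.Fubini_integral[OF i1])
  also have "\<dots> = (LINT s|lborel. (LINT x|lborel. F2 (s, x)))"
    using integral_translate[of "\<lambda>x. F2 (s, x)" "s *\<^sub>R z" for s] by (simp add: shift)
  also have "\<dots> = (LINT x|lborel. (LINT s|lborel. F2 (s, x)))"
    by (rule lborel_pair.Fubini_integral[OF i2, symmetric])
  also have "\<dots> = (LINT x|lborel. line_avg \<kappa> (-z) g x * \<phi> x)"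
    unfolding line_avg_def set_lebesgue_integral_def F2_def
    by (subst Bochner_Integration.integral_mult_left_zero[symmetric]) (simp add: mult_ac)
  finally show ?thesis .
qed

subsection \<open>Weak derivatives\<close>

text \<open>Lists of directions instead of multi-indices turn composition of derivatives into
  concatenation and permit induction on one direction at a time.\<close>

definition wd :: "'n::finite list \<Rightarrow> (real^'n \<Rightarrow> real) \<Rightarrow> (real^'n \<Rightarrow> real) \<Rightarrow> bool" where
  "wd is v g \<longleftrightarrow> l2loc v \<and> l2loc g \<and> (\<forall>\<phi>. test_fn UNIV \<phi> \<longrightarrow>
     (LINT x|lborel. v x * iter_pd is \<phi> x) = (-1) ^ length is * (LINT x|lborel. g x * \<phi> x))"

lemma AE_eq_if_test_integrals_eq:
  assumes "l2loc f" "l2loc g"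
    and eq: "\<And>\<phi>. test_fn UNIV \<phi> \<Longrightarrow> (LINT x|lborel. f x * \<phi> x) = (LINT x|lborel. g x * \<phi> x)"
  shows "AE x in lborel. f x = g x"
proof -
  have l: "l2loc (\<lambda>x. f x + (-1) * g x)" by (intro l2loc_add l2loc_cmult assms)
  have "AE x in lborel. x \<in> UNIV \<longrightarrow> f x + (-1) * g x = 0"
  proof (rule fundamental_lemma[OF l2loc_borel[OF l]])
    show "set_integrable lborel (cbox a b) (\<lambda>x. f x + (-1) * g x)" for a b by (rule l2loc_integrable[OF l])
    fix \<phi> :: "real^'a \<Rightarrow> real" assume \<phi>: "test_fn UNIV \<phi>"
    then show "(LINT x|lborel. (f x + (-1) * g x) * \<phi> x) = 0"
      using eq[OF \<phi>] l2loc_test_integrable[OF assms(1) \<phi>] l2loc_test_integrable[OF assms(2) \<phi>]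
      by (simp add: left_diff_distrib)
  qed simp
  then show ?thesis by eventually_elim simp
qed

lemma wd_unique: "wd is v g \<Longrightarrow> wd is v h \<Longrightarrow> AE x in lborel. g x = h x"
  by (rule AE_eq_if_test_integrals_eq) (auto simp: wd_def)

lemma wd_mset_cong: "mset is = mset js \<Longrightarrow> wd is v g \<longleftrightarrow> wd js v g"
proof -
  assume m: "mset is = mset js"
  then have "length is = length js" by (metis size_mset)
  with iter_pd_mset_cong[OF _ m] show ?thesis unfolding wd_def test_fn_def by auto
qed

text \<open>Derivatives of test functions are test functions, so \<open>iter_pd js \<phi>\<close>
  may be inserted for \<phi> in the defining identity for \<open>is\<close>; the common sign then
  cancels.\<close>

lemma wd_step:
  assumes "wd is v g" "wd (is @ js) v h"
  shows "wd js g h"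
  unfolding wd_def
proof (intro conjI allI impI)
  fix \<phi> :: "real^'a \<Rightarrow> real" assume \<phi>: "test_fn UNIV \<phi>"
  have "(-1) ^ length is * (LINT x|lborel. g x * iter_pd js \<phi> x) = (LINT x|lborel. v x * iter_pd is (iter_pd js \<phi>) x)"
    using assms(1) test_fn_iter_pd[OF \<phi>] by (simp add: wd_def)
  also have "\<dots> = (LINT x|lborel. v x * iter_pd (is @ js) \<phi> x)" by (simp add: iter_pd_append)
  also have "\<dots> = (-1) ^ length is * ((-1) ^ length js * (LINT x|lborel. h x * \<phi> x))"
    using assms(2) \<phi> by (simp add: wd_def power_add)
  finally show "(LINT x|lborel. g x * iter_pd js \<phi> x) = (-1) ^ length js * (LINT x|lborel. h x * \<phi> x)"
    by (subst (asm) mult_left_cancel) simp_all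
qed (use assms in \<open>auto simp: wd_def\<close>)

lemma wd_trans:
  assumes "wd is v g" "wd js g h" shows "wd (js @ is) v h"
proof -
  have "wd (is @ js) v h"
    unfolding wd_def
  proof (intro conjI allI impI)
    fix \<phi> :: "real^'a \<Rightarrow> real" assume \<phi>: "test_fn UNIV \<phi>"
    have "(LINT x|lborel. v x * iter_pd (is @ js) \<phi> x) = (-1) ^ length is * (LINT x|lborel. g x * iter_pd js \<phi> x)"
      using assms(1) test_fn_iter_pd[OF \<phi>, of js] by (simp add: wd_def iter_pd_append)
    also have "\<dots> = (-1) ^ length (is @ js) * (LINT x|lborel. h x * \<phi> x)"
      using assms(2) \<phi> by (simp add: wd_def power_add)
    finally show "(LINT x|lborel. v x * iter_pd (is @ js) \<phi> x) = (-1) ^ length (is @ js) * (LINT x|lborel. h x * \<phi> x)" .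
  qed (use assms in \<open>auto simp: wd_def\<close>)
  then show ?thesis using wd_mset_cong[of "is @ js" "js @ is"] by simp
qed

lemma test_fn_difference:
  assumes \<phi>: "smooth_fn \<phi>"
  shows "\<phi> (x + z) - \<phi> x = (\<Sum>i\<in>UNIV. z $ i * line_avg (\<lambda>_. 1) z (pd i \<phi>) x)"
proof -
  have i: "(\<lambda>s. 1 * pd i \<phi> (x + s *\<^sub>R z)) integrable_on {0..1}"
    "line_avg (\<lambda>_. 1) z (pd i \<phi>) x = integral {0..1} (\<lambda>s. 1 * pd i \<phi> (x + s *\<^sub>R z))" for i
    by (rule line_avg_eq_integral; simp add: continuous_on_smooth smooth_fn_pd \<phi>)+
  have "((\<lambda>s. \<Sum>i\<in>UNIV. z $ i * pd i \<phi> (x + s *\<^sub>R z)) has_integral \<phi> (x + 1 *\<^sub>R z) - \<phi> (x + 0 *\<^sub>R z)) {0..1}"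
  proof (rule fundamental_theorem_of_calculus)
    fix s :: real
    show "((\<lambda>s. \<phi> (x + s *\<^sub>R z)) has_vector_derivative (\<Sum>i\<in>UNIV. z $ i * pd i \<phi> (x + s *\<^sub>R z))) (at s within {0..1})"
      using DERIV_along_line[OF smooth_fnD[OF \<phi>], where x = x and s = s and z = z]
      by (simp add: has_real_derivative_iff_has_vector_derivative has_vector_derivative_at_within)
  qed simp
  moreover have "((\<lambda>s. \<Sum>i\<in>UNIV. z $ i * pd i \<phi> (x + s *\<^sub>R z)) has_integral
     (\<Sum>i\<in>UNIV. z $ i * line_avg (\<lambda>_. 1) z (pd i \<phi>) x)) {0..1}"
    using i by (intro has_integral_sum has_integral_mult_right) (auto simp: integrable_integral)
  ultimately have "\<phi> (x + 1 *\<^sub>R z) - \<phi> (x + 0 *\<^sub>R z) = (\<Sum>i\<in>UNIV. z $ i * line_avg (\<lambda>_. 1) z (pd i \<phi>) x)"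
    by (rule has_integral_unique)
  then show ?thesis by simp
qed

text \<open>The dual of \<open>test_fn_difference\<close>: translations and segment averages both
  have explicit adjoints, so the formula of the fundamental theorem passes from test functions to w,
  for almost every x.\<close>

lemma weak_difference:
  fixes w :: "real^'n::finite \<Rightarrow> real"
  assumes wd: "\<And>i. wd [i] w (g i)"
  shows "AE x in lborel. w (x + z) - w x = (\<Sum>i\<in>UNIV. z $ i * line_avg (\<lambda>_. 1) z (g i) x)"
proof -
  have w: "l2loc w" and g: "\<And>i. l2loc (g i)" using wd by (auto simp: wd_def)
  have c1: "continuous_on UNIV (\<lambda>_::real. 1::real)" by simp
  have [measurable]: "w \<in> borel_measurable borel" by (rule l2loc_borel[OF w])
  have sh: "l2loc (\<lambda>x. w (x + z))"
    unfolding l2loc_def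
  proof (intro conjI allI)
    show "(\<lambda>x. w (x + z)) \<in> borel_measurable borel" by measurable
    fix a b
    have "(\<integral>\<^sup>+x. indicator (cbox (a + z) (b + z)) x * ennreal ((w x)\<^sup>2) \<partial>lborel)
       = (\<integral>\<^sup>+x. indicator (cbox (a + z) (b + z)) (x + z) * ennreal ((w (x + z))\<^sup>2) \<partial>lborel)"
      by (rule nn_integral_translate[symmetric]) measurable
    also have "\<dots> = (\<integral>\<^sup>+x. indicator (cbox a b) x * ennreal ((w (x + z))\<^sup>2) \<partial>lborel)"
      by (rule nn_integral_cong) (simp add: indicator_def mem_box_cart)
    finally have "(\<integral>\<^sup>+x. indicator (cbox a b) x * ennreal ((w (x + z))\<^sup>2) \<partial>lborel)
       = (\<integral>\<^sup>+x. indicator (cbox (a + z) (b + z)) x * ennreal ((w x)\<^sup>2) \<partial>lborel)" by (rule sym)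
    also have "\<dots> < \<infinity>"
      using w nn_integral_square_finite_iff[of w "cbox (a + z) (b + z)"] by (simp add: l2loc_def)
    finally show "set_integrable lborel (cbox a b) (\<lambda>x. (w (x + z))\<^sup>2)"
      by (simp add: nn_integral_square_finite_iff)
  qed
  have l1: "l2loc (\<lambda>x. w (x + z) + (-1) * w x)" by (intro l2loc_add l2loc_cmult sh w)
  have lg: "l2loc (\<lambda>x. z $ i * line_avg (\<lambda>_. 1) z (g i) x)" for i
    by (intro l2loc_cmult l2loc_line_avg c1 g)
  have "AE x in lborel. w (x + z) + (-1) * w x = (\<Sum>i\<in>UNIV. z $ i * line_avg (\<lambda>_. 1) z (g i) x)"
  proof (rule AE_eq_if_test_integrals_eq[OF l1 l2loc_sum[OF lg]])
    fix \<phi> :: "real^'n \<Rightarrow> real" assume \<phi>: "test_fn UNIV \<phi>"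
    then have sm: "smooth_fn \<phi>" by (simp add: test_fn_def)
    have [measurable]: "\<phi> \<in> borel_measurable borel" by (rule test_fn_borel[OF \<phi>])
    \<comment> \<open>The average of \<phi> in direction -z: its partial derivatives produce \<phi>
      (x - z), and its adjoint is the average along z in the claim.\<close>
    let ?A = "line_avg (\<lambda>_. 1) (-z) \<phi>"
    have A: "test_fn UNIV ?A" by (rule test_fn_line_avg[OF c1 \<phi>])
    have "(LINT x|lborel. w (x + z) * \<phi> x) = (LINT x|lborel. w x * \<phi> (x - z))"
      using integral_translate[of "\<lambda>x. w x * \<phi> (x - z)" z] by simp
    moreover have iz: "integrable lborel (\<lambda>x. w (x + z) * \<phi> x)" "integrable lborel (\<lambda>x. w x * \<phi> x)"
      by (rule l2loc_test_integrable[OF _ \<phi>], rule sh w)+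
    moreover have "w x * \<phi> (x - z) = w x * \<phi> x - (\<Sum>i\<in>UNIV. z $ i * (w x * pd i ?A x))" for x
    proof -
      have "\<phi> (x - z) = \<phi> x - (\<Sum>i\<in>UNIV. z $ i * pd i ?A x)"
        using test_fn_difference[OF sm, of x "-z"] by (simp add: pd_line_avg[OF c1 sm] sum_negf)
      moreover have "(\<Sum>i\<in>UNIV. z $ i * (w x * pd i ?A x)) = w x * (\<Sum>i\<in>UNIV. z $ i * pd i ?A x)"
        by (simp add: sum_distrib_left mult.left_commute)
      ultimately show ?thesis by (simp only: right_diff_distrib)
    qed
    moreover have ip: "integrable lborel (\<lambda>x. w x * pd i ?A x)" for i
      by (rule l2loc_test_integrable[OF w test_fn_pd[OF A]])
    ultimately have "(LINT x|lborel. (w (x + z) + (-1) * w x) * \<phi> x) = - (\<Sum>i\<in>UNIV. z $ i * (LINT x|lborel. w x * pd i ?A x))"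
      by (simp add: left_diff_distrib)
    also have "\<dots> = (\<Sum>i\<in>UNIV. z $ i * (LINT x|lborel. g i x * ?A x))"
    proof -
      have "(LINT x|lborel. w x * pd i ?A x) = - (LINT x|lborel. g i x * ?A x)" for i
        using wd[of i] A by (simp add: wd_def)
      then show ?thesis by (simp add: sum_negf)
    qed
    also have "\<dots> = (\<Sum>i\<in>UNIV. z $ i * (LINT x|lborel. line_avg (\<lambda>_. 1) z (g i) x * \<phi> x))"
      using line_avg_adjoint[OF c1 g \<phi>, of _ "-z"] by simp
    also have "\<dots> = (LINT x|lborel. (\<Sum>i\<in>UNIV. z $ i * line_avg (\<lambda>_. 1) z (g i) x) * \<phi> x)"
      using l2loc_test_integrable[OF l2loc_line_avg[OF c1 g] \<phi>, of z]
      by (simp add: sum_distrib_right mult.assoc)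
    finally show "(LINT x|lborel. (w (x + z) + (-1) * w x) * \<phi> x)
      = (LINT x|lborel. (\<Sum>i\<in>UNIV. z $ i * line_avg (\<lambda>_. 1) z (g i) x) * \<phi> x)" .
  qed
  then show ?thesis by eventually_elim simp
qed

subsection \<open>Intermediate weak derivatives\<close>

lemma line_avg_by_parts:
  fixes \<phi> :: "real^'n::finite \<Rightarrow> real"
  assumes \<kappa>: "\<And>s. (\<kappa> has_real_derivative \<kappa>' s) (at s)" and \<kappa>': "continuous_on UNIV \<kappa>'"
    and \<phi>: "smooth_fn \<phi>"
  shows "line_avg \<kappa> (axis i 1) (pd i \<phi>) x
    = \<kappa> 1 * \<phi> (x + axis i 1) - \<kappa> 0 * \<phi> x - line_avg \<kappa>' (axis i 1) \<phi> x"
proof -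
  have ck: "continuous_on UNIV \<kappa>" using \<kappa> DERIV_isCont continuous_at_imp_continuous_on by blast
  note e1 = line_avg_eq_integral[OF ck continuous_on_smooth[OF smooth_fn_pd[OF \<phi>, of i]], where x = x and z = "axis i 1"]
  note e2 = line_avg_eq_integral[OF \<kappa>' continuous_on_smooth[OF \<phi>], where x = x and z = "axis i 1"]
  let ?h = "\<lambda>s. \<kappa> s * pd i \<phi> (x + s *\<^sub>R axis i 1) + \<kappa>' s * \<phi> (x + s *\<^sub>R axis i 1)"
  have "(?h has_integral \<kappa> 1 * \<phi> (x + 1 *\<^sub>R axis i 1) - \<kappa> 0 * \<phi> (x + 0 *\<^sub>R axis i 1)) {0..1}"
  proof (rule fundamental_theorem_of_calculus)
    fix s :: real
    have "((\<lambda>s. \<kappa> s * \<phi> (x + s *\<^sub>R axis i 1)) has_real_derivative ?h s) (at s)"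
      using DERIV_mult[OF \<kappa>[of s] DERIV_along_axis[OF smooth_fnD[OF \<phi>], where x = x and s = s and i = i]] by (simp add: algebra_simps)
    then show "((\<lambda>s. \<kappa> s * \<phi> (x + s *\<^sub>R axis i 1)) has_vector_derivative ?h s) (at s within {0..1})"
      by (simp add: has_real_derivative_iff_has_vector_derivative has_vector_derivative_at_within)
  qed simp
  moreover have "(?h has_integral line_avg \<kappa> (axis i 1) (pd i \<phi>) x + line_avg \<kappa>' (axis i 1) \<phi> x) {0..1}"
    unfolding e1(2) e2(2) by (intro has_integral_add integrable_integral e1(1) e2(1))
  ultimately have "\<kappa> 1 * \<phi> (x + 1 *\<^sub>R axis i 1) - \<kappa> 0 * \<phi> (x + 0 *\<^sub>R axis i 1)
     = line_avg \<kappa> (axis i 1) (pd i \<phi>) x + line_avg \<kappa>' (axis i 1) \<phi> x"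
    by (rule has_integral_unique)
  then show ?thesis by simp
qed

text \<open>With \<open>X 0\<close> a smooth step and \<open>R = 1 - X 0\<close>, integration by parts along the axis gives
  \<open>\<phi> = line_avg (X 1) e \<phi> - pd i (line_avg R e \<phi>)\<close>. Dualising, the derivative of order j of w is obtained
  explicitly from w and from its derivative of order j + 1, without any limit.\<close>

lemma wd_replicate_lower:
  fixes w :: "real^'n::finite \<Rightarrow> real"
  assumes wd: "wd (replicate (Suc j) i) w h"
  shows "\<exists>g. wd (replicate j i) w g"
proof -
  obtain X :: "nat \<Rightarrow> real \<Rightarrow> real" where X: "\<And>m t. (X m has_real_derivative X (Suc m) t) (at t)"
    and X0: "\<And>t. t \<le> 0 \<Longrightarrow> X 0 t = 0" and X1: "\<And>t. t \<ge> 1 \<Longrightarrow> X 0 t = 1"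
    and Xz: "\<And>m t. t \<le> 0 \<or> 1 \<le> t \<Longrightarrow> X (Suc m) t = 0"
    using smooth_step_exists by blast
  have cX: "continuous_on UNIV (X m)" for m using X DERIV_isCont continuous_at_imp_continuous_on by blast
  let ?e = "axis i 1 :: real^'n"
  define R where "R s = 1 - X 0 s" for s
  have cR: "continuous_on UNIV R" unfolding R_def by (intro continuous_intros cX)
  have w: "l2loc w" and h: "l2loc h" using wd by (auto simp: wd_def)
  \<comment> \<open>After j derivatives the kernel of the first average has become
    \<open>X (Suc j)\<close> up to sign, while the second average carries j + 1 derivatives, which
    are passed on to h. Adjunction then moves both averages onto w and h.\<close>
  define g where "g x = line_avg (X (Suc j)) (- ?e) w x + line_avg R (- ?e) h x" for x
  have lg: "l2loc g" unfolding g_def by (intro l2loc_add l2loc_line_avg cX cR w h)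
  have "wd (replicate j i) w g"
    unfolding wd_def
  proof (intro conjI allI impI lg w)
    fix \<phi> :: "real^'n \<Rightarrow> real" assume \<phi>: "test_fn UNIV \<phi>"
    then have sm: "smooth_fn \<phi>" by (simp add: test_fn_def)
    have dec: "\<phi> = (\<lambda>x. line_avg (X 1) ?e \<phi> x - pd i (line_avg R ?e \<phi>) x)"
    proof
      fix x
      have R': "(R has_real_derivative - X 1 s) (at s)" for s
        unfolding R_def using X[of 0 s] by (auto intro!: derivative_eq_intros)
      have "pd i (line_avg R ?e \<phi>) x = line_avg R ?e (pd i \<phi>) x" by (simp add: pd_line_avg[OF cR sm])
      also have "\<dots> = R 1 * \<phi> (x + axis i 1) - R 0 * \<phi> x - line_avg (\<lambda>s. - X 1 s) ?e \<phi> x"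
        by (rule line_avg_by_parts[OF R' _ sm]) (intro continuous_intros cX)
      also have "\<dots> = - \<phi> x + line_avg (X 1) ?e \<phi> x"
        by (simp add: R_def X0 X1 line_avg_def set_lebesgue_integral_def)
      finally show "\<phi> x = line_avg (X 1) ?e \<phi> x - pd i (line_avg R ?e \<phi>) x" by simp
    qed
    have AR: "test_fn UNIV (line_avg R ?e \<phi>)" by (rule test_fn_line_avg[OF cR \<phi>])
    have AX: "test_fn UNIV (line_avg (X m) ?e \<phi>)" for m by (rule test_fn_line_avg[OF cX \<phi>])
    \<comment> \<open>\<open>X (Suc m)\<close> vanishes at 0 and 1, so integration by parts leaves
      no boundary terms and just differentiates the kernel.\<close>
    have pX: "pd i (line_avg (X (Suc m)) ?e \<phi>) = (\<lambda>x. - line_avg (X (Suc (Suc m))) ?e \<phi> x)" for m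
    proof
      fix x
      have "pd i (line_avg (X (Suc m)) ?e \<phi>) x = line_avg (X (Suc m)) ?e (pd i \<phi>) x"
        by (simp add: pd_line_avg[OF cX sm])
      also have "\<dots> = X (Suc m) 1 * \<phi> (x + axis i 1) - X (Suc m) 0 * \<phi> x - line_avg (X (Suc (Suc m))) ?e \<phi> x"
        by (rule line_avg_by_parts[OF X cX sm])
      finally show "pd i (line_avg (X (Suc m)) ?e \<phi>) x = - line_avg (X (Suc (Suc m))) ?e \<phi> x"
        by (simp add: Xz)
    qed
    have pdc: "pd i (\<lambda>x. c * f x) = (\<lambda>x. c * pd i f x)" if "smooth_fn f" for c :: real and f :: "real^'n \<Rightarrow> real"
    proof
      fix x
      have "((\<lambda>x. c * f x) has_derivative (\<lambda>h. c * frechet_derivative f (at x) h)) (at x)"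
        using smooth_fnD[OF that, of x] frechet_derivative_works by (blast intro: has_derivative_mult_right)
      from has_derivative_imp_pd[OF this] show "pd i (\<lambda>x. c * f x) x = c * pd i f x" by (simp add: pd_def)
    qed
    have iX: "iter_pd (replicate m i) (line_avg (X 1) ?e \<phi>) = (\<lambda>x. (-1) ^ m * line_avg (X (Suc m)) ?e \<phi> x)" for m
    proof (induction m)
      case (Suc m)
      then show ?case
        using pdc[of "line_avg (X (Suc m)) ?e \<phi>" "(-1) ^ m"] AX[of "Suc m"]
        by (simp add: pX test_fn_def)
    qed simp
    have sub: "iter_pd (replicate j i) \<phi> x = (-1) ^ j * line_avg (X (Suc j)) ?e \<phi> x
        - iter_pd (replicate (Suc j) i) (line_avg R ?e \<phi>) x" for x
    proof -
      have eq: "iter_pd (replicate j i) \<phi> x = iter_pd (replicate j i) (\<lambda>x. line_avg (X 1) ?e \<phi> x + (-1) * pd i (line_avg R ?e \<phi>) x) x"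
        using arg_cong[OF dec, of "\<lambda>f. iter_pd (replicate j i) f x"] by simp
      have s1: "smooth_fn (line_avg (X 1) ?e \<phi>)" and s2: "smooth_fn (pd i (line_avg R ?e \<phi>))"
        using AX AR by (auto simp: test_fn_def smooth_fn_pd)
      have "iter_pd (replicate m i) (\<lambda>x. line_avg (X 1) ?e \<phi> x + (-1) * pd i (line_avg R ?e \<phi>) x)
        = (\<lambda>x. iter_pd (replicate m i) (line_avg (X 1) ?e \<phi>) x + (-1) * iter_pd (replicate m i) (pd i (line_avg R ?e \<phi>)) x)" for m
      proof (induction m)
        case (Suc m)
        let ?f = "iter_pd (replicate m i) (line_avg (X 1) ?e \<phi>)" and ?g = "iter_pd (replicate m i) (pd i (line_avg R ?e \<phi>))"
        have f: "smooth_fn ?f" and g: "smooth_fn ?g" using s1 s2 by (auto intro: smooth_fn_iter_pd)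
        have "pd i (\<lambda>x. ?f x + (-1) * ?g x) x = pd i ?f x + pd i (\<lambda>x. (-1) * ?g x) x" for x
          by (rule pd_add) (use smooth_fnD[OF f] smooth_fnD[OF g] in \<open>auto intro!: derivative_intros\<close>)
        then show ?case using Suc pdc[OF g, of "-1"] by simp
      qed simp
      moreover have "iter_pd (replicate m i) (pd i f) = iter_pd (replicate (Suc m) i) f" for m and f :: "real^'n \<Rightarrow> real"
        using iter_pd_append[of "replicate m i" "[i]" f] by (simp only: replicate_append_same replicate_Suc iter_pd.simps)
      ultimately show ?thesis unfolding eq iX by simp
    qed
    have i1: "integrable lborel (\<lambda>x. w x * line_avg (X (Suc j)) ?e \<phi> x)"
      by (rule l2loc_test_integrable[OF w AX])
    have i2: "integrable lborel (\<lambda>x. w x * iter_pd (replicate (Suc j) i) (line_avg R ?e \<phi>) x)"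
      by (rule l2loc_test_integrable[OF w test_fn_iter_pd[OF AR]])
    have "w x * iter_pd (replicate j i) \<phi> x = (-1) ^ j * (w x * line_avg (X (Suc j)) ?e \<phi> x)
        - w x * iter_pd (replicate (Suc j) i) (line_avg R ?e \<phi>) x" for x
      by (simp only: sub) (simp only: right_diff_distrib mult.left_commute)
    then have "(LINT x|lborel. w x * iter_pd (replicate j i) \<phi> x)
      = (-1) ^ j * (LINT x|lborel. w x * line_avg (X (Suc j)) ?e \<phi> x)
        - (LINT x|lborel. w x * iter_pd (replicate (Suc j) i) (line_avg R ?e \<phi>) x)"
      using i1 i2 by (simp del: iter_pd.simps replicate.simps)
    also have "(LINT x|lborel. w x * iter_pd (replicate (Suc j) i) (line_avg R ?e \<phi>) x)
      = (-1) ^ Suc j * (LINT x|lborel. h x * line_avg R ?e \<phi> x)"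
      using wd AR unfolding wd_def length_replicate by blast
    also have "(LINT x|lborel. h x * line_avg R ?e \<phi> x) = (LINT x|lborel. line_avg R (- ?e) h x * \<phi> x)"
      by (rule line_avg_adjoint[OF cR h \<phi>])
    also have "(LINT x|lborel. w x * line_avg (X (Suc j)) ?e \<phi> x) = (LINT x|lborel. line_avg (X (Suc j)) (- ?e) w x * \<phi> x)"
      by (rule line_avg_adjoint[OF cX w \<phi>])
    also have "(-1) ^ j * (LINT x|lborel. line_avg (X (Suc j)) (- ?e) w x * \<phi> x)
       - (-1) ^ Suc j * (LINT x|lborel. line_avg R (- ?e) h x * \<phi> x) = (-1) ^ j * (LINT x|lborel. g x * \<phi> x)"
      using l2loc_test_integrable[OF l2loc_line_avg[OF cX w] \<phi>] l2loc_test_integrable[OF l2loc_line_avg[OF cR h] \<phi>]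
      by (simp add: g_def distrib_right distrib_left)
    finally show "(LINT x|lborel. w x * iter_pd (replicate j i) \<phi> x)
        = (-1) ^ length (replicate j i) * (LINT x|lborel. g x * \<phi> x)"
      by simp
  qed
  then show ?thesis by blast
qed

text \<open>\<^const>\<open>weak_deriv\<close> is a choice, so the orders below kmin in \<^const>\<open>hk_norm\<close> are meaningful only because
  those derivatives exist, although the definition of V does not mention them.\<close>

lemma wd_lower_orders:
  fixes v :: "real^'n::finite \<Rightarrow> real"
  assumes v: "l2loc v" and top: "\<And>is. length is = M \<Longrightarrow> \<exists>g. wd is v g"
  shows "length is \<le> M \<Longrightarrow> \<exists>g. wd is v g"
proof (induction "is" rule: length_induct)
  case (1 "is")
  show ?case
  proof (cases "is")
    case Nil
    have "wd [] v v" using v by (simp add: wd_def)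
    with Nil show ?thesis by blast
  next
    case (Cons i is')
    \<comment> \<open>All occurrences of one direction i are split off. The shorter rest
      \<open>js\<close> has a derivative \<open>g0\<close> by induction, and only pure derivatives
      of \<open>g0\<close> in direction i remain to be found.\<close>
    define js where "js = filter (\<lambda>l. l \<noteq> i) is"
    have m: "mset is = mset (replicate (count_list is i) i @ js)"
      unfolding js_def multiset_eq_iff by (auto simp: count_mset)
    have len: "length is = count_list is i + length js"
      using arg_cong[OF m, of size] by simp
    have c: "0 < count_list is i" using Cons by simp
    then obtain g0 where g0: "wd js v g0" using 1 len by (metis less_add_same_cancel2 less_imp_le order_trans)
    \<comment> \<open>Descending in m: when the total order is M the hypothesis on top order
      derivatives applies, and each further step lowers the power of i by one.\<close>
    have "\<exists>g. wd (replicate m i) g0 g" if "m + length js \<le> M" for m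
      using that
    proof (induction "M - length js - m" arbitrary: m)
      case 0
      then have "length (js @ replicate m i) = M" by simp
      from top[OF this] wd_step[OF g0] show ?case by blast
    next
      case (Suc r)
      have "r = M - length js - Suc m" "Suc m + length js \<le> M" using Suc(2,3) by linarith+
      then have "\<exists>g. wd (replicate (Suc m) i) g0 g" by (rule Suc(1))
      then show ?case using wd_replicate_lower by blast
    qed
    then obtain g where "wd (replicate (count_list is i) i) g0 g" using 1 len by auto
    from wd_trans[OF g0 this] show ?thesis using wd_mset_cong[OF m] by blast
  qed
qed

subsection \<open>Weak derivatives on open sets\<close>

lemma lebesgue_imp_borel_AE:
  fixes f :: "'a::euclidean_space \<Rightarrow> real"
  assumes "f \<in> borel_measurable lebesgue"
  obtains g where "g \<in> borel_measurable borel" "AE x in lborel. f x = g x"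
  using completion_ex_borel_measurable_real[OF assms] by auto

lemma set_integrable_lebesgue_iff:
  fixes f :: "'a::euclidean_space \<Rightarrow> real"
  assumes "f \<in> borel_measurable borel" "A \<in> sets borel"
  shows "set_integrable lebesgue A f \<longleftrightarrow> set_integrable lborel A f"
  unfolding set_integrable_def by (rule integrable_completion) (use assms in measurable)

lemma loc_int_l2loc:
  assumes "l2loc g" shows "loc_int U g"
  unfolding loc_int_def
proof (intro allI impI)
  fix K :: "(real^'a) set" assume K: "compact K \<and> K \<subseteq> U"
  then have "bounded K" by (simp add: compact_imp_bounded)
  then obtain c where "K \<subseteq> cbox (-c) c" by (rule bounded_subset_cbox_symmetric)
  then obtain a b where ab: "K \<subseteq> cbox a b" by blast
  have "K \<in> sets borel" using K by (simp add: borel_compact)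
  with ab show "set_integrable lebesgue K g"
    using set_integrable_subset[OF l2loc_integrable[OF assms, of a b], of K] l2loc_borel[OF assms]
    by (simp add: set_integrable_lebesgue_iff)
qed

text \<open>The given derivative is only Lebesgue measurable; an almost everywhere equal Borel
  function has the same test integrals and the same square integral.\<close>

lemma has_weak_deriv_imp_wd:
  assumes v: "continuous_on UNIV v" and g: "has_weak_deriv UNIV (count_list is) v g" "L2_on UNIV g"
  shows "\<exists>h. wd is v h \<and> integrable lborel (\<lambda>x. (h x)\<^sup>2)"
proof -
  have gm: "g \<in> borel_measurable lebesgue" and gi: "integrable lebesgue (\<lambda>x. (g x)\<^sup>2)"
    using g(2) by (simp_all add: L2_on_def set_borel_measurable_def set_integrable_def)
  obtain h where [measurable]: "h \<in> borel_measurable borel" and "AE x in lborel. g x = h x"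
    using lebesgue_imp_borel_AE[OF gm] by blast
  then have ae: "AE x in lebesgue. g x = h x" by (intro AE_completion)
  have hm: "h \<in> borel_measurable lebesgue" by (rule measurable_completion) simp
  have "integrable lebesgue (\<lambda>x. (h x)\<^sup>2)"
    by (rule integrable_cong_AE_imp[OF gi]) (use hm ae in auto)
  then have hi: "integrable lborel (\<lambda>x. (h x)\<^sup>2)"
    by (subst (asm) integrable_completion) auto
  have lv: "l2loc v" by (rule l2loc_continuous[OF v])
  have [measurable]: "v \<in> borel_measurable borel" by (rule l2loc_borel[OF lv])
  have lh: "l2loc h"
    unfolding l2loc_def set_integrable_def
    by (intro conjI allI integrable_mult_indicator[OF _ hi]) simp_all
  have "wd is v h"
    unfolding wd_def
  proof (intro conjI allI impI lv lh)
    fix \<phi> :: "real^'a \<Rightarrow> real" assume \<phi>: "test_fn UNIV \<phi>"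
    have [measurable]: "\<phi> \<in> borel_measurable borel" "iter_pd is \<phi> \<in> borel_measurable borel"
      using test_fn_borel[OF \<phi>] test_fn_borel[OF test_fn_iter_pd[OF \<phi>]] by auto
    have \<phi>m: "\<phi> \<in> borel_measurable lebesgue" by (rule measurable_completion) simp
    have "(LINT x|lborel. v x * iter_pd is \<phi> x) = (LINT x|lebesgue. v x * iter_pd is \<phi> x)"
      by (rule integral_completion[symmetric]) simp
    also have "\<dots> = (LINT x:UNIV|lebesgue. v x * cderiv (count_list is) \<phi> x)"
      using \<phi> by (simp add: set_lebesgue_integral_def cderiv_eq[of \<phi> "is"] test_fn_def)
    also have "\<dots> = (-1) ^ length is * (LINT x|lebesgue. g x * \<phi> x)"
      using g(1) \<phi> by (simp add: has_weak_deriv_def mi_abs_count_list set_lebesgue_integral_def)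
    also have "(LINT x|lebesgue. g x * \<phi> x) = (LINT x|lebesgue. h x * \<phi> x)"
      by (rule integral_cong_AE) (use gm hm \<phi>m ae in auto)
    also have "\<dots> = (LINT x|lborel. h x * \<phi> x)" by (rule integral_completion) simp
    finally show "(LINT x|lborel. v x * iter_pd is \<phi> x) = (-1) ^ length is * (LINT x|lborel. h x * \<phi> x)" .
  qed
  with hi show ?thesis by blast
qed

lemma test_fn_set_integral:
  assumes \<phi>: "test_fn U \<phi>" and [measurable]: "v \<in> borel_measurable borel"
  shows "(LINT x:U|lebesgue. v x * iter_pd is \<phi> x) = (LINT x|lborel. v x * iter_pd is \<phi> x)"
proof -
  have [measurable]: "iter_pd is \<phi> \<in> borel_measurable borel"
    using test_fn_borel[OF test_fn_iter_pd[OF \<phi>]] by auto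
  have "indicator U x *\<^sub>R (v x * iter_pd is \<phi> x) = v x * iter_pd is \<phi> x" for x
  proof (cases "x \<in> U")
    case False
    then have "x \<notin> tsupp \<phi>" using \<phi> by (auto simp: test_fn_def)
    then show ?thesis by (simp add: iter_pd_zero_outside)
  qed simp
  then have "(LINT x:U|lebesgue. v x * iter_pd is \<phi> x) = (LINT x|lebesgue. v x * iter_pd is \<phi> x)"
    by (simp only: set_lebesgue_integral_def)
  also have "\<dots> = (LINT x|lborel. v x * iter_pd is \<phi> x)" by (rule integral_completion) simp
  finally show ?thesis .
qed

lemma wd_imp_has_weak_deriv:
  assumes "wd is v g" shows "has_weak_deriv U (count_list is) v g"
  unfolding has_weak_deriv_def
proof (intro conjI allI impI)
  have l: "l2loc v" "l2loc g" using assms by (auto simp: wd_def)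
  then show "loc_int U v" "loc_int U g" by (auto intro: loc_int_l2loc)
  fix \<phi> :: "real^'a \<Rightarrow> real" assume \<phi>: "test_fn U \<phi>"
  then have "test_fn UNIV \<phi>" by (rule test_fn_mono) simp
  with assms have "(LINT x|lborel. v x * iter_pd is \<phi> x) = (-1) ^ length is * (LINT x|lborel. g x * \<phi> x)"
    by (simp add: wd_def)
  then show "(LINT x:U|lebesgue. v x * cderiv (count_list is) \<phi> x)
      = (-1) ^ mi_abs (count_list is) * (LINT x:U|lebesgue. g x * \<phi> x)"
    using test_fn_set_integral[OF \<phi> l2loc_borel[OF l(1)], of "is"]
      test_fn_set_integral[OF \<phi> l2loc_borel[OF l(2)], of "[]"] \<phi>
    by (simp add: cderiv_eq[of \<phi> "is"] test_fn_def mi_abs_count_list)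
qed

text \<open>\<open>loc_int\<close> provides measurability on compact sets only, and U is exhausted
  by finite unions of compact boxes.\<close>

lemma loc_int_measurable:
  assumes "open U" "loc_int U g"
  shows "(\<lambda>x. indicator U x * g x) \<in> borel_measurable lebesgue"
proof -
  obtain D where D: "countable D" "D \<subseteq> Pow U" "\<And>X. X \<in> D \<Longrightarrow> \<exists>a b. X = cbox a b" "\<Union>D = U"
    using open_countable_Union_open_cbox[OF \<open>open U\<close>] by metis
  show ?thesis
  proof (cases "D = {}")
    case True
    with D have "U = {}" by auto
    then show ?thesis by simp
  next
    case False
    then obtain A :: "nat \<Rightarrow> (real^'a) set" where A: "range A = D"
      using D(1) uncountable_def by blast
    let ?F = "\<lambda>n::nat. \<Union>k<n. A k"
    have "compact (?F n) \<and> ?F n \<subseteq> U" for n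
    proof
      show "compact (?F n)"
      proof (rule compact_UN)
        fix k assume "k \<in> {..<n}"
        have "A k \<in> D" using A by blast
        then show "compact (A k)" using D(3) compact_cbox by metis
      qed simp
      show "?F n \<subseteq> U" using A D(4) by blast
    qed
    then have "set_integrable lebesgue (?F n) g" for n using assms(2) by (simp add: loc_int_def)
    then have m: "(\<lambda>x. indicator (?F n) x * g x) \<in> borel_measurable lebesgue" for n
      unfolding set_integrable_def by (auto dest: borel_measurable_integrable)
    show ?thesis
    proof (rule borel_measurable_LIMSEQ_metric[OF m])
      fix x
      have "(\<lambda>n. indicator (?F n) x * g x) \<longlonglongrightarrow> indicator (\<Union>n. A n) x * g x"
        by (intro tendsto_mult tendsto_const LIMSEQ_indicator_UN)
      then show "(\<lambda>n. indicator (?F n) x * g x) \<longlonglongrightarrow> indicator U x * g x" using A D(4) by simp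
    qed
  qed
qed

text \<open>A derivative on U in the sense of \<open>has_weak_deriv\<close> is merely locally
  integrable on U and arbitrary outside. It is compared with h through a Borel representative
  \<open>g'\<close> of its restriction to U and the fundamental lemma on U.\<close>

lemma has_weak_deriv_unique:
  assumes U: "open U" and g: "has_weak_deriv U (count_list is) v g" and h: "wd is v h"
  shows "AE x in lborel. indicator U x * g x = indicator U x * h x"
proof -
  have lU: "loc_int U g" using g by (simp add: has_weak_deriv_def)
  have m: "(\<lambda>x. indicator U x * g x) \<in> borel_measurable lebesgue" by (rule loc_int_measurable[OF U lU])
  obtain g' where [measurable]: "g' \<in> borel_measurable borel" and ae0: "AE x in lborel. indicator U x * g x = g' x"
    using lebesgue_imp_borel_AE[OF m] by blast
  then have ae: "AE x in lebesgue. indicator U x * g x = g' x" by (intro AE_completion)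
  have g'm: "g' \<in> borel_measurable lebesgue" by (rule measurable_completion) simp
  have lh: "l2loc h" using h by (simp add: wd_def)
  have [measurable]: "h \<in> borel_measurable borel" by (rule l2loc_borel[OF lh])
  have Ub [measurable]: "U \<in> sets borel" using U by simp
  have "AE x in lborel. x \<in> U \<longrightarrow> g' x - h x = 0"
  proof (rule fundamental_lemma[OF _ U])
    show "(\<lambda>x. g' x - h x) \<in> borel_measurable borel" by measurable
    show "set_integrable lborel (cbox a b) (\<lambda>x. g' x - h x)" if ab: "cbox a b \<subseteq> U" for a b
    proof (rule set_integral_diff(1)[OF _ l2loc_integrable[OF lh]])
      have "set_integrable lebesgue (cbox a b) g" using lU ab by (simp add: loc_int_def)
      then have "integrable lebesgue (\<lambda>x. indicator (cbox a b) x *\<^sub>R g' x)"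
        unfolding set_integrable_def
      proof (rule integrable_cong_AE_imp)
        show "AE x in lebesgue. indicator (cbox a b) x *\<^sub>R g x = indicator (cbox a b) x *\<^sub>R g' x"
          using ae by eventually_elim (use ab in \<open>auto simp: indicator_def\<close>)
        show "(\<lambda>x. indicator (cbox a b) x *\<^sub>R g' x) \<in> borel_measurable lebesgue"
          by (rule measurable_completion) simp
      qed
      then show "set_integrable lborel (cbox a b) g'"
        unfolding set_integrable_def by (subst (asm) integrable_completion) auto
    qed
    fix \<phi> :: "real^'a \<Rightarrow> real" assume \<phi>: "test_fn U \<phi>"
    have \<phi>U: "test_fn UNIV \<phi>" using \<phi> by (rule test_fn_mono) simp
    have [measurable]: "\<phi> \<in> borel_measurable borel" by (rule test_fn_borel[OF \<phi>])
    have \<phi>m: "\<phi> \<in> borel_measurable lebesgue" by (rule measurable_completion) simp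
    have lv: "v \<in> borel_measurable borel" using h by (auto simp: wd_def l2loc_borel)
    have "(-1) ^ length is * (LINT x:U|lebesgue. g x * \<phi> x) = (LINT x:U|lebesgue. v x * iter_pd is \<phi> x)"
    proof -
      have "cderiv (count_list is) \<phi> = iter_pd is \<phi>"
        by (rule cderiv_eq) (use \<phi> in \<open>auto simp: test_fn_def\<close>)
      moreover have "(LINT x:U|lebesgue. v x * cderiv (count_list is) \<phi> x)
          = (-1) ^ mi_abs (count_list is) * (LINT x:U|lebesgue. g x * \<phi> x)"
        using g \<phi> unfolding has_weak_deriv_def by blast
      ultimately show ?thesis by (simp add: mi_abs_count_list)
    qed
    also have "\<dots> = (-1) ^ length is * (LINT x|lborel. h x * \<phi> x)"
      using h \<phi>U by (simp add: test_fn_set_integral[OF \<phi> lv] wd_def)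
    finally have e1: "(LINT x:U|lebesgue. g x * \<phi> x) = (LINT x|lborel. h x * \<phi> x)" by simp
    have e2: "(LINT x:U|lebesgue. g x * \<phi> x) = (LINT x|lebesgue. g' x * \<phi> x)"
    proof -
      have "(LINT x:U|lebesgue. g x * \<phi> x) = (LINT x|lebesgue. (indicator U x * g x) * \<phi> x)"
        by (simp add: set_lebesgue_integral_def mult.assoc)
      also have "\<dots> = (LINT x|lebesgue. g' x * \<phi> x)"
        by (rule integral_cong_AE) (use m g'm \<phi>m ae in auto)
      finally show ?thesis .
    qed
    have z: "\<phi> x = 0" if "x \<notin> U" for x
      using iter_pd_zero_outside[of x \<phi> "[]"] \<phi> that by (auto simp: test_fn_def)
    have "integrable lborel (\<lambda>x. g' x * \<phi> x)"
    proof -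
      obtain B where B: "\<And>x. \<bar>\<phi> x\<bar> \<le> B" using test_fn_bounded[OF \<phi>] by blast
      have "set_integrable lebesgue (tsupp \<phi>) g" using lU \<phi> by (simp add: loc_int_def test_fn_def)
      then have "integrable lebesgue (\<lambda>x. B * (indicator (tsupp \<phi>) x *\<^sub>R g x))"
        unfolding set_integrable_def by simp
      then have "integrable lebesgue (\<lambda>x. g' x * \<phi> x)"
      proof (rule Bochner_Integration.integrable_bound)
        show "AE x in lebesgue. norm (g' x * \<phi> x) \<le> norm (B * (indicator (tsupp \<phi>) x *\<^sub>R g x))"
          using ae
        proof eventually_elim
          case (elim x)
          show ?case
          proof (cases "x \<in> tsupp \<phi>")
            case True
            then have "g' x = g x" using elim \<phi> by (auto simp: test_fn_def)
            moreover have "\<bar>\<phi> x\<bar> * \<bar>g x\<bar> \<le> \<bar>B\<bar> * \<bar>g x\<bar>"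
              by (intro mult_right_mono) (use B[of x] in auto)
            ultimately show ?thesis using True by (simp add: abs_mult mult.commute)
          next
            case False
            then show ?thesis using iter_pd_zero_outside[of x \<phi> "[]"] by simp
          qed
        qed
      qed (use g'm \<phi>m in simp)
      then show ?thesis by (subst (asm) integrable_completion) auto
    qed
    moreover have "(LINT x|lebesgue. g' x * \<phi> x) = (LINT x|lborel. g' x * \<phi> x)"
      by (rule integral_completion) simp
    ultimately show "(LINT x|lborel. (g' x - h x) * \<phi> x) = 0"
      using e1 e2 l2loc_test_integrable[OF lh \<phi>U] by (simp add: left_diff_distrib)
  qed
  then show ?thesis using ae0 by eventually_elim (auto simp: indicator_def split: if_splits)
qed

text \<open>The bridge from the derivatives chosen in the statement to concrete Borel functions:
  whatever \<open>weak_deriv\<close> chooses on U agrees almost everywhere on U with any derivative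
  on the whole space.\<close>

lemma l2inner_weak_deriv:
  assumes U: "open U" and f: "wd is u f" and g: "wd js v g"
  shows "l2inner U (weak_deriv U (count_list is) u) (weak_deriv U (count_list js) v)
    = (LINT x:U|lborel. f x * g x)"
proof -
  have w: "has_weak_deriv U (count_list is) v (weak_deriv U (count_list is) v)" if "wd is v f" for "is" v f
    unfolding weak_deriv_def by (rule someI[of _ f]) (rule wd_imp_has_weak_deriv[OF that])
  let ?f = "weak_deriv U (count_list is) u" and ?g = "weak_deriv U (count_list js) v"
  note wf = w[OF f] and wg = w[OF g]
  have [measurable]: "f \<in> borel_measurable borel" "g \<in> borel_measurable borel" "U \<in> sets borel"
    using f g U by (auto simp: wd_def l2loc_borel)
  have m: "(\<lambda>x. indicator U x * ?f x) \<in> borel_measurable lebesgue" "(\<lambda>x. indicator U x * ?g x) \<in> borel_measurable lebesgue"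
    by (rule loc_int_measurable[OF U]; use wf wg in \<open>simp add: has_weak_deriv_def\<close>)+
  have ae: "AE x in lebesgue. indicator U x * ?f x = indicator U x * f x"
    "AE x in lebesgue. indicator U x * ?g x = indicator U x * g x"
    by (rule AE_completion[OF has_weak_deriv_unique[OF U wf f]], rule AE_completion[OF has_weak_deriv_unique[OF U wg g]])
  have fgm: "(\<lambda>x. (indicator U x * f x) * (indicator U x * g x)) \<in> borel_measurable lebesgue"
    by (rule measurable_completion) simp
  have "l2inner U ?f ?g = (LINT x|lebesgue. (indicator U x * ?f x) * (indicator U x * ?g x))"
    unfolding l2inner_def set_lebesgue_integral_def
    by (rule Bochner_Integration.integral_cong) (auto simp: indicator_def)
  also have "\<dots> = (LINT x|lebesgue. (indicator U x * f x) * (indicator U x * g x))"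
  proof (rule integral_cong_AE)
    show "AE x in lebesgue. (indicator U x * ?f x) * (indicator U x * ?g x) = (indicator U x * f x) * (indicator U x * g x)"
      using ae by eventually_elim (simp only:)
  qed (use m fgm in simp_all)
  also have "\<dots> = (LINT x|lborel. (indicator U x * f x) * (indicator U x * g x))"
    by (rule integral_completion) simp
  also have "\<dots> = (LINT x:U|lborel. f x * g x)"
    unfolding set_lebesgue_integral_def
    by (rule Bochner_Integration.integral_cong) (auto simp: indicator_def)
  finally show ?thesis .
qed

subsection \<open>Borel representatives of the derivatives of elements of V\<close>

definition rep_list :: "('n::finite \<Rightarrow> nat) \<Rightarrow> 'n list" where
  "rep_list \<alpha> = (SOME is. count_list is = \<alpha>)"

lemma count_rep_list [simp]: "count_list (rep_list \<alpha>) = \<alpha>"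
proof -
  obtain "is" where "count_list is = \<alpha>" using ex_list_counts[of \<alpha>] by blast
  then show ?thesis unfolding rep_list_def by (rule someI)
qed

lemma length_rep_list [simp]: "length (rep_list \<alpha>) = mi_abs \<alpha>"
  using mi_abs_count_list[of "rep_list \<alpha>"] by simp

text \<open>One representative on the whole space, used for all boxes at once. Being a choice, it is
  handled as linear in u only almost everywhere.\<close>

definition der :: "(real^'n::finite \<Rightarrow> real) \<Rightarrow> ('n \<Rightarrow> nat) \<Rightarrow> real^'n \<Rightarrow> real" where
  "der u \<alpha> = (SOME g. wd (rep_list \<alpha>) u g)"

lemma wd_count_cong: "count_list is = count_list js \<Longrightarrow> wd is v g \<longleftrightarrow> wd js v g"
  by (rule wd_mset_cong) (simp add: mset_eq_iff_count_list)

lemma wd_der_ex: "wd is u g \<Longrightarrow> wd is u (der u (count_list is))"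
proof -
  assume "wd is u g"
  then have "wd (rep_list (count_list is)) u g" using wd_count_cong[of "is" "rep_list (count_list is)"] by simp
  then have "wd (rep_list (count_list is)) u (der u (count_list is))" unfolding der_def by (rule someI[where P = "wd (rep_list (count_list is)) u"])
  then show ?thesis using wd_count_cong[of "is" "rep_list (count_list is)"] by simp
qed

lemma V_spaceI:
  assumes c: "continuous_on UNIV u"
    and d: "\<And>\<alpha>. kmin \<le> mi_abs \<alpha> \<Longrightarrow> mi_abs \<alpha> \<le> k \<Longrightarrow>
      \<exists>g. wd (rep_list \<alpha>) u g \<and> integrable lborel (\<lambda>x. (g x)\<^sup>2)"
  shows "u \<in> V_space kmin k"
  unfolding V_space_def mem_Collect_eq
proof (intro conjI allI impI c)
  show "loc_int UNIV u" by (rule loc_int_l2loc[OF l2loc_continuous[OF c]])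
  fix \<alpha> :: "'a \<Rightarrow> nat" assume \<alpha>: "kmin \<le> mi_abs \<alpha> \<and> mi_abs \<alpha> \<le> k"
  then obtain g where g: "wd (rep_list \<alpha>) u g" "integrable lborel (\<lambda>x. (g x)\<^sup>2)" using d by blast
  have [measurable]: "g \<in> borel_measurable borel" using g(1) by (auto simp: wd_def intro: l2loc_borel)
  have "integrable lebesgue (\<lambda>x. (g x)\<^sup>2)" using g(2) by (subst integrable_completion) auto
  moreover have "g \<in> borel_measurable lebesgue" by (rule measurable_completion) simp
  ultimately have "L2_on UNIV g" by (simp add: L2_on_def set_borel_measurable_def set_integrable_def)
  moreover have "has_weak_deriv UNIV \<alpha> u g" using wd_imp_has_weak_deriv[OF g(1), of UNIV] by simp
  ultimately show "\<exists>g. has_weak_deriv UNIV \<alpha> u g \<and> L2_on UNIV g" by blast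
qed

text \<open>For orders from kmin to k this is the definition of V. Smaller orders are reached from
  the derivatives of order kmin by \<open>wd_lower_orders\<close>.\<close>

lemma V_space_wd:
  fixes u :: "real^'n::finite \<Rightarrow> real"
  assumes u: "u \<in> V_space kmin k" and k: "kmin \<le> k" and len: "length is \<le> k"
  shows "wd is u (der u (count_list is))"
proof -
  have c: "continuous_on UNIV u" using u by (simp add: V_space_def)
  have e: "\<exists>g. wd is u g" if "kmin \<le> length is" "length is \<le> k" for "is"
  proof -
    have "kmin \<le> mi_abs (count_list is) \<and> mi_abs (count_list is) \<le> k"
      using that by (simp add: mi_abs_count_list)
    then obtain g where "has_weak_deriv UNIV (count_list is) u g" "L2_on UNIV g"
      using u unfolding V_space_def by blast
    from has_weak_deriv_imp_wd[OF c this] show ?thesis by blast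
  qed
  have "\<exists>g. wd is u g"
  proof (cases "kmin \<le> length is")
    case True
    then show ?thesis using e len by blast
  next
    case False
    then show ?thesis
      using wd_lower_orders[OF l2loc_continuous[OF c], of kmin "is"] e k by simp
  qed
  then show ?thesis using wd_der_ex by blast
qed

lemma V_space_der_square_integrable:
  fixes u :: "real^'n::finite \<Rightarrow> real"
  assumes u: "u \<in> V_space kmin k" and \<alpha>: "kmin \<le> mi_abs \<alpha>" "mi_abs \<alpha> \<le> k"
  shows "integrable lborel (\<lambda>x. (der u \<alpha> x)\<^sup>2)"
proof -
  have c: "continuous_on UNIV u" using u by (simp add: V_space_def)
  obtain g where "has_weak_deriv UNIV (count_list (rep_list \<alpha>)) u g" "L2_on UNIV g"
    using u \<alpha> by (auto simp: V_space_def)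
  from has_weak_deriv_imp_wd[OF c this] obtain h where
    h: "wd (rep_list \<alpha>) u h" "integrable lborel (\<lambda>x. (h x)\<^sup>2)" by blast
  have d: "wd (rep_list \<alpha>) u (der u \<alpha>)" using wd_der_ex[OF h(1)] by simp
  have "l2loc h" "l2loc (der u \<alpha>)" using h d by (auto simp: wd_def)
  then have [measurable]: "h \<in> borel_measurable borel" "der u \<alpha> \<in> borel_measurable borel"
    by (auto intro: l2loc_borel)
  show ?thesis
    by (rule integrable_cong_AE_imp[OF h(2)]) (use wd_unique[OF h(1) d] in auto)
qed

subsection \<open>The Poincare inequality\<close>

lemma square_sum_le:
  fixes z y :: "'n::finite \<Rightarrow> real"
  assumes "\<And>i. \<bar>z i\<bar> \<le> h"
  shows "(\<Sum>i\<in>UNIV. z i * y i)\<^sup>2 \<le> real CARD('n) * h\<^sup>2 * (\<Sum>i\<in>UNIV. (y i)\<^sup>2)"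
proof -
  have "(\<Sum>i\<in>UNIV. z i * y i)\<^sup>2 \<le> (\<Sum>i\<in>UNIV. (z i)\<^sup>2) * (\<Sum>i\<in>UNIV. (y i)\<^sup>2)"
    by (rule Cauchy_Schwarz_ineq_sum)
  also have "\<dots> \<le> (\<Sum>i\<in>(UNIV::'n set). h\<^sup>2) * (\<Sum>i\<in>UNIV. (y i)\<^sup>2)"
  proof (intro mult_right_mono sum_mono)
    fix i
    have "\<bar>z i\<bar> \<le> \<bar>h\<bar>" using assms[of i] by linarith
    then show "(z i)\<^sup>2 \<le> h\<^sup>2" by (simp add: abs_le_square_iff)
  qed (simp add: sum_nonneg)
  finally show ?thesis by simp
qed

lemma nn_integral_set_square:
  fixes f :: "'a::euclidean_space \<Rightarrow> real"
  assumes "set_integrable lborel S (\<lambda>x. (f x)\<^sup>2)"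
  shows "(\<integral>\<^sup>+x. indicator S x * ennreal ((f x)\<^sup>2) \<partial>lborel) = ennreal (LINT x:S|lborel. (f x)\<^sup>2)"
proof -
  have "(\<integral>\<^sup>+x. indicator S x * ennreal ((f x)\<^sup>2) \<partial>lborel) = (\<integral>\<^sup>+x. ennreal (indicator S x *\<^sub>R (f x)\<^sup>2) \<partial>lborel)"
    by (rule nn_integral_cong) (simp add: indicator_def)
  also have "\<dots> = ennreal (LINT x:S|lborel. (f x)\<^sup>2)"
    unfolding set_lebesgue_integral_def
    by (rule nn_integral_eq_integral[OF assms[unfolded set_integrable_def]]) simp
  finally show ?thesis .
qed

lemma set_square_nonneg: "0 \<le> (LINT x:S|lborel. (f x :: real)\<^sup>2)"
  unfolding set_lebesgue_integral_def by (rule Bochner_Integration.integral_nonneg) simp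

lemma l2loc_set_integrable:
  assumes "l2loc f" "l2loc g" "S \<in> sets borel" "S \<subseteq> cbox c d"
  shows "set_integrable lborel S (\<lambda>x. f x * g x)"
  by (rule set_integrable_subset[OF l2loc_mult_integrable[OF assms(1,2), of c d]]) (use assms in auto)

text \<open>Both sides arise from the double integral of \<open>(w y - w x)\<^sup>2\<close> over \<open>S \<times> S\<close>: the mean zero condition bounds it
  from below, the substitution \<open>y = x + z\<close> and convexity of S bound it from above.\<close>

lemma poincare_cell:
  fixes w :: "real^'n::finite \<Rightarrow> real"
  assumes wd: "\<And>i. wd [i] w (g i)"
    and S [measurable]: "S \<in> sets borel" and "convex S" and sub: "box c d \<subseteq> S" "S \<subseteq> cbox c d"
    and cd: "\<And>i. c $ i < d $ i" "\<And>i. d $ i - c $ i \<le> h"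
    and mean: "(LINT x:S|lborel. w x) = 0"
  shows "(LINT x:S|lborel. (w x)\<^sup>2) \<le> 2 ^ CARD('n) * real CARD('n) * h\<^sup>2 * (\<Sum>i\<in>UNIV. (LINT x:S|lborel. (g i x)\<^sup>2))"
proof -
  have lw: "l2loc w" and lg: "\<And>i. l2loc (g i)" using wd by (auto simp: wd_def)
  have wm [measurable]: "w \<in> borel_measurable borel" and gm [measurable]: "\<And>i. g i \<in> borel_measurable borel"
    using lw lg by (auto intro: l2loc_borel)
  have c1: "continuous_on UNIV (\<lambda>_::real. 1::real)" by simp
  define vol where "vol = (\<Prod>i\<in>UNIV. d $ i - c $ i)"
  have vol: "0 < vol" unfolding vol_def using cd by (simp add: prod_pos)
  have ebox: "emeasure lborel (cbox a b) = ennreal (\<Prod>i\<in>UNIV. b $ i - a $ i)"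
    "emeasure lborel (box a b) = ennreal (\<Prod>i\<in>UNIV. b $ i - a $ i)"
    if "\<And>i. a $ i \<le> b $ i" for a b :: "real^'n"
  proof -
    have p: "(\<Prod>i\<in>Basis. (b - a) \<bullet> i) = (\<Prod>i\<in>UNIV. b $ i - a $ i)"
      by (simp add: Basis_vec_def prod.reindex inj_on_def axis_eq_axis inner_axis prod.UNION_disjoint
          flip: image_image)
    have le: "\<And>i. i \<in> Basis \<Longrightarrow> a \<bullet> i \<le> b \<bullet> i"
      using that by (auto simp: Basis_vec_def inner_axis)
    show "emeasure lborel (cbox a b) = ennreal (\<Prod>i\<in>UNIV. b $ i - a $ i)"
      "emeasure lborel (box a b) = ennreal (\<Prod>i\<in>UNIV. b $ i - a $ i)"
      using emeasure_lborel_cbox[of a b, OF le] emeasure_lborel_box[of a b, OF le] p by auto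
  qed
  have cle: "c $ i \<le> d $ i" for i using cd(1)[of i] by simp
  have eS: "emeasure lborel S = ennreal vol"
  proof (rule antisym)
    show "emeasure lborel S \<le> ennreal vol"
      using emeasure_mono[OF sub(2), of lborel] ebox(1)[OF cle] by (simp add: vol_def)
    show "ennreal vol \<le> emeasure lborel S"
      using emeasure_mono[OF sub(1), of lborel] ebox(2)[OF cle] by (simp add: vol_def)
  qed
  define W where "W = (LINT x:S|lborel. (w x)\<^sup>2)"
  define G where "G = (\<Sum>i\<in>UNIV. (LINT x:S|lborel. (g i x)\<^sup>2))"
  have G0: "0 \<le> G" unfolding G_def by (intro sum_nonneg set_square_nonneg)
  \<comment> \<open>All differences y - x of points of S lie here. The volume of this box is 2^d
    times that of S, the origin of the factor \<open>2 ^ CARD('n)\<close>.\<close>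
  let ?R = "cbox (c - d) (d - c)"
  define F where "F z x = indicator S x * (indicator S (x + z) * ennreal ((w (x + z) - w x)\<^sup>2))" for z x
  have Fm [measurable]: "(\<lambda>(z, x). F z x) \<in> borel_measurable (lborel \<Otimes>\<^sub>M lborel)"
    unfolding F_def by measurable
  \<comment> \<open>Cauchy-Schwarz in the difference formula, with every component of z at most h in
    absolute value, contributes d h^2; by convexity the segments from x to x + z stay in S.\<close>
  have up: "(\<integral>\<^sup>+x. F z x \<partial>lborel) \<le> ennreal (real CARD('n) * h\<^sup>2 * G) * indicator ?R z" for z
  proof (cases "z \<in> ?R")
    case False
    have "F z x = 0" for x
    proof (rule ccontr)
      assume "F z x \<noteq> 0"
      then have "x \<in> S" "x + z \<in> S" by (auto simp: F_def indicator_def split: if_splits)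
      then have "x \<in> cbox c d" "x + z \<in> cbox c d" using sub by auto
      then have "(c - d) $ i \<le> z $ i \<and> z $ i \<le> (d - c) $ i" for i
        unfolding mem_box_cart by (auto dest!: spec[of _ i])
      with False show False by (simp add: mem_box_cart)
    qed
    then show ?thesis by simp
  next
    case True
    have zh: "\<bar>z $ i\<bar> \<le> h" for i
    proof -
      have "c $ i - d $ i \<le> z $ i \<and> z $ i \<le> d $ i - c $ i" using True by (simp add: mem_box_cart)
      then show ?thesis using cd(2)[of i] by linarith
    qed
    let ?A = "{x. x \<in> S \<and> x + z \<in> S}"
    let ?av = "\<lambda>i. line_avg (\<lambda>_. 1) z (g i)"
    have avm [measurable]: "?av i \<in> borel_measurable borel" for i by (rule line_avg_borel[OF c1 gm])
    have Am [measurable]: "?A \<in> sets borel"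
    proof -
      have "{x \<in> space borel. x \<in> S \<and> x + z \<in> S} \<in> sets borel" by measurable
      then show ?thesis by simp
    qed
    have "(\<integral>\<^sup>+x. F z x \<partial>lborel) \<le> (\<integral>\<^sup>+x. (\<Sum>i\<in>UNIV. ennreal (real CARD('n) * h\<^sup>2) * (indicator ?A x * ennreal ((?av i x)\<^sup>2))) \<partial>lborel)"
    proof (rule nn_integral_mono_AE)
      show "AE x in lborel. F z x \<le> (\<Sum>i\<in>UNIV. ennreal (real CARD('n) * h\<^sup>2) * (indicator ?A x * ennreal ((?av i x)\<^sup>2)))"
        using weak_difference[OF wd, where z = z]
      proof eventually_elim
        case (elim x)
        show ?case
        proof (cases "x \<in> ?A")
          case True
          have "(w (x + z) - w x)\<^sup>2 \<le> real CARD('n) * h\<^sup>2 * (\<Sum>i\<in>UNIV. (?av i x)\<^sup>2)"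
            unfolding elim by (rule square_sum_le[OF zh])
          then have "ennreal ((w (x + z) - w x)\<^sup>2) \<le> ennreal (real CARD('n) * h\<^sup>2 * (\<Sum>i\<in>UNIV. (?av i x)\<^sup>2))"
            by (rule ennreal_leI)
          also have "\<dots> = (\<Sum>i\<in>UNIV. ennreal (real CARD('n) * h\<^sup>2) * ennreal ((?av i x)\<^sup>2))"
            by (simp add: ennreal_mult sum_nonneg sum_ennreal[symmetric] sum_distrib_left)
          finally show ?thesis using True by (simp add: F_def)
        qed (auto simp: F_def indicator_def)
      qed
    qed
    also have "\<dots> = (\<Sum>i\<in>UNIV. ennreal (real CARD('n) * h\<^sup>2) * (\<integral>\<^sup>+x. indicator ?A x * ennreal ((?av i x)\<^sup>2) \<partial>lborel))"
      by (subst nn_integral_sum) (auto intro!: sum.cong nn_integral_cmult)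
    also have "\<dots> \<le> (\<Sum>i\<in>UNIV. ennreal (real CARD('n) * h\<^sup>2) * ennreal (LINT x:S|lborel. (g i x)\<^sup>2))"
    proof (intro sum_mono mult_left_mono)
      fix i
      have "(\<integral>\<^sup>+x. indicator ?A x * ennreal ((?av i x)\<^sup>2) \<partial>lborel) \<le> ennreal (1\<^sup>2) * (\<integral>\<^sup>+x. indicator S x * ennreal ((g i x)\<^sup>2) \<partial>lborel)"
      proof (rule nn_integral_line_avg_square[OF c1 gm _ Am S])
        fix s :: real and x assume s: "s \<in> {0..1}" and x: "x \<in> ?A"
        have "x + s *\<^sub>R z = (1 - s) *\<^sub>R x + s *\<^sub>R (x + z)" by (simp add: algebra_simps)
        with s x show "x + s *\<^sub>R z \<in> S" using \<open>convex S\<close> unfolding convex_alt by simp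
      qed simp
      also have "(\<integral>\<^sup>+x. indicator S x * ennreal ((g i x)\<^sup>2) \<partial>lborel) = ennreal (LINT x:S|lborel. (g i x)\<^sup>2)"
        by (rule nn_integral_set_square)
           (use l2loc_set_integrable[OF lg lg S sub(2)] in \<open>simp add: power2_eq_square\<close>)
      finally show "(\<integral>\<^sup>+x. indicator ?A x * ennreal ((?av i x)\<^sup>2) \<partial>lborel) \<le> ennreal (LINT x:S|lborel. (g i x)\<^sup>2)" by simp
    qed simp
    also have "\<dots> = ennreal (real CARD('n) * h\<^sup>2 * G)"
      by (simp add: G_def ennreal_mult sum_nonneg set_square_nonneg sum_ennreal[symmetric] sum_distrib_left)
    finally show ?thesis using True by simp
  qed
  have vR: "emeasure lborel ?R = ennreal (2 ^ CARD('n) * vol)"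
  proof -
    have le: "(c - d) $ i \<le> (d - c) $ i" for i using cle[of i] by simp
    have "(d - c) $ i - (c - d) $ i = 2 * (d $ i - c $ i)" for i by simp
    then have "emeasure lborel ?R = ennreal (\<Prod>i\<in>UNIV. 2 * (d $ i - c $ i))"
      unfolding ebox(1)[OF le] by presburger
    then show ?thesis by (simp only: prod.distrib prod_constant vol_def)
  qed
  have isq: "set_integrable lborel S (\<lambda>x. (w x)\<^sup>2)"
    using l2loc_set_integrable[OF lw lw S sub(2)] by (simp add: power2_eq_square)
  have iw: "set_integrable lborel S w"
    using l2loc_set_integrable[OF lw l2loc_const[of 1] S sub(2)] by simp
  have iq: "set_integrable lborel S (\<lambda>x. q)" for q :: real
    using l2loc_set_integrable[OF l2loc_const[of q] l2loc_const[of 1] S sub(2)] by simp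
  \<comment> \<open>Expanding the square, the mean zero condition removes the cross term, and the
    remaining constant \<open>W\<close> is nonnegative and dropped.\<close>
  have low: "ennreal (vol * (w x)\<^sup>2) * indicator S x \<le> (\<integral>\<^sup>+z. F z x \<partial>lborel)" for x
  proof (cases "x \<in> S")
    case True
    have m: "measure lborel S = vol" using eS vol by (simp add: measure_def)
    have i2: "set_integrable lborel S (\<lambda>y. (w y)\<^sup>2 + (w x)\<^sup>2 - 2 * w x * w y)"
      by (intro set_integral_diff(1) set_integral_add(1) set_integrable_mult_right isq iw iq)
    have sq: "(w y - w x)\<^sup>2 = (w y)\<^sup>2 + (w x)\<^sup>2 - 2 * w x * w y" for y
      by (simp add: power2_diff mult_ac)
    have "(\<integral>\<^sup>+z. F z x \<partial>lborel) = (\<integral>\<^sup>+z. indicator S (z + x) * ennreal ((w (z + x) - w x)\<^sup>2) \<partial>lborel)"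
      using True by (simp add: F_def add.commute)
    also have "\<dots> = (\<integral>\<^sup>+y. indicator S y * ennreal ((w y - w x)\<^sup>2) \<partial>lborel)"
      by (rule nn_integral_translate[where f = "\<lambda>y. indicator S y * ennreal ((w y - w x)\<^sup>2)"]) measurable
    also have "\<dots> = ennreal (LINT y:S|lborel. (w y - w x)\<^sup>2)"
      by (rule nn_integral_set_square) (use i2 in \<open>simp add: sq\<close>)
    also have "(LINT y:S|lborel. (w y - w x)\<^sup>2) = W + vol * (w x)\<^sup>2"
    proof -
      have "(LINT y:S|lborel. (w y - w x)\<^sup>2) = (LINT y:S|lborel. (w y)\<^sup>2) + (LINT y:S|lborel. (w x)\<^sup>2) - (LINT y:S|lborel. 2 * w x * w y)"
        unfolding sq by (subst set_integral_diff(2) set_integral_add(2); (intro set_integral_add(1) set_integrable_mult_right isq iw iq)?)+ simp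
      also have "(LINT y:S|lborel. (w x)\<^sup>2) = vol * (w x)\<^sup>2"
        using m eS by (simp add: set_lebesgue_integral_def)
      also have "(LINT y:S|lborel. 2 * w x * w y) = 0" using mean by simp
      finally show ?thesis by (simp add: W_def)
    qed
    finally have "(\<integral>\<^sup>+z. F z x \<partial>lborel) = ennreal (W + vol * (w x)\<^sup>2)" .
    moreover have "0 \<le> W" unfolding W_def by (rule set_square_nonneg)
    ultimately show ?thesis using True by (simp add: ennreal_leI)
  qed simp
  have "ennreal (vol * W) = ennreal vol * (\<integral>\<^sup>+x. indicator S x * ennreal ((w x)\<^sup>2) \<partial>lborel)"
    using vol by (simp add: nn_integral_set_square[OF isq] W_def ennreal_mult set_square_nonneg)
  also have "\<dots> = (\<integral>\<^sup>+x. ennreal (vol * (w x)\<^sup>2) * indicator S x \<partial>lborel)"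
    by (subst nn_integral_cmult[symmetric]) (use vol in \<open>auto intro!: nn_integral_cong simp: ennreal_mult mult_ac\<close>)
  also have "\<dots> \<le> (\<integral>\<^sup>+x. (\<integral>\<^sup>+z. F z x \<partial>lborel) \<partial>lborel)" by (rule nn_integral_mono) (rule low)
  also have "\<dots> = (\<integral>\<^sup>+z. (\<integral>\<^sup>+x. F z x \<partial>lborel) \<partial>lborel)"
    by (rule lborel_pair.Fubini'[OF Fm])
  also have "\<dots> \<le> (\<integral>\<^sup>+z. ennreal (real CARD('n) * h\<^sup>2 * G) * indicator ?R z \<partial>lborel)"
    by (rule nn_integral_mono) (rule up)
  also have "\<dots> = ennreal (real CARD('n) * h\<^sup>2 * G) * ennreal (2 ^ CARD('n) * vol)"
    by (subst nn_integral_cmult_indicator) (auto simp: vR)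
  also have "\<dots> = ennreal (vol * (2 ^ CARD('n) * real CARD('n) * h\<^sup>2 * G))"
    using G0 vol by (simp add: ennreal_mult[symmetric] mult_ac)
  finally have "vol * W \<le> vol * (2 ^ CARD('n) * real CARD('n) * h\<^sup>2 * G)"
    using G0 vol by (subst (asm) ennreal_le_iff) auto
  then show ?thesis using vol by (simp add: W_def G_def)
qed

text \<open>The identity of indicators encodes disjointness and covering together, in the form in
  which integrals are split. A cell lies between an open box and its closure because half-open cells
  are cut by the open box.\<close>

definition cell_partition :: "real \<Rightarrow> real^'n::finite \<Rightarrow> real^'n \<Rightarrow> (real^'n) set set \<Rightarrow> bool" where
  "cell_partition H a b \<C> \<longleftrightarrow> finite \<C> \<and>
     (\<forall>C\<in>\<C>. C \<in> sets borel \<and> C \<subseteq> box a b \<and> convex C \<and>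
        (\<exists>c d. box c d \<subseteq> C \<and> C \<subseteq> cbox c d \<and> (\<forall>i. c $ i < d $ i \<and> d $ i - c $ i \<le> H))) \<and>
     (\<forall>x. indicator (box a b) x = (\<Sum>C\<in>\<C>. indicator C x :: real))"

text \<open>A grid of half-open cells with the least number of pieces per axis that makes the sides
  at most H. The index of the cell of x is the floor of (x_i - a_i)/h_i, so the cells are disjoint
  exactly and not just up to null sets.\<close>

lemma box_cells:
  fixes a b :: "real^'n::finite"
  assumes ab: "\<And>i. a $ i < b $ i" and H: "0 < H"
  shows "\<exists>\<C>. cell_partition H a b \<C> \<and> card \<C> \<le> (\<Prod>i\<in>UNIV. nat \<lceil>(b $ i - a $ i) / H\<rceil>)"
proof -
  define n where "n i = nat \<lceil>(b $ i - a $ i) / H\<rceil>" for i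
  have n0: "0 < n i" for i unfolding n_def using ab[of i] H by simp
  define h where "h i = (b $ i - a $ i) / real (n i)" for i
  have h0: "0 < h i" for i unfolding h_def using ab[of i] n0[of i] by simp
  have hH: "h i \<le> H" for i
  proof -
    have "(b $ i - a $ i) / H \<le> real (n i)" unfolding n_def by (rule real_nat_ceiling_ge)
    then show ?thesis unfolding h_def using n0[of i] H by (simp add: field_simps)
  qed
  have nh: "real (n i) * h i = b $ i - a $ i" for i unfolding h_def using n0[of i] by simp
  define P where "P = (\<Pi>\<^sub>E i\<in>(UNIV::'n set). {..<n i})"
  define c where "c p = (\<chi> i. a $ i + real (p i) * h i)" for p
  define d where "d p = (\<chi> i. a $ i + (real (p i) + 1) * h i)" for p
  define cell where "cell p = {x \<in> box a b. \<forall>i. c p $ i \<le> x $ i \<and> x $ i < d p $ i}" for p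
  have idx: "p i = nat \<lfloor>(x $ i - a $ i) / h i\<rfloor>" if "x \<in> cell p" for p x i
  proof -
    have "a $ i + real (p i) * h i \<le> x $ i" "x $ i < a $ i + (real (p i) + 1) * h i"
      using that by (auto simp: cell_def c_def d_def)
    then have "real (p i) \<le> (x $ i - a $ i) / h i" "(x $ i - a $ i) / h i < real (p i) + 1"
      using h0[of i] by (auto simp: field_simps)
    then have "\<lfloor>(x $ i - a $ i) / h i\<rfloor> = int (p i)" by (intro floor_unique) auto
    then show ?thesis by simp
  qed
  have uniq: "p = q" if "x \<in> cell p" "x \<in> cell q" for p q x
    using idx[OF that(1)] idx[OF that(2)] by auto
  have ex: "\<exists>p\<in>P. x \<in> cell p" if x: "x \<in> box a b" for x
  proof -
    define p where "p i = nat \<lfloor>(x $ i - a $ i) / h i\<rfloor>" for i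
    have xi: "a $ i < x $ i" "x $ i < b $ i" for i using x by (auto simp: mem_box_cart)
    have pr: "real (p i) \<le> (x $ i - a $ i) / h i \<and> (x $ i - a $ i) / h i < real (p i) + 1" for i
    proof -
      have "0 \<le> (x $ i - a $ i) / h i" using xi(1)[of i] h0[of i] by simp
      then show ?thesis unfolding p_def by simp
    qed
    have "p i < n i" for i
    proof -
      have "real (p i) * h i \<le> x $ i - a $ i" using pr[of i] h0[of i] by (simp add: field_simps)
      also have "\<dots> < real (n i) * h i" using nh[of i] xi(2)[of i] by simp
      finally show ?thesis using h0[of i] by simp
    qed
    then have "p \<in> P" by (simp add: P_def PiE_def Pi_def)
    moreover have "x \<in> cell p"
      using x pr h0 by (auto simp: cell_def c_def d_def field_simps)
    ultimately show ?thesis by blast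
  qed
  have fP: "finite P" unfolding P_def by (rule finite_PiE) simp_all
  let ?\<C> = "cell ` P"
  show ?thesis
  unfolding cell_partition_def
  proof (rule exI[of _ ?\<C>], intro conjI ballI allI)
    show "finite ?\<C>" using fP by simp
    have "card ?\<C> \<le> card P" by (rule card_image_le[OF fP])
    also have "card P = (\<Prod>i\<in>UNIV. n i)" by (simp add: P_def card_PiE)
    finally show "card ?\<C> \<le> (\<Prod>i\<in>UNIV. nat \<lceil>(b $ i - a $ i) / H\<rceil>)" by (simp add: n_def)
  next
    fix x
    show "indicator (box a b) x = (\<Sum>C\<in>?\<C>. indicator C x :: real)"
    proof (cases "x \<in> box a b")
      case True
      then obtain p where p: "p \<in> P" "x \<in> cell p" using ex by blast
      have "(\<Sum>C\<in>?\<C>. indicator C x :: real) = (\<Sum>C\<in>{cell p}. indicator C x)"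
      proof (rule sum.mono_neutral_right)
        show "\<forall>C\<in>?\<C> - {cell p}. indicator C x = (0::real)"
          using uniq[OF p(2)] by (auto simp: indicator_def)
      qed (use fP p in auto)
      then show ?thesis using p True by simp
    next
      case False
      then have "x \<notin> cell p" for p by (auto simp: cell_def)
      then show ?thesis using False by (auto intro!: sum.neutral)
    qed
  next
    fix C assume "C \<in> ?\<C>"
    then obtain p where p: "p \<in> P" and C: "C = cell p" by blast
    have cellE: "cell p = box a b \<inter> (\<Inter>i. {x. c p $ i \<le> x $ i} \<inter> {x. x $ i < d p $ i})"
      by (auto simp: cell_def)
    have hs: "closed {x::real^'n. r \<le> x $ i}" "open {x::real^'n. x $ i < r}" for r i
      by (auto intro!: closed_Collect_le open_Collect_less continuous_intros)
    show "C \<in> sets borel" unfolding C cellE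
      by (intro sets.Int sets.countable_INT') (use hs in auto)
    show "C \<subseteq> box a b" by (auto simp: C cell_def)
    show "convex C" unfolding C
    proof (rule convexI)
      fix x y and u v :: real
      assume x: "x \<in> cell p" and y: "y \<in> cell p" and uv: "0 \<le> u" "0 \<le> v" "u + v = 1"
      have "u *\<^sub>R x + v *\<^sub>R y \<in> box a b"
        using convex_box(2)[of a b] x y uv unfolding convex_def cell_def by blast
      moreover have "c p $ i \<le> u * x $ i + v * y $ i \<and> u * x $ i + v * y $ i < d p $ i" for i
      proof -
        have "x $ i \<in> {c p $ i..<d p $ i}" "y $ i \<in> {c p $ i..<d p $ i}" using x y by (auto simp: cell_def)
        moreover have "convex {c p $ i..<d p $ i}" by simp
        ultimately have "u *\<^sub>R x $ i + v *\<^sub>R y $ i \<in> {c p $ i..<d p $ i}" using uv unfolding convex_def by blast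
        then show ?thesis by simp
      qed
      ultimately show "u *\<^sub>R x + v *\<^sub>R y \<in> cell p" by (simp add: cell_def)
    qed
    have pn: "real (p i) + 1 \<le> real (n i)" for i
    proof -
      have "p i < n i" using p by (auto simp: P_def PiE_def Pi_def)
      then show ?thesis by linarith
    qed
    have "box (c p) (d p) \<subseteq> C"
    proof
      fix x assume x: "x \<in> box (c p) (d p)"
      then have xi: "c p $ i < x $ i" "x $ i < d p $ i" for i by (auto simp: mem_box_cart)
      have "a $ i < x $ i \<and> x $ i < b $ i" for i
      proof -
        have "0 \<le> real (p i) * h i" using h0[of i] by simp
        moreover have "(real (p i) + 1) * h i \<le> real (n i) * h i"
          by (rule mult_right_mono[OF pn]) (use h0[of i] in simp)
        ultimately show ?thesis using xi[of i] nh[of i] by (simp add: c_def d_def)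
      qed
      then show "x \<in> C" using xi by (auto simp: C cell_def mem_box_cart less_imp_le)
    qed
    moreover have "C \<subseteq> cbox (c p) (d p)" by (auto simp: C cell_def mem_box_cart less_imp_le)
    moreover have "c p $ i < d p $ i \<and> d p $ i - c p $ i \<le> H" for i
      using h0[of i] hH[of i] by (simp add: c_def d_def algebra_simps)
    ultimately show "\<exists>c d. box c d \<subseteq> C \<and> C \<subseteq> cbox c d \<and> (\<forall>i. c $ i < d $ i \<and> d $ i - c $ i \<le> H)" by blast
  qed
qed

text \<open>The inequalities of the cells add up without loss, so the constant involves the cell
  size H and not the size of the box.\<close>

lemma poincare_box:
  fixes w :: "real^'n::finite \<Rightarrow> real"
  assumes wd: "\<And>i. wd [i] w (g i)" and part: "cell_partition H a b \<C>"
    and mean: "\<And>C. C \<in> \<C> \<Longrightarrow> (LINT x:C|lborel. w x) = 0"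
  shows "(LINT x:box a b|lborel. (w x)\<^sup>2)
    \<le> 2 ^ CARD('n) * real CARD('n) * H\<^sup>2 * (\<Sum>i\<in>UNIV. (LINT x:box a b|lborel. (g i x)\<^sup>2))"
proof -
  have cells: "\<And>C. C \<in> \<C> \<Longrightarrow> C \<in> sets borel \<and> C \<subseteq> box a b \<and> convex C \<and>
        (\<exists>c d. box c d \<subseteq> C \<and> C \<subseteq> cbox c d \<and> (\<forall>i. c $ i < d $ i \<and> d $ i - c $ i \<le> H))"
    and ind: "\<And>x. indicator (box a b) x = (\<Sum>C\<in>\<C>. indicator C x :: real)"
    using part unfolding cell_partition_def by blast+
  have lw: "l2loc w" and lg: "\<And>i. l2loc (g i)" using wd by (auto simp: wd_def)
  have split: "(LINT x:box a b|lborel. (f x)\<^sup>2) = (\<Sum>C\<in>\<C>. (LINT x:C|lborel. (f x)\<^sup>2))" if "l2loc f" for f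
  proof -
    have i: "set_integrable lborel C (\<lambda>x. (f x)\<^sup>2)" if "C \<in> \<C>" for C
      using l2loc_set_integrable[OF \<open>l2loc f\<close> \<open>l2loc f\<close>, of C a b] cells[OF that] box_subset_cbox[of a b]
      by (auto simp: power2_eq_square)
    have "(LINT x:box a b|lborel. (f x)\<^sup>2) = (LINT x|lborel. (\<Sum>C\<in>\<C>. indicator C x *\<^sub>R (f x)\<^sup>2))"
      by (simp add: set_lebesgue_integral_def ind sum_distrib_right)
    also have "\<dots> = (\<Sum>C\<in>\<C>. (LINT x:C|lborel. (f x)\<^sup>2))"
      unfolding set_lebesgue_integral_def
      by (rule Bochner_Integration.integral_sum) (use i in \<open>auto simp: set_integrable_def\<close>)
    finally show ?thesis .
  qed
  have "(LINT x:box a b|lborel. (w x)\<^sup>2) = (\<Sum>C\<in>\<C>. (LINT x:C|lborel. (w x)\<^sup>2))" by (rule split[OF lw])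
  also have "\<dots> \<le> (\<Sum>C\<in>\<C>. 2 ^ CARD('n) * real CARD('n) * H\<^sup>2 * (\<Sum>i\<in>UNIV. (LINT x:C|lborel. (g i x)\<^sup>2)))"
  proof (rule sum_mono)
    fix C assume C: "C \<in> \<C>"
    then obtain c d where cd: "box c d \<subseteq> C" "C \<subseteq> cbox c d" "\<And>i. c $ i < d $ i" "\<And>i. d $ i - c $ i \<le> H"
      using cells by blast
    show "(LINT x:C|lborel. (w x)\<^sup>2) \<le> 2 ^ CARD('n) * real CARD('n) * H\<^sup>2 * (\<Sum>i\<in>UNIV. (LINT x:C|lborel. (g i x)\<^sup>2))"
      by (rule poincare_cell[OF wd _ _ cd mean[OF C]]) (use cells[OF C] in auto)
  qed
  also have "\<dots> = 2 ^ CARD('n) * real CARD('n) * H\<^sup>2 * (\<Sum>i\<in>UNIV. (\<Sum>C\<in>\<C>. (LINT x:C|lborel. (g i x)\<^sup>2)))"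
    by (simp only: sum_distrib_left[symmetric] sum.swap[of _ \<C>])
  also have "\<dots> = 2 ^ CARD('n) * real CARD('n) * H\<^sup>2 * (\<Sum>i\<in>UNIV. (LINT x:box a b|lborel. (g i x)\<^sup>2))"
    by (simp add: split[OF lg])
  finally show ?thesis .
qed

subsection \<open>The Leibniz rule for weak derivatives\<close>

text \<open>The derivative of w is tested with \<open>\<zeta> x * \<phi> x\<close> and the classical
  product rule is applied.\<close>

lemma wd_product:
  fixes \<zeta> :: "real^'n::finite \<Rightarrow> real"
  assumes w: "wd [i] w g" and \<zeta>: "test_fn UNIV \<zeta>"
  shows "wd [i] (\<lambda>x. \<zeta> x * w x) (\<lambda>x. \<zeta> x * g x + pd i \<zeta> x * w x)"
proof -
  have lw: "l2loc w" and lg: "l2loc g" using w by (auto simp: wd_def)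
  have sm: "smooth_fn \<zeta>" using \<zeta> by (simp add: test_fn_def)
  have l: "l2loc (\<lambda>x. f x * h x)" if f: "test_fn UNIV f" and h: "l2loc h" for f h :: "real^'n \<Rightarrow> real"
  proof -
    obtain M where "\<And>x. \<bar>f x\<bar> \<le> M" using test_fn_bounded[OF f] by blast
    then show ?thesis by (rule l2loc_mult_bounded[OF h test_fn_borel[OF f]])
  qed
  have p: "test_fn UNIV (pd i \<zeta>)" by (rule test_fn_pd[OF \<zeta>])
  show ?thesis
    unfolding wd_def
  proof (intro conjI allI impI l2loc_add l \<zeta> lw lg p)
    fix \<phi> :: "real^'n \<Rightarrow> real" assume \<phi>: "test_fn UNIV \<phi>"
    then have sp: "smooth_fn \<phi>" by (simp add: test_fn_def)
    have t: "test_fn UNIV (\<lambda>x. \<zeta> x * \<phi> x)" by (rule test_fn_mult[OF sm \<phi>])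
    have "(LINT x|lborel. w x * pd i (\<lambda>x. \<zeta> x * \<phi> x) x) = - (LINT x|lborel. g x * (\<zeta> x * \<phi> x))"
      using w t by (simp add: wd_def)
    moreover have "w x * pd i (\<lambda>x. \<zeta> x * \<phi> x) x = (\<zeta> x * w x) * pd i \<phi> x + (pd i \<zeta> x * w x) * \<phi> x" for x
    proof -
      have "pd i (\<lambda>x. \<zeta> x * \<phi> x) x = \<zeta> x * pd i \<phi> x + pd i \<zeta> x * \<phi> x"
        by (rule pd_mult[OF smooth_fnD[OF sm] smooth_fnD[OF sp]])
      then show ?thesis by (simp only:) (simp add: algebra_simps)
    qed
    moreover have i1: "integrable lborel (\<lambda>x. (\<zeta> x * w x) * pd i \<phi> x)"
      by (rule l2loc_test_integrable[OF l[OF \<zeta> lw] test_fn_pd[OF \<phi>]])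
    moreover have i2: "integrable lborel (\<lambda>x. (pd i \<zeta> x * w x) * \<phi> x)"
      by (rule l2loc_test_integrable[OF l[OF p lw] \<phi>])
    ultimately have e: "(LINT x|lborel. (\<zeta> x * w x) * pd i \<phi> x) + (LINT x|lborel. (pd i \<zeta> x * w x) * \<phi> x)
        = - (LINT x|lborel. g x * (\<zeta> x * \<phi> x))" by simp
    have i3: "integrable lborel (\<lambda>x. (\<zeta> x * g x) * \<phi> x)"
      by (rule l2loc_test_integrable[OF l[OF \<zeta> lg] \<phi>])
    have "(LINT x|lborel. (\<zeta> x * g x + pd i \<zeta> x * w x) * \<phi> x)
       = (LINT x|lborel. (\<zeta> x * g x) * \<phi> x) + (LINT x|lborel. (pd i \<zeta> x * w x) * \<phi> x)"
      using i2 i3 by (simp add: distrib_right)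
    moreover have "(LINT x|lborel. (\<zeta> x * g x) * \<phi> x) = (LINT x|lborel. g x * (\<zeta> x * \<phi> x))"
      by (simp add: mult_ac)
    ultimately show "(LINT x|lborel. \<zeta> x * w x * iter_pd [i] \<phi> x)
      = (-1) ^ length [i] * (LINT x|lborel. (\<zeta> x * g x + pd i \<zeta> x * w x) * \<phi> x)"
      using e by simp
  qed
qed

lemma wd_add:
  assumes "wd is v g" "wd is w h" shows "wd is (\<lambda>x. v x + w x) (\<lambda>x. g x + h x)"
  unfolding wd_def
proof (intro conjI allI impI)
  have l: "l2loc v" "l2loc w" "l2loc g" "l2loc h" using assms by (auto simp: wd_def)
  then show "l2loc (\<lambda>x. v x + w x)" "l2loc (\<lambda>x. g x + h x)" by (auto intro: l2loc_add)
  fix \<phi> :: "real^'a \<Rightarrow> real" assume \<phi>: "test_fn UNIV \<phi>"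
  show "(LINT x|lborel. (v x + w x) * iter_pd is \<phi> x) = (-1) ^ length is * (LINT x|lborel. (g x + h x) * \<phi> x)"
    using assms \<phi> l2loc_test_integrable[OF _ \<phi>] l2loc_test_integrable[OF _ test_fn_iter_pd[OF \<phi>]] l
    by (simp add: wd_def distrib_right distrib_left)
qed

lemma wd_cmult:
  assumes "wd is v g" shows "wd is (\<lambda>x. c * v x) (\<lambda>x. c * g x)"
  using assms by (simp add: wd_def l2loc_cmult mult.assoc)

lemma wd_zero: "wd is (\<lambda>x. 0) (\<lambda>x. 0)"
  by (simp add: wd_def l2loc_const)

lemma wd_sum_list:
  "(\<And>p. p \<in> set ps \<Longrightarrow> wd is (f p) (g p)) \<Longrightarrow> wd is (\<lambda>x. \<Sum>p\<leftarrow>ps. f p x) (\<lambda>x. \<Sum>p\<leftarrow>ps. g p x)"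
  by (induction ps) (auto intro: wd_zero wd_add)

lemma V_space_der_step:
  assumes u: "u \<in> V_space kmin k" "kmin \<le> k" "length B < k"
  shows "wd [i] (der u (count_list B)) (der u (count_list (i # B)))"
proof (rule wd_step)
  show "wd B u (der u (count_list B))" by (rule V_space_wd[OF u(1,2)]) (use u in simp)
  have "wd (i # B) u (der u (count_list (i # B)))" by (rule V_space_wd[OF u(1,2)]) (use u in simp)
  then show "wd (B @ [i]) u (der u (count_list (i # B)))"
    using wd_mset_cong[of "i # B" "B @ [i]"] by simp
qed

definition leibniz :: "(real^'n::finite \<Rightarrow> real) \<Rightarrow> (real^'n \<Rightarrow> real) \<Rightarrow> 'n list \<Rightarrow> real^'n \<Rightarrow> real" where
  "leibniz \<eta> u is x = (\<Sum>p\<leftarrow>splits is. iter_pd (fst p) \<eta> x * der u (count_list (snd p)) x)"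

lemma wd_leibniz:
  assumes u: "u \<in> V_space kmin k" "kmin \<le> k" and \<eta>: "test_fn UNIV \<eta>" and "length is \<le> k"
  shows "wd is (\<lambda>x. \<eta> x * u x) (leibniz \<eta> u is)"
  using assms(4)
proof (induction "is")
  \<comment> \<open>Even for order 0 the chosen \<open>der u\<close> is identified with u only
    through test integrals; hence the detour via the test function
    \<open>\<eta> x * \<phi> x\<close>.\<close>
  case Nil
  have d: "wd [] u (der u (count_list []))" by (rule V_space_wd[OF u]) simp
  have lu: "l2loc u" "l2loc (der u (count_list []))" using d by (auto simp: wd_def)
  obtain M where M: "\<And>x. \<bar>\<eta> x\<bar> \<le> M" using test_fn_bounded[OF \<eta>] by blast
  have sm: "smooth_fn \<eta>" using \<eta> by (simp add: test_fn_def)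
  show ?case
    unfolding wd_def leibniz_def
  proof (intro conjI allI impI)
    show "l2loc (\<lambda>x. \<eta> x * u x)" by (rule l2loc_mult_bounded[OF lu(1) test_fn_borel[OF \<eta>] M])
    show "l2loc (\<lambda>x. \<Sum>p\<leftarrow>splits []. iter_pd (fst p) \<eta> x * der u (count_list (snd p)) x)"
      using l2loc_mult_bounded[OF lu(2) test_fn_borel[OF \<eta>] M] by simp
    fix \<phi> :: "real^'a \<Rightarrow> real" assume \<phi>: "test_fn UNIV \<phi>"
    have "test_fn UNIV (\<lambda>x. \<eta> x * \<phi> x)" by (rule test_fn_mult[OF sm \<phi>])
    with d have "(LINT x|lborel. u x * (\<eta> x * \<phi> x)) = (LINT x|lborel. der u (count_list []) x * (\<eta> x * \<phi> x))"
      by (simp add: wd_def)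
    then show "(LINT x|lborel. \<eta> x * u x * iter_pd [] \<phi> x) = (-1) ^ length [] *
      (LINT x|lborel. (\<Sum>p\<leftarrow>splits []. iter_pd (fst p) \<eta> x * der u (count_list (snd p)) x) * \<phi> x)"
      by (simp add: mult_ac)
  qed
next
  case (Cons i "is")
  have "wd [i] (\<lambda>x. \<Sum>p\<leftarrow>splits is. iter_pd (fst p) \<eta> x * der u (count_list (snd p)) x)
    (\<lambda>x. \<Sum>p\<leftarrow>splits is. iter_pd (fst p) \<eta> x * der u (count_list (i # snd p)) x
       + pd i (iter_pd (fst p) \<eta>) x * der u (count_list (snd p)) x)"
  proof (rule wd_sum_list, rule wd_product)
    fix p assume "p \<in> set (splits is)"
    then have "length (snd p) < k" using splits_length[of "fst p" "snd p" "is"] Cons.prems by auto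
    then show "wd [i] (der u (count_list (snd p))) (der u (count_list (i # snd p)))"
      by (rule V_space_der_step[OF u])
    show "test_fn UNIV (iter_pd (fst p) \<eta>)" by (rule test_fn_iter_pd[OF \<eta>])
  qed
  then have "wd [i] (leibniz \<eta> u is) (leibniz \<eta> u (i # is))"
    unfolding leibniz_def[abs_def] by (simp add: sum_list_addf o_def case_prod_beta)
  from wd_trans[OF Cons.IH this] Cons.prems show ?case by simp
qed

subsection \<open>The energy decay of harmonic functions\<close>

definition sqint :: "(real^'n::finite) set \<Rightarrow> (real^'n \<Rightarrow> real) \<Rightarrow> real" where
  "sqint U f = (LINT x:U|lborel. (f x)\<^sup>2)"

lemma sqint_nonneg: "0 \<le> sqint U f"
  unfolding sqint_def by (rule set_square_nonneg)

text \<open>The integral of (s f + t g)^2 is a nonnegative quadratic form in s and t, evaluated at s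
  = I and t = -F. If F = 0, it is affine in s for t = 1, which forces I = 0.\<close>

lemma Cauchy_Schwarz_set_integral:
  fixes f g :: "'a \<Rightarrow> real"
  assumes fm [measurable]: "f \<in> borel_measurable M" and gm [measurable]: "g \<in> borel_measurable M"
    and S [measurable]: "S \<in> sets M"
    and f: "set_integrable M S (\<lambda>x. (f x)\<^sup>2)" and g: "set_integrable M S (\<lambda>x. (g x)\<^sup>2)"
  shows "\<bar>LINT x:S|M. f x * g x\<bar> \<le> sqrt (LINT x:S|M. (f x)\<^sup>2) * sqrt (LINT x:S|M. (g x)\<^sup>2)"
proof -
  have fg: "set_integrable M S (\<lambda>x. f x * g x)" by (rule set_integrable_mult_squares[OF fm gm S f g])
  define I where "I = (LINT x:S|M. f x * g x)"
  define F where "F = (LINT x:S|M. (f x)\<^sup>2)"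
  define G where "G = (LINT x:S|M. (g x)\<^sup>2)"
  have nonneg: "0 \<le> F" "0 \<le> G" unfolding F_def G_def set_lebesgue_integral_def
    by (rule Bochner_Integration.integral_nonneg; simp)+
  have quad: "0 \<le> s\<^sup>2 * F + 2 * s * t * I + t\<^sup>2 * G" for s t
  proof -
    have "0 \<le> (LINT x:S|M. (s * f x + t * g x)\<^sup>2)"
      unfolding set_lebesgue_integral_def by (rule Bochner_Integration.integral_nonneg) simp
    also have "(\<lambda>x. (s * f x + t * g x)\<^sup>2) = (\<lambda>x. s\<^sup>2 * (f x)\<^sup>2 + 2 * s * t * (f x * g x) + t\<^sup>2 * (g x)\<^sup>2)"
      by (simp add: power2_sum power_mult_distrib fun_eq_iff algebra_simps)
    also have "(LINT x:S|M. s\<^sup>2 * (f x)\<^sup>2 + 2 * s * t * (f x * g x) + t\<^sup>2 * (g x)\<^sup>2)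
       = s\<^sup>2 * F + 2 * s * t * I + t\<^sup>2 * G"
      unfolding F_def G_def I_def
      by (subst set_integral_add(2); (intro set_integral_add(1) set_integrable_mult_right f g fg)?)
         (subst set_integral_add(2); (intro set_integral_add(1) set_integrable_mult_right f g fg)?; simp)
    finally show ?thesis .
  qed
  have "I\<^sup>2 \<le> F * G"
  proof (cases "F = 0")
    case False
    with nonneg have "F > 0" by simp
    have "0 \<le> I\<^sup>2 * F + 2 * I * (- F) * I + (- F)\<^sup>2 * G" by (rule quad)
    also have "\<dots> = F * (F * G - I\<^sup>2)" by (simp add: power2_eq_square algebra_simps)
    finally show ?thesis using \<open>F > 0\<close> by (simp add: zero_le_mult_iff)
  next
    case True
    have lin: "0 \<le> 2 * s * I + G" for s using quad[of s 1] True by simp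
    have "I = 0"
    proof (rule ccontr)
      assume "I \<noteq> 0"
      then have "2 * (- (G + 1) / (2 * I)) * I + G = -1" by (simp add: field_simps)
      with lin[of "- (G + 1) / (2 * I)"] show False by simp
    qed
    then show ?thesis using True by simp
  qed
  then have "sqrt (I\<^sup>2) \<le> sqrt (F * G)" by (rule real_sqrt_le_mono)
  then show ?thesis by (simp add: real_sqrt_mult I_def F_def G_def)
qed

lemma weighted_product_bound:
  assumes f: "l2loc f" and g: "l2loc g" and \<zeta>: "\<zeta> \<in> borel_measurable borel"
    and M: "\<And>x. \<bar>\<zeta> x\<bar> \<le> M" and z: "\<And>x. x \<notin> box a b \<Longrightarrow> \<zeta> x = 0"
  shows "integrable lborel (\<lambda>x. f x * (\<zeta> x * g x))"
    and "\<bar>LINT x|lborel. f x * (\<zeta> x * g x)\<bar> \<le> M * (sqrt (sqint (box a b) f) * sqrt (sqint (box a b) g))"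
proof -
  have m: "f \<in> borel_measurable lborel" "g \<in> borel_measurable lborel" using l2loc_borel[OF f] l2loc_borel[OF g] by auto
  have zg: "l2loc (\<lambda>x. \<zeta> x * g x)" by (rule l2loc_mult_bounded[OF g \<zeta> M])
  have ind: "indicator (box a b) x *\<^sub>R (f x * (\<zeta> x * g x)) = f x * (\<zeta> x * g x)" for x
    using z[of x] by (cases "x \<in> box a b") simp_all
  have i: "set_integrable lborel (box a b) (\<lambda>x. f x * (\<zeta> x * g x))"
    by (rule l2loc_set_integrable[OF f zg _ box_subset_cbox]) simp
  then show "integrable lborel (\<lambda>x. f x * (\<zeta> x * g x))" by (simp only: set_integrable_def ind)
  have sq: "set_integrable lborel (box a b) (\<lambda>x. (h x)\<^sup>2)" if "l2loc h" for h
    using l2loc_set_integrable[OF that that _ box_subset_cbox, of a b] by (simp add: power2_eq_square)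
  have M0: "0 \<le> M" using M[of undefined] by linarith
  have "\<bar>LINT x|lborel. f x * (\<zeta> x * g x)\<bar> = \<bar>LINT x:box a b|lborel. f x * (\<zeta> x * g x)\<bar>"
    by (simp only: set_lebesgue_integral_def ind)
  also have "\<dots> \<le> sqrt (sqint (box a b) f) * sqrt (LINT x:box a b|lborel. (\<zeta> x * g x)\<^sup>2)"
    unfolding sqint_def
    by (rule Cauchy_Schwarz_set_integral) (use m \<zeta> sq[OF f] sq[OF zg] in auto)
  also have "(LINT x:box a b|lborel. (\<zeta> x * g x)\<^sup>2) \<le> (LINT x:box a b|lborel. M\<^sup>2 * (g x)\<^sup>2)"
  proof (rule set_integral_mono)
    show "(\<zeta> x * g x)\<^sup>2 \<le> M\<^sup>2 * (g x)\<^sup>2" for x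
      using M[of x] M0 by (auto simp: power_mult_distrib abs_le_square_iff[symmetric] intro!: mult_right_mono)
  qed (use sq[OF zg] sq[OF g] in auto)
  then have "sqrt (LINT x:box a b|lborel. (\<zeta> x * g x)\<^sup>2) \<le> M * sqrt (sqint (box a b) g)"
    using M0 by (simp add: sqint_def real_sqrt_mult flip: real_sqrt_le_iff[of _ "M\<^sup>2 * _"])
  then have "sqrt (sqint (box a b) f) * sqrt (LINT x:box a b|lborel. (\<zeta> x * g x)\<^sup>2)
     \<le> sqrt (sqint (box a b) f) * (M * sqrt (sqint (box a b) g))"
    by (rule mult_left_mono) (simp add: sqint_nonneg)
  finally show "\<bar>LINT x|lborel. f x * (\<zeta> x * g x)\<bar> \<le> M * (sqrt (sqint (box a b) f) * sqrt (sqint (box a b) g))"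
    by (simp add: mult_ac)
qed

text \<open>\<open>\<eta> u\<close> is an admissible test function: it vanishes at the points of P
  inside the box because u does, at the others because \<eta> does, and its support lies in the
  box.\<close>

lemma V_harm_cutoff_identity:
  fixes u :: "real^'n::finite \<Rightarrow> real"
  assumes k: "kmin \<le> k" and u: "u \<in> V_harm kmin k \<sigma> P (box a b)" and \<eta>: "test_fn (box a b) \<eta>"
  shows "(\<Sum>l\<in>{kmin..k}. \<sigma> l * (\<Sum>\<alpha>\<in>{\<alpha>::'n \<Rightarrow> nat. mi_abs \<alpha> = l}. (fact l / real (mi_fact \<alpha>)) *
     (LINT x|lborel. der u \<alpha> x * leibniz \<eta> u (rep_list \<alpha>) x))) = 0"
proof -
  have uV: "u \<in> V_space kmin k" and u0: "\<And>x. x \<in> P \<Longrightarrow> x \<in> box a b \<Longrightarrow> u x = 0"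
    and orth: "\<And>v. v \<in> V0_space kmin k P \<Longrightarrow> tsupp v \<subseteq> box a b \<Longrightarrow> a_form kmin k \<sigma> u v = 0"
    using u by (auto simp: V_harm_def)
  have \<eta>U: "test_fn UNIV \<eta>" by (rule test_fn_mono[OF \<eta>]) simp
  have \<eta>0: "iter_pd is \<eta> x = 0" if "x \<notin> tsupp \<eta>" for "is" x by (rule iter_pd_zero_outside[OF that])
  have ts: "tsupp \<eta> \<subseteq> box a b" using \<eta> by (simp add: test_fn_def)
  let ?v = "\<lambda>x. \<eta> x * u x"
  have wl: "wd is ?v (leibniz \<eta> u is)" if "length is \<le> k" for "is"
    by (rule wd_leibniz[OF uV k \<eta>U that])
  have cu: "continuous_on UNIV u" using uV by (simp add: V_space_def)
  have cv: "continuous_on UNIV ?v"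
    using \<eta> by (intro continuous_on_mult cu continuous_on_smooth) (simp add: test_fn_def)
  have "?v \<in> V_space kmin k"
  proof (rule V_spaceI[OF cv])
    fix \<alpha> :: "'n \<Rightarrow> nat" assume \<alpha>: "kmin \<le> mi_abs \<alpha>" "mi_abs \<alpha> \<le> k"
    let ?g = "leibniz \<eta> u (rep_list \<alpha>)"
    have w: "wd (rep_list \<alpha>) ?v ?g" using wl \<alpha> by simp
    then have lg: "l2loc ?g" by (simp add: wd_def)
    have g0: "?g x = 0" if "x \<notin> cbox a b" for x
    proof -
      have "x \<notin> tsupp \<eta>" using that ts box_subset_cbox[of a b] by auto
      then show ?thesis by (simp add: leibniz_def \<eta>0)
    qed
    have "indicator (cbox a b) x *\<^sub>R (?g x)\<^sup>2 = (?g x)\<^sup>2" for x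
      using g0[of x] by (cases "x \<in> cbox a b") simp_all
    moreover have "set_integrable lborel (cbox a b) (\<lambda>x. (?g x)\<^sup>2)" using lg by (simp add: l2loc_def)
    ultimately have "integrable lborel (\<lambda>x. (?g x)\<^sup>2)" by (simp only: set_integrable_def)
    with w show "\<exists>g. wd (rep_list \<alpha>) ?v g \<and> integrable lborel (\<lambda>x. (g x)\<^sup>2)" by blast
  qed
  moreover have "?v x = 0" if "x \<in> P" for x
    using u0[OF that] \<eta>0[of x "[]"] ts by (cases "x \<in> box a b") auto
  ultimately have "?v \<in> V0_space kmin k P" by (simp add: V0_space_def)
  moreover have "tsupp ?v \<subseteq> box a b"
  proof -
    have "tsupp ?v \<subseteq> tsupp \<eta>"
    proof (rule tsupp_subset)
      show "closed (tsupp \<eta>)" by (simp add: tsupp_def)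
      show "?v x = 0" if "x \<notin> tsupp \<eta>" for x using \<eta>0[OF that, of "[]"] by simp
    qed
    then show ?thesis using ts by blast
  qed
  ultimately have "a_form kmin k \<sigma> u ?v = 0" by (rule orth)
  moreover have "l2inner UNIV (weak_deriv UNIV \<alpha> u) (weak_deriv UNIV \<alpha> ?v)
      = (LINT x|lborel. der u \<alpha> x * leibniz \<eta> u (rep_list \<alpha>) x)" if "mi_abs \<alpha> \<le> k" for \<alpha>
  proof -
    have "wd (rep_list \<alpha>) u (der u \<alpha>)" using V_space_wd[OF uV k, of "rep_list \<alpha>"] that by simp
    from l2inner_weak_deriv[OF _ this wl[of "rep_list \<alpha>"], of UNIV] that
    show ?thesis by (simp add: set_lebesgue_integral_def)
  qed
  ultimately show ?thesis unfolding a_form_def by simp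
qed

text \<open>The weights make a derivative moved from u to a cutoff of width \<delta> cost nothing,
  so the estimates below need no scaling of the box.\<close>

definition energy :: "real \<Rightarrow> nat \<Rightarrow> (real^'n::finite) set \<Rightarrow> (real^'n \<Rightarrow> real) \<Rightarrow> real" where
  "energy \<delta> k U u = (\<Sum>\<alpha>\<in>{\<alpha>. mi_abs \<alpha> \<le> k}. \<delta> ^ (2 * mi_abs \<alpha>) * sqint U (der u \<alpha>))"

lemma length_splits: "length (splits is) = 2 ^ length is"
  by (induction "is") auto

lemma mi_fact_pos: "0 < mi_fact \<alpha>"
  unfolding mi_fact_def by (simp add: prod_pos)

lemma integrable_sum_list:
  fixes F :: "'b \<Rightarrow> 'a \<Rightarrow> real"
  assumes "\<And>p. p \<in> set r \<Longrightarrow> integrable M (F p)"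
  shows "integrable M (\<lambda>x. \<Sum>p\<leftarrow>r. F p x)"
    and "(LINT x|M. (\<Sum>p\<leftarrow>r. F p x)) = (\<Sum>p\<leftarrow>r. (LINT x|M. F p x))"
  using assms by (induction r) auto

lemma abs_sum_list_le:
  fixes F :: "'b \<Rightarrow> real"
  assumes "\<And>p. p \<in> set r \<Longrightarrow> \<bar>F p\<bar> \<le> X"
  shows "\<bar>\<Sum>p\<leftarrow>r. F p\<bar> \<le> real (length r) * X"
  using assms
proof (induction r)
  case (Cons p r)
  then have "\<bar>F p\<bar> \<le> X" "\<bar>\<Sum>p\<leftarrow>r. F p\<bar> \<le> real (length r) * X" by auto
  moreover have "\<bar>F p + (\<Sum>p\<leftarrow>r. F p)\<bar> \<le> \<bar>F p\<bar> + \<bar>\<Sum>p\<leftarrow>r. F p\<bar>" by (rule abs_triangle_ineq)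
  ultimately show ?case by (simp add: algebra_simps)
qed simp

lemma sqint_mono:
  assumes "l2loc f" "A \<in> sets borel" "A \<subseteq> B" "B \<in> sets borel" "B \<subseteq> cbox c d"
  shows "sqint A f \<le> sqint B f"
proof -
  have i: "set_integrable lborel B (\<lambda>x. (f x)\<^sup>2)"
    using l2loc_set_integrable[OF assms(1,1,4,5)] by (simp add: power2_eq_square)
  have j: "set_integrable lborel A (\<lambda>x. (f x)\<^sup>2)"
    by (rule set_integrable_subset[OF i]) (use assms in auto)
  show ?thesis
    unfolding sqint_def set_lebesgue_integral_def
    by (rule integral_mono) (use i j assms(3) in \<open>auto simp: set_integrable_def indicator_def\<close>)
qed

lemma V_space_l2loc_der:
  assumes "u \<in> V_space kmin k" "kmin \<le> k" "mi_abs \<alpha> \<le> k"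
  shows "l2loc (der u \<alpha>)"
  using V_space_wd[OF assms(1,2), of "rep_list \<alpha>"] assms(3) by (simp add: wd_def)

text \<open>Poincare on cells of side \<theta> \<delta> gains (\<theta> \<delta>)^2; the factor
  \<delta>^2 raises the weight to that of the next order and \<theta>^2 is the gain. The second
  factor d arises since each of the d next derivatives is bounded by the full energy.\<close>

lemma lower_order_decay:
  fixes u :: "real^'n::finite \<Rightarrow> real"
  assumes k: "kmin \<le> k" and u: "u \<in> V_space kmin k" and \<delta>: "0 < \<delta>"
    and part: "cell_partition (\<theta> * \<delta>) a b \<C>"
    and mean: "\<And>C. C \<in> \<C> \<Longrightarrow> (LINT x:C|lborel. der u \<alpha> x) = 0" and \<alpha>: "mi_abs \<alpha> < k"
  shows "\<delta> ^ (2 * mi_abs \<alpha>) * sqint (box a b) (der u \<alpha>)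
    \<le> 2 ^ CARD('n) * real CARD('n) * real CARD('n) * \<theta>\<^sup>2 * energy \<delta> k (box a b) u"
proof -
  define \<beta> where "\<beta> i = count_list (i # rep_list \<alpha>)" for i
  have \<beta>: "mi_abs (\<beta> i) = Suc (mi_abs \<alpha>)" for i
    unfolding \<beta>_def mi_abs_count_list by simp
  have wd: "wd [i] (der u \<alpha>) (der u (\<beta> i))" for i
    using V_space_der_step[OF u k, of "rep_list \<alpha>" i] \<alpha> by (simp add: \<beta>_def)
  have "sqint (box a b) (der u \<alpha>)
    \<le> 2 ^ CARD('n) * real CARD('n) * (\<theta> * \<delta>)\<^sup>2 * (\<Sum>i\<in>UNIV. sqint (box a b) (der u (\<beta> i)))"
    unfolding sqint_def by (rule poincare_box[OF wd part mean])
  then have "\<delta> ^ (2 * mi_abs \<alpha>) * sqint (box a b) (der u \<alpha>)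
    \<le> \<delta> ^ (2 * mi_abs \<alpha>) * (2 ^ CARD('n) * real CARD('n) * (\<theta> * \<delta>)\<^sup>2 * (\<Sum>i\<in>UNIV. sqint (box a b) (der u (\<beta> i))))"
    using \<delta> by (intro mult_left_mono) auto
  also have "\<dots> = 2 ^ CARD('n) * real CARD('n) * \<theta>\<^sup>2 * (\<Sum>i\<in>UNIV. \<delta> ^ (2 * mi_abs (\<beta> i)) * sqint (box a b) (der u (\<beta> i)))"
    by (simp add: \<beta> sum_distrib_left power_mult_distrib power2_eq_square mult_ac)
  also have "\<dots> \<le> 2 ^ CARD('n) * real CARD('n) * \<theta>\<^sup>2 * (\<Sum>i\<in>(UNIV::'n set). energy \<delta> k (box a b) u)"
  proof (intro mult_left_mono sum_mono)
    fix i
    show "\<delta> ^ (2 * mi_abs (\<beta> i)) * sqint (box a b) (der u (\<beta> i)) \<le> energy \<delta> k (box a b) u"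
      unfolding energy_def
      by (rule member_le_sum[of "\<beta> i"]) (use \<alpha> \<beta> \<delta> finite_mi_abs_le in \<open>auto intro!: mult_nonneg_nonneg sqint_nonneg\<close>)
  qed simp
  finally show ?thesis by (simp add: mult_ac)
qed

text \<open>The term with all derivatives on u is isolated. Each of the fewer than 2^k others puts
  at least one derivative on the cutoff, leaving u with order below \<open>mi_abs \<alpha>\<close>,
  where \<open>lower_order_decay\<close> can act.\<close>

lemma leibniz_splitting:
  assumes k: "kmin \<le> k" and u: "u \<in> V_space kmin k" and \<eta>: "test_fn (box a b) \<eta>"
    and K: "\<And>is x. \<bar>iter_pd is \<eta> x\<bar> \<le> K (length is) / \<delta> ^ length is" and \<alpha>: "mi_abs \<alpha> \<le> k"
  shows "\<exists>r. length r \<le> 2 ^ k \<and> (\<forall>p\<in>set r. length (snd p) < mi_abs \<alpha> \<and> length (fst p) + length (snd p) = mi_abs \<alpha>) \<and>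
    (\<forall>p\<in>set r. \<bar>LINT x|lborel. der u \<alpha> x * (iter_pd (fst p) \<eta> x * der u (count_list (snd p)) x)\<bar>
       \<le> K (length (fst p)) / \<delta> ^ length (fst p) * (sqrt (sqint (box a b) (der u \<alpha>)) * sqrt (sqint (box a b) (der u (count_list (snd p)))))) \<and>
    (LINT x|lborel. der u \<alpha> x * leibniz \<eta> u (rep_list \<alpha>) x)
      = (LINT x|lborel. der u \<alpha> x * (\<eta> x * der u \<alpha> x))
        + (\<Sum>p\<leftarrow>r. (LINT x|lborel. der u \<alpha> x * (iter_pd (fst p) \<eta> x * der u (count_list (snd p)) x)))"
proof -
  obtain r where r: "splits (rep_list \<alpha>) = ([], rep_list \<alpha>) # r" "\<And>p. p \<in> set r \<Longrightarrow> fst p \<noteq> []"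
    using splits_eq_Cons[of "rep_list \<alpha>"] by blast
  have "length (splits (rep_list \<alpha>)) \<le> 2 ^ k" using \<alpha> by (simp add: length_splits)
  then have lr: "length r \<le> 2 ^ k" by (simp add: r)
  have lens: "length (fst p) + length (snd p) = mi_abs \<alpha> \<and> length (snd p) < mi_abs \<alpha>" if "p \<in> set r" for p
  proof -
    have "length (fst p) + length (snd p) = mi_abs \<alpha>"
      using splits_length[of "fst p" "snd p" "rep_list \<alpha>"] that by (simp add: r)
    moreover have "0 < length (fst p)" using r(2)[OF that] by simp
    ultimately show ?thesis by linarith
  qed
  have ld: "l2loc (der u \<beta>)" if "mi_abs \<beta> \<le> k" for \<beta> by (rule V_space_l2loc_der[OF u k that])
  have z: "iter_pd A \<eta> x = 0" if "x \<notin> box a b" for A x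
    using \<eta> that by (intro iter_pd_zero_outside) (auto simp: test_fn_def)
  have b: "integrable lborel (\<lambda>x. der u \<alpha> x * (iter_pd A \<eta> x * der u (count_list B) x))"
    "\<bar>LINT x|lborel. der u \<alpha> x * (iter_pd A \<eta> x * der u (count_list B) x)\<bar>
       \<le> K (length A) / \<delta> ^ length A * (sqrt (sqint (box a b) (der u \<alpha>)) * sqrt (sqint (box a b) (der u (count_list B))))"
    if "length B \<le> k" for A B
  proof -
    have lB: "l2loc (der u (count_list B))" by (rule ld) (simp add: mi_abs_count_list that)
    note wp = weighted_product_bound[OF ld[OF \<alpha>] lB test_fn_borel[OF test_fn_iter_pd[OF \<eta>]] K[of A] z]
    show "integrable lborel (\<lambda>x. der u \<alpha> x * (iter_pd A \<eta> x * der u (count_list B) x))" by (rule wp(1))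
    show "\<bar>LINT x|lborel. der u \<alpha> x * (iter_pd A \<eta> x * der u (count_list B) x)\<bar>
       \<le> K (length A) / \<delta> ^ length A * (sqrt (sqint (box a b) (der u \<alpha>)) * sqrt (sqint (box a b) (der u (count_list B))))"
      by (rule wp(2))
  qed
  have bk: "length (snd p) \<le> k" if "p \<in> set r" for p using lens[OF that] \<alpha> by simp
  have "(\<lambda>x. der u \<alpha> x * leibniz \<eta> u (rep_list \<alpha>) x) = (\<lambda>x. der u \<alpha> x * (\<eta> x * der u \<alpha> x)
        + (\<Sum>p\<leftarrow>r. der u \<alpha> x * (iter_pd (fst p) \<eta> x * der u (count_list (snd p)) x)))"
    by (simp add: leibniz_def r distrib_left sum_list_const_mult fun_eq_iff)
  moreover have "integrable lborel (\<lambda>x. der u \<alpha> x * (\<eta> x * der u \<alpha> x))"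
    using b(1)[of "rep_list \<alpha>" "[]"] \<alpha> by simp
  moreover note integrable_sum_list[of r lborel "\<lambda>p x. der u \<alpha> x * (iter_pd (fst p) \<eta> x * der u (count_list (snd p)) x)", OF b(1)[OF bk]]
  ultimately have "(LINT x|lborel. der u \<alpha> x * leibniz \<eta> u (rep_list \<alpha>) x)
      = (LINT x|lborel. der u \<alpha> x * (\<eta> x * der u \<alpha> x))
        + (\<Sum>p\<leftarrow>r. (LINT x|lborel. der u \<alpha> x * (iter_pd (fst p) \<eta> x * der u (count_list (snd p)) x)))"
    by simp
  then show ?thesis using lr lens b(2)[OF bk] by blast
qed

text \<open>In the identity tested with \<open>\<eta> u\<close>, a rest term is a product of a
  factor of size sqrt E and a lower order factor of size \<theta> sqrt E, hence of size \<theta> E.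
  The main terms are nonnegative for all orders, so those of order k are controlled alone; orders
  below k are small directly by Poincare.\<close>

lemma energy_decay:
  fixes \<sigma> :: "nat \<Rightarrow> real"
  assumes k: "kmin \<le> k" and \<sigma>: "\<And>l. l \<in> {kmin..k} \<Longrightarrow> 0 \<le> \<sigma> l" "0 < \<sigma> k" and \<delta>bar: "0 < \<delta>bar"
  shows "\<exists>C0>0. \<forall>(P :: (real^'n::finite) set) a b \<delta> \<theta> u \<C>. (\<forall>i. a $ i < b $ i) \<longrightarrow> 0 < \<delta> \<longrightarrow> \<delta> \<le> \<delta>bar \<longrightarrow> 0 < \<theta> \<longrightarrow> \<theta> \<le> 1 \<longrightarrow>
     u \<in> V_harm kmin k \<sigma> P (box_ext a b \<delta>) \<longrightarrow>
     cell_partition (\<theta> * \<delta>) (a - (\<chi> i. \<delta>)) (b + (\<chi> i. \<delta>)) \<C> \<longrightarrow>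
     (\<forall>C\<in>\<C>. \<forall>\<alpha>. mi_abs \<alpha> < k \<longrightarrow> (LINT x:C|lborel. der u \<alpha> x) = 0) \<longrightarrow>
     energy \<delta> k (box a b) u \<le> C0 * \<theta> * energy \<delta> k (box_ext a b \<delta>) u"
proof -
  obtain K :: "nat \<Rightarrow> real" where K1: "\<And>m. 1 \<le> K m" and K: "\<And>(a :: real^'n) b \<delta>. 0 < \<delta> \<Longrightarrow> (\<forall>i. a $ i \<le> b $ i) \<Longrightarrow>
     (\<exists>\<eta>. is_cutoff K a b \<delta> \<eta>)"
    using cutoff_exists[where ?'n = 'n] by blast
  let ?I = "{\<alpha>::'n \<Rightarrow> nat. mi_abs \<alpha> \<le> k}"
  let ?J = "\<lambda>l. {\<alpha>::'n \<Rightarrow> nat. mi_abs \<alpha> = l}"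
  define D where "D = real CARD('n)"
  define N where "N = real (card ?I)"
  define C1 where "C1 = 2 ^ CARD('n) * D * D"
  define c where "c \<alpha> = fact (mi_abs \<alpha>) / real (mi_fact \<alpha>)" for \<alpha> :: "'n \<Rightarrow> nat"
  define S where "S = (\<Sum>l\<in>{kmin..k}. \<sigma> l * (\<Sum>\<alpha>\<in>?J l. c \<alpha>))"
  define Q where "Q = (\<Sum>\<alpha>\<in>?J k. 1 / c \<alpha>)"
  \<comment> \<open>A term of order l in the form scales like \<delta>^(-2l); after multiplication
    by \<delta>^(2k) the surplus \<delta>^(2(k-l)) is at most \<open>Dm\<close>.\<close>
  define Dm where "Dm = (max 1 \<delta>bar) ^ (2 * k)"
  define Kk where "Kk = (\<Sum>m\<le>k. K m)"
  define R0 where "R0 = Dm * (2 ^ k * (Kk * sqrt C1))"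
  \<comment> \<open>\<open>S * R0\<close> bounds the weighted sum of all rest terms; dividing by
    \<sigma> k isolates the top order.\<close>
  define T where "T = S * R0 / \<sigma> k"
  have fin: "finite ?I" by (rule finite_mi_abs_le)
  have finJ: "finite (?J l)" for l by (rule finite_subset[OF _ finite_mi_abs_le[of l]]) auto
  have cpos: "0 < c \<alpha>" for \<alpha> unfolding c_def using mi_fact_pos[of \<alpha>] by simp
  have nn: "0 \<le> D" "0 \<le> N" "0 \<le> C1" by (simp_all add: D_def N_def C1_def)
  have Snn: "0 \<le> S" unfolding S_def
    by (intro sum_nonneg mult_nonneg_nonneg \<sigma>(1) less_imp_le[OF cpos])
  have Qnn: "0 \<le> Q" unfolding Q_def by (intro sum_nonneg) (simp add: less_imp_le[OF cpos])
  have Dm1: "1 \<le> Dm" unfolding Dm_def by (rule one_le_power) simp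
  have Kle: "K m \<le> Kk" if "m \<le> k" for m
    unfolding Kk_def by (rule member_le_sum) (use that K1 in \<open>auto intro: order_trans[OF zero_le_one]\<close>)
  have Kk1: "1 \<le> Kk" using Kle[of 0] K1[of 0] by simp
  have R0nn: "0 \<le> R0" unfolding R0_def using Dm1 Kk1 nn by simp
  have Tnn: "0 \<le> T" unfolding T_def using Snn R0nn \<sigma>(2) by simp
  \<comment> \<open>The orders below k contribute \<open>N * C1\<close>, order k contributes
    \<open>Q * T\<close>; the 1 only secures positivity.\<close>
  define C0 where "C0 = N * C1 + Q * T + 1"
  have "0 < C0" unfolding C0_def using nn Qnn Tnn by (simp add: add_nonneg_pos)
  moreover have "energy \<delta> k (box a b) u \<le> C0 * \<theta> * energy \<delta> k (box_ext a b \<delta>) u"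
    if ab: "\<forall>i. a $ i < b $ i" and \<delta>: "0 < \<delta>" "\<delta> \<le> \<delta>bar" and \<theta>: "0 < \<theta>" "\<theta> \<le> 1"
      and u: "u \<in> V_harm kmin k \<sigma> P (box_ext a b \<delta>)"
      and part: "cell_partition (\<theta> * \<delta>) (a - (\<chi> i. \<delta>)) (b + (\<chi> i. \<delta>)) \<C>"
      and mean: "\<forall>C\<in>\<C>. \<forall>\<alpha>. mi_abs \<alpha> < k \<longrightarrow> (LINT x:C|lborel. der u \<alpha> x) = 0"
    for P :: "(real^'n) set" and a b \<delta> \<theta> u \<C>
  proof -
    define a' where "a' = a - (\<chi> i. \<delta>)"
    define b' where "b' = b + (\<chi> i. \<delta>)"
    define E where "E = energy \<delta> k (box a' b') u"
    have be: "box_ext a b \<delta> = box a' b'" by (simp add: box_ext_def a'_def b'_def)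
    have uV: "u \<in> V_space kmin k" using u by (simp add: V_harm_def)
    define e where "e \<alpha> = \<delta> ^ (2 * mi_abs \<alpha>) * sqint (box a' b') (der u \<alpha>)" for \<alpha>
    have e0: "0 \<le> e \<alpha>" for \<alpha> unfolding e_def by (intro mult_nonneg_nonneg sqint_nonneg) (use \<delta> in simp)
    have E_sum: "E = (\<Sum>\<alpha>\<in>?I. e \<alpha>)" by (simp add: E_def energy_def e_def)
    have E0: "0 \<le> E" unfolding E_sum by (rule sum_nonneg) (rule e0)
    have eE: "e \<alpha> \<le> E" if "mi_abs \<alpha> \<le> k" for \<alpha>
      unfolding E_sum by (rule member_le_sum) (use that fin e0 in auto)
    have low: "e \<alpha> \<le> C1 * \<theta>\<^sup>2 * E" if "mi_abs \<alpha> < k" for \<alpha>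
      unfolding e_def C1_def D_def E_def
      by (rule lower_order_decay[OF k uV \<delta>(1) part[folded a'_def b'_def] _ that]) (use mean that in blast)
    have low': "e \<alpha> \<le> C1 * \<theta> * E" if "mi_abs \<alpha> < k" for \<alpha>
    proof -
      have "C1 * \<theta>\<^sup>2 * E \<le> C1 * \<theta> * E"
        using \<theta> nn E0 by (intro mult_right_mono mult_left_mono) (auto simp: power2_eq_square)
      with low[OF that] show ?thesis by linarith
    qed
    have se: "\<delta> ^ mi_abs \<alpha> * sqrt (sqint (box a' b') (der u \<alpha>)) = sqrt (e \<alpha>)" for \<alpha>
    proof -
      have "e \<alpha> = (\<delta> ^ mi_abs \<alpha>)\<^sup>2 * sqint (box a' b') (der u \<alpha>)"
        unfolding e_def by (simp add: power_mult[symmetric] mult.commute)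
      then show ?thesis using \<delta> by (simp add: real_sqrt_mult)
    qed
    have "\<forall>i. a $ i \<le> b $ i" using ab less_imp_le by blast
    from K[OF \<delta>(1) this] obtain \<eta> where \<eta>: "smooth_fn \<eta>" "\<And>x. 0 \<le> \<eta> x \<and> \<eta> x \<le> 1" "\<And>x. x \<in> cbox a b \<Longrightarrow> \<eta> x = 1"
      "\<And>x. x \<notin> cbox (a - (\<chi> i. \<delta> / 2)) (b + (\<chi> i. \<delta> / 2)) \<Longrightarrow> \<eta> x = 0"
      "\<And>is x. \<bar>iter_pd is \<eta> x\<bar> \<le> K (length is) / \<delta> ^ length is"
      unfolding is_cutoff_def by blast
    have sub: "cbox (a - (\<chi> i. \<delta> / 2)) (b + (\<chi> i. \<delta> / 2)) \<subseteq> box a' b'"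
    proof
      fix x assume x: "x \<in> cbox (a - (\<chi> i. \<delta> / 2)) (b + (\<chi> i. \<delta> / 2))"
      have "a' $ i < x $ i \<and> x $ i < b' $ i" for i
        using x[unfolded mem_box_cart, rule_format, of i] \<delta> by (simp add: a'_def b'_def)
      then show "x \<in> box a' b'" by (simp add: mem_box_cart)
    qed
    have t\<eta>: "test_fn (box a' b') \<eta>" by (rule test_fnI[OF \<eta>(1) compact_cbox sub \<eta>(4)])
    define main where "main \<alpha> = (LINT x|lborel. der u \<alpha> x * (\<eta> x * der u \<alpha> x))" for \<alpha>
    define rest where "rest \<alpha> = (LINT x|lborel. der u \<alpha> x * leibniz \<eta> u (rep_list \<alpha>) x) - main \<alpha>" for \<alpha>
    have restB: "\<delta> ^ (2 * k) * \<bar>rest \<alpha>\<bar> \<le> R0 * \<theta> * E" if \<alpha>: "mi_abs \<alpha> \<le> k" for \<alpha>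
    proof -
      let ?l = "mi_abs \<alpha>"
      obtain r where r: "length r \<le> 2 ^ k" "\<And>p. p \<in> set r \<Longrightarrow> length (snd p) < ?l \<and> length (fst p) + length (snd p) = ?l"
        "\<And>p. p \<in> set r \<Longrightarrow> \<bar>LINT x|lborel. der u \<alpha> x * (iter_pd (fst p) \<eta> x * der u (count_list (snd p)) x)\<bar>
       \<le> K (length (fst p)) / \<delta> ^ length (fst p) * (sqrt (sqint (box a' b') (der u \<alpha>)) * sqrt (sqint (box a' b') (der u (count_list (snd p)))))"
        "(LINT x|lborel. der u \<alpha> x * leibniz \<eta> u (rep_list \<alpha>) x)
      = (LINT x|lborel. der u \<alpha> x * (\<eta> x * der u \<alpha> x))
        + (\<Sum>p\<leftarrow>r. (LINT x|lborel. der u \<alpha> x * (iter_pd (fst p) \<eta> x * der u (count_list (snd p)) x)))"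
        using leibniz_splitting[OF k uV t\<eta> \<eta>(5) \<alpha>] by blast
      have re: "rest \<alpha> = (\<Sum>p\<leftarrow>r. (LINT x|lborel. der u \<alpha> x * (iter_pd (fst p) \<eta> x * der u (count_list (snd p)) x)))"
        unfolding rest_def main_def r(4) by simp
      have "\<bar>LINT x|lborel. der u \<alpha> x * (iter_pd (fst p) \<eta> x * der u (count_list (snd p)) x)\<bar>
          \<le> Kk * sqrt C1 * \<theta> * E / \<delta> ^ (2 * ?l)" if p: "p \<in> set r" for p
      proof -
        let ?A = "fst p" and ?B = "snd p"
        let ?s = "\<lambda>\<gamma>. sqrt (sqint (box a' b') (der u \<gamma>))"
        have mB: "mi_abs (count_list ?B) = length ?B" by (rule mi_abs_count_list)
        \<comment> \<open>The weight \<delta>^(2l) is distributed: one part cancels the derivatives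
          of the cutoff, the others supply the energy weights of both derivatives of u.\<close>
        have ll: "2 * ?l = length ?A + ?l + length ?B" using r(2)[OF p] by simp
        have "\<delta> ^ (2 * ?l) * (K (length ?A) / \<delta> ^ length ?A * (?s \<alpha> * ?s (count_list ?B)))
          = K (length ?A) * ((\<delta> ^ ?l * ?s \<alpha>) * (\<delta> ^ length ?B * ?s (count_list ?B)))"
          using \<delta> by (simp add: ll power_add)
        also have "\<dots> = K (length ?A) * (sqrt (e \<alpha>) * sqrt (e (count_list ?B)))"
          using se[of \<alpha>] se[of "count_list ?B"] by (simp add: mB)
        \<comment> \<open>Only the derivative along \<open>?B\<close> is certain to have order below
          k and gains \<theta>; the one of multi-index \<alpha> may have order k and is bounded by
          E.\<close>
        also have "\<dots> \<le> Kk * (sqrt E * sqrt (C1 * \<theta>\<^sup>2 * E))"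
        proof (rule mult_mono)
          show "K (length ?A) \<le> Kk" using r(2)[OF p] \<alpha> by (intro Kle) simp
          show "sqrt (e \<alpha>) * sqrt (e (count_list ?B)) \<le> sqrt E * sqrt (C1 * \<theta>\<^sup>2 * E)"
          proof (rule mult_mono)
            show "sqrt (e \<alpha>) \<le> sqrt E" using eE[OF \<alpha>] by simp
            have "mi_abs (count_list ?B) < k" using r(2)[OF p] \<alpha> mB by simp
            from low[OF this] show "sqrt (e (count_list ?B)) \<le> sqrt (C1 * \<theta>\<^sup>2 * E)" by simp
          qed (use E0 e0 in auto)
        qed (use Kk1 e0 in auto)
        also have "\<dots> = Kk * sqrt C1 * \<theta> * E"
          using E0 \<theta> by (simp add: real_sqrt_mult)
        finally have "\<delta> ^ (2 * ?l) * (K (length ?A) / \<delta> ^ length ?A * (?s \<alpha> * ?s (count_list ?B))) \<le> Kk * sqrt C1 * \<theta> * E" .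
        then have "K (length ?A) / \<delta> ^ length ?A * (?s \<alpha> * ?s (count_list ?B)) \<le> Kk * sqrt C1 * \<theta> * E / \<delta> ^ (2 * ?l)"
          using \<delta> by (simp add: pos_le_divide_eq mult.commute)
        with r(3)[OF p] show ?thesis by linarith
      qed
      then have "\<bar>rest \<alpha>\<bar> \<le> real (length r) * (Kk * sqrt C1 * \<theta> * E / \<delta> ^ (2 * ?l))"
        unfolding re by (rule abs_sum_list_le)
      also have "\<dots> \<le> 2 ^ k * (Kk * sqrt C1 * \<theta> * E / \<delta> ^ (2 * ?l))"
      proof (rule mult_right_mono)
        show "real (length r) \<le> 2 ^ k" using of_nat_mono[OF r(1), where 'a = real] by simp
      qed (use Kk1 nn \<theta> E0 \<delta> in simp)
      finally have "\<delta> ^ (2 * k) * \<bar>rest \<alpha>\<bar> \<le> \<delta> ^ (2 * k) * (2 ^ k * (Kk * sqrt C1 * \<theta> * E / \<delta> ^ (2 * ?l)))"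
        using \<delta> by (intro mult_left_mono) auto
      also have "\<dots> = \<delta> ^ (2 * (k - ?l)) * (2 ^ k * (Kk * sqrt C1 * \<theta> * E))"
      proof -
        have "2 * k = 2 * (k - ?l) + 2 * ?l" using \<alpha> by simp
        then have "\<delta> ^ (2 * k) = \<delta> ^ (2 * (k - ?l)) * \<delta> ^ (2 * ?l)" by (metis power_add)
        then show ?thesis using \<delta> by simp
      qed
      also have "\<dots> \<le> Dm * (2 ^ k * (Kk * sqrt C1 * \<theta> * E))"
      proof (rule mult_right_mono)
        have "\<delta> ^ (2 * (k - ?l)) \<le> (max 1 \<delta>bar) ^ (2 * (k - ?l))" using \<delta> by (intro power_mono) auto
        also have "\<dots> \<le> Dm" unfolding Dm_def by (rule power_increasing) auto
        finally show "\<delta> ^ (2 * (k - ?l)) \<le> Dm" .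
      qed (use Kk1 nn \<theta> E0 in simp)
      finally show ?thesis by (simp add: R0_def mult_ac)
    qed
    have ld: "l2loc (der u \<alpha>)" if "mi_abs \<alpha> \<le> k" for \<alpha> by (rule V_space_l2loc_der[OF uV k that])
    \<comment> \<open>\<eta> is 1 on the inner box and nonnegative elsewhere.\<close>
    have mainB: "sqint (box a b) (der u \<alpha>) \<le> main \<alpha>" if \<alpha>: "mi_abs \<alpha> \<le> k" for \<alpha>
      unfolding sqint_def main_def set_lebesgue_integral_def
    proof (rule integral_mono)
      have "set_integrable lborel (box a b) (\<lambda>x. der u \<alpha> x * der u \<alpha> x)"
        by (rule l2loc_set_integrable[OF ld[OF \<alpha>] ld[OF \<alpha>] _ box_subset_cbox]) simp
      then show "integrable lborel (\<lambda>x. indicator (box a b) x *\<^sub>R (der u \<alpha> x)\<^sup>2)"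
        by (simp add: set_integrable_def power2_eq_square)
      show "integrable lborel (\<lambda>x. der u \<alpha> x * (\<eta> x * der u \<alpha> x))"
      proof (rule weighted_product_bound(1)[OF ld[OF \<alpha>] ld[OF \<alpha>] test_fn_borel[OF t\<eta>]])
        show "\<bar>\<eta> x\<bar> \<le> 1" for x using \<eta>(2)[of x] by simp
        show "\<eta> x = 0" if "x \<notin> box a' b'" for x using \<eta>(4)[of x] sub that by blast
      qed
      fix x
      show "indicator (box a b) x *\<^sub>R (der u \<alpha> x)\<^sup>2 \<le> der u \<alpha> x * (\<eta> x * der u \<alpha> x)"
      proof (cases "x \<in> box a b")
        case True
        then have "\<eta> x = 1" using \<eta>(3) box_subset_cbox[of a b] by blast
        then show ?thesis using True by (simp add: power2_eq_square)
      next
        case False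
        have "0 \<le> \<eta> x * (der u \<alpha> x * der u \<alpha> x)" using \<eta>(2)[of x] by simp
        then show ?thesis using False by (simp add: mult.left_commute)
      qed
    qed
    have main0: "0 \<le> main \<alpha>" if "mi_abs \<alpha> \<le> k" for \<alpha>
      using mainB[OF that] sqint_nonneg[of "box a b" "der u \<alpha>"] by linarith
    have id: "(\<Sum>l\<in>{kmin..k}. \<sigma> l * (\<Sum>\<alpha>\<in>?J l. c \<alpha> * (main \<alpha> + rest \<alpha>))) = 0"
      using V_harm_cutoff_identity[OF k u[unfolded be] t\<eta>] by (simp add: c_def rest_def)
    \<comment> \<open>Adding \<delta>^(2k) times the vanishing identity replaces each main term by
      minus its rest.\<close>
    have sum_main: "(\<Sum>l\<in>{kmin..k}. \<sigma> l * (\<Sum>\<alpha>\<in>?J l. c \<alpha> * (\<delta> ^ (2 * k) * main \<alpha>))) \<le> S * (R0 * \<theta> * E)"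
    proof -
      have "(\<Sum>l\<in>{kmin..k}. \<sigma> l * (\<Sum>\<alpha>\<in>?J l. c \<alpha> * (\<delta> ^ (2 * k) * main \<alpha>)))
        = (\<Sum>l\<in>{kmin..k}. \<sigma> l * (\<Sum>\<alpha>\<in>?J l. c \<alpha> * (\<delta> ^ (2 * k) * (- rest \<alpha>))))
          + \<delta> ^ (2 * k) * (\<Sum>l\<in>{kmin..k}. \<sigma> l * (\<Sum>\<alpha>\<in>?J l. c \<alpha> * (main \<alpha> + rest \<alpha>)))"
        by (simp add: sum_distrib_left sum.distrib[symmetric] algebra_simps)
      also have "\<dots> = (\<Sum>l\<in>{kmin..k}. \<sigma> l * (\<Sum>\<alpha>\<in>?J l. c \<alpha> * (\<delta> ^ (2 * k) * (- rest \<alpha>))))"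
        by (simp only: id mult_zero_right add_0_right)
      also have "\<dots> \<le> (\<Sum>l\<in>{kmin..k}. \<sigma> l * (\<Sum>\<alpha>\<in>?J l. c \<alpha> * (R0 * \<theta> * E)))"
      proof (intro sum_mono mult_left_mono \<sigma>(1) less_imp_le[OF cpos])
        fix l and \<alpha> :: "'n \<Rightarrow> nat" assume "l \<in> {kmin..k}" "\<alpha> \<in> ?J l"
        then have "mi_abs \<alpha> \<le> k" by simp
        from restB[OF this] have "\<delta> ^ (2 * k) * \<bar>rest \<alpha>\<bar> \<le> R0 * \<theta> * E" .
        moreover have "\<delta> ^ (2 * k) * (- rest \<alpha>) \<le> \<delta> ^ (2 * k) * \<bar>rest \<alpha>\<bar>"
          using \<delta> by (intro mult_left_mono) auto
        ultimately show "\<delta> ^ (2 * k) * (- rest \<alpha>) \<le> R0 * \<theta> * E" by linarith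
      qed
      also have "\<dots> = S * (R0 * \<theta> * E)"
        unfolding S_def by (simp add: sum_distrib_right mult.assoc)
      finally show ?thesis .
    qed
    \<comment> \<open>All other summands are nonnegative, so a single multi-index of order k may be
      singled out; dividing by \<sigma> k and by its multinomial coefficient gives the
      bound.\<close>
    have top: "\<delta> ^ (2 * k) * sqint (box a b) (der u \<alpha>) \<le> 1 / c \<alpha> * (T * \<theta> * E)" if \<alpha>: "mi_abs \<alpha> = k" for \<alpha>
    proof -
      have nn1: "0 \<le> c \<beta> * (\<delta> ^ (2 * k) * main \<beta>)" if "mi_abs \<beta> \<le> k" for \<beta>
        using cpos[of \<beta>] main0[OF that] \<delta> by simp
      have "\<sigma> k * (c \<alpha> * (\<delta> ^ (2 * k) * main \<alpha>)) \<le> \<sigma> k * (\<Sum>\<alpha>\<in>?J k. c \<alpha> * (\<delta> ^ (2 * k) * main \<alpha>))"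
        using \<sigma>(2) by (intro mult_left_mono member_le_sum) (use \<alpha> finJ nn1 in auto)
      also have "\<dots> \<le> (\<Sum>l\<in>{kmin..k}. \<sigma> l * (\<Sum>\<alpha>\<in>?J l. c \<alpha> * (\<delta> ^ (2 * k) * main \<alpha>)))"
        by (rule member_le_sum[of k]) (use k in \<open>auto intro!: mult_nonneg_nonneg sum_nonneg \<sigma>(1) nn1\<close>)
      also note sum_main
      finally have "\<sigma> k * (c \<alpha> * (\<delta> ^ (2 * k) * main \<alpha>)) \<le> S * (R0 * \<theta> * E)" .
      then have "\<delta> ^ (2 * k) * main \<alpha> \<le> S * (R0 * \<theta> * E) / (\<sigma> k * c \<alpha>)"
        using \<sigma>(2) cpos[of \<alpha>] by (simp add: pos_le_divide_eq mult_ac)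
      also have "\<dots> = 1 / c \<alpha> * (T * \<theta> * E)" by (simp add: T_def mult_ac)
      finally have "\<delta> ^ (2 * k) * main \<alpha> \<le> 1 / c \<alpha> * (T * \<theta> * E)" .
      moreover have "\<delta> ^ (2 * k) * sqint (box a b) (der u \<alpha>) \<le> \<delta> ^ (2 * k) * main \<alpha>"
        using \<delta> mainB[of \<alpha>] \<alpha> by (intro mult_left_mono) auto
      ultimately show ?thesis by linarith
    qed
    have lowB: "\<delta> ^ (2 * mi_abs \<alpha>) * sqint (box a b) (der u \<alpha>) \<le> C1 * \<theta> * E" if \<alpha>: "mi_abs \<alpha> < k" for \<alpha>
    proof -
      have "box a b \<subseteq> box a' b'"
      proof
        fix x assume x: "x \<in> box a b"
        have "a' $ i < x $ i \<and> x $ i < b' $ i" for i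
          using x[unfolded mem_box_cart, rule_format, of i] \<delta> by (simp add: a'_def b'_def)
        then show "x \<in> box a' b'" by (simp add: mem_box_cart)
      qed
      then have "sqint (box a b) (der u \<alpha>) \<le> sqint (box a' b') (der u \<alpha>)"
        by (intro sqint_mono[OF ld _ _ _ box_subset_cbox]) (use \<alpha> in auto)
      then have "\<delta> ^ (2 * mi_abs \<alpha>) * sqint (box a b) (der u \<alpha>) \<le> e \<alpha>"
        unfolding e_def using \<delta> by (intro mult_left_mono) auto
      with low'[OF \<alpha>] show ?thesis by linarith
    qed
    have "energy \<delta> k (box a b) u = (\<Sum>\<alpha>\<in>{\<alpha>. mi_abs \<alpha> < k} \<union> ?J k. \<delta> ^ (2 * mi_abs \<alpha>) * sqint (box a b) (der u \<alpha>))"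
      unfolding energy_def by (rule sum.cong) auto
    also have "\<dots> = (\<Sum>\<alpha>\<in>{\<alpha>. mi_abs \<alpha> < k}. \<delta> ^ (2 * mi_abs \<alpha>) * sqint (box a b) (der u \<alpha>))
        + (\<Sum>\<alpha>\<in>?J k. \<delta> ^ (2 * mi_abs \<alpha>) * sqint (box a b) (der u \<alpha>))"
      by (rule sum.union_disjoint) (auto intro: finite_subset[OF _ fin] finJ)
    also have "\<dots> \<le> (\<Sum>\<alpha>\<in>{\<alpha>::'n \<Rightarrow> nat. mi_abs \<alpha> < k}. C1 * \<theta> * E) + (\<Sum>\<alpha>\<in>?J k. 1 / c \<alpha> * (T * \<theta> * E))"
      by (intro add_mono sum_mono) (use lowB top in auto)
    also have "\<dots> \<le> N * (C1 * \<theta> * E) + Q * (T * \<theta> * E)"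
    proof -
      have "card {\<alpha>::'n \<Rightarrow> nat. mi_abs \<alpha> < k} \<le> card ?I" by (rule card_mono[OF fin]) auto
      moreover have "0 \<le> C1 * \<theta> * E" using nn \<theta> E0 by simp
      ultimately have "real (card {\<alpha>::'n \<Rightarrow> nat. mi_abs \<alpha> < k}) * (C1 * \<theta> * E) \<le> N * (C1 * \<theta> * E)"
        unfolding N_def by (intro mult_right_mono) auto
      then show ?thesis by (simp add: Q_def sum_distrib_right)
    qed
    also have "\<dots> \<le> C0 * \<theta> * E"
      unfolding C0_def using \<theta> E0 by (simp add: algebra_simps)
    finally show ?thesis by (simp add: E_def be)
  qed
  ultimately show ?thesis by blast
qed

subsection \<open>Finite-rank operators annihilating finitely many functionals on the complement\<close>

text \<open>Without completeness there is no orthogonal projection onto the common kernel, but a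
  nearly optimal representative of each functional gives one up to a factor arbitrarily close to 1.\<close>

lemma near_orthogonal_bound:
  fixes m I W c q :: real
  assumes m: "0 < m" and q: "1 < q" and W: "0 \<le> W" and u: "0 \<le> c\<^sup>2 * m + 2 * c * I + W"
    and opt: "\<And>t. m / q \<le> m + 2 * t * I + t\<^sup>2 * W"
  shows "W \<le> q * (c\<^sup>2 * m + 2 * c * I + W)"
proof (cases "W = 0")
  case True
  then show ?thesis using u q by simp
next
  case False
  with W have W: "0 < W" by simp
  \<comment> \<open>The minimising t = -I / W turns \<open>opt\<close> into a strengthened
    Cauchy-Schwarz inequality: I^2 is at most (1 - 1/q) m W.\<close>
  have "m / q \<le> m - I\<^sup>2 / W"
    using opt[of "- I / W"] W by (simp add: power2_eq_square field_simps)
  then have "q * I\<^sup>2 \<le> m * W * (q - 1)"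
    using W q by (simp add: field_simps)
  then have "q * (q * I\<^sup>2) \<le> q * (m * W * (q - 1))" using q by (intro mult_left_mono) auto
  \<comment> \<open>The claim, multiplied by q m, is a complete square in c plus the nonnegative
    remainder just obtained.\<close>
  then have "0 \<le> (q * m * c + q * I)\<^sup>2 + (q * (m * W * (q - 1)) - q * (q * I\<^sup>2))" by simp
  also have "\<dots> = (q * m) * (q * (c\<^sup>2 * m + 2 * c * I + W) - W)"
    by (simp add: power2_eq_square algebra_simps)
  finally have "0 \<le> (q * m) * (q * (c\<^sup>2 * m + 2 * c * I + W) - W)" .
  moreover have "0 < q * m" using m q by simp
  ultimately show ?thesis unfolding zero_le_mult_iff by linarith
qed

text \<open>Induction on the functionals. The complement R = 1 - T of the previous operator maps
  into their common kernel \<open>X'\<close>. Unless the new functional vanishes there, it is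
  removed by subtracting \<open>ell j (R u)\<close> times some \<open>x0\<close> in
  \<open>X'\<close> with \<open>ell j x0 = 1\<close> and nearly minimal form, at the cost of one
  dimension.\<close>

lemma near_projection:
  fixes X :: "('a \<Rightarrow> real) set" and ip :: "('a \<Rightarrow> real) \<Rightarrow> ('a \<Rightarrow> real) \<Rightarrow> real"
    and ell :: "'j \<Rightarrow> ('a \<Rightarrow> real) \<Rightarrow> real"
  assumes add: "\<And>u v. u \<in> X \<Longrightarrow> v \<in> X \<Longrightarrow> (\<lambda>x. u x + v x) \<in> X"
    and scale: "\<And>u c. u \<in> X \<Longrightarrow> (\<lambda>x. c * u x) \<in> X" and zero: "(\<lambda>x. 0) \<in> X"
    and ip_sym: "\<And>u v. u \<in> X \<Longrightarrow> v \<in> X \<Longrightarrow> ip u v = ip v u"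
    and ip_add: "\<And>u v w. u \<in> X \<Longrightarrow> v \<in> X \<Longrightarrow> w \<in> X \<Longrightarrow> ip (\<lambda>x. u x + v x) w = ip u w + ip v w"
    and ip_scale: "\<And>u v c. u \<in> X \<Longrightarrow> v \<in> X \<Longrightarrow> ip (\<lambda>x. c * u x) v = c * ip u v"
    and ip_nonneg: "\<And>u. u \<in> X \<Longrightarrow> 0 \<le> ip u u"
    and "finite J"
    and l_add: "\<And>j u v. j \<in> J \<Longrightarrow> u \<in> X \<Longrightarrow> v \<in> X \<Longrightarrow> ell j (\<lambda>x. u x + v x) = ell j u + ell j v"
    and l_scale: "\<And>j u c. j \<in> J \<Longrightarrow> u \<in> X \<Longrightarrow> ell j (\<lambda>x. c * u x) = c * ell j u"
    and l_bound: "\<And>j. j \<in> J \<Longrightarrow> \<exists>c. \<forall>u\<in>X. \<bar>ell j u\<bar> \<le> c * sqrt (ip u u)"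
    and q: "1 < q"
  shows "\<exists>T F. finite F \<and> card F \<le> card J \<and> (\<forall>u\<in>X. T u \<in> X) \<and>
    (\<forall>u\<in>X. \<forall>v\<in>X. T (\<lambda>x. u x + v x) = (\<lambda>x. T u x + T v x)) \<and>
    (\<forall>u\<in>X. \<forall>c. T (\<lambda>x. c * u x) = (\<lambda>x. c * T u x)) \<and>
    (\<forall>u\<in>X. \<exists>c. T u = (\<lambda>x. \<Sum>f\<in>F. c f * f x)) \<and>
    (\<forall>u\<in>X. \<forall>j\<in>J. ell j (\<lambda>x. u x - T u x) = 0) \<and>
    (\<forall>u\<in>X. ip (\<lambda>x. u x - T u x) (\<lambda>x. u x - T u x) \<le> q * ip u u)"
  using \<open>finite J\<close> l_add l_scale l_bound q
proof (induction J arbitrary: q rule: finite_induct)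
  case empty
  have "ip u u \<le> q * ip u u" if "u \<in> X" for u
    using ip_nonneg[OF that] empty by (simp add: mult_le_cancel_right1)
  then show ?case
    by (intro exI[of _ "\<lambda>u x. 0"] exI[of _ "{}"]) (auto simp: zero)
next
  case (insert j J)
  have la: "\<And>i u v. i \<in> insert j J \<Longrightarrow> u \<in> X \<Longrightarrow> v \<in> X \<Longrightarrow> ell i (\<lambda>x. u x + v x) = ell i u + ell i v"
    and lsc: "\<And>i u c. i \<in> insert j J \<Longrightarrow> u \<in> X \<Longrightarrow> ell i (\<lambda>x. c * u x) = c * ell i u"
    and lb: "\<And>i. i \<in> insert j J \<Longrightarrow> \<exists>c. \<forall>u\<in>X. \<bar>ell i u\<bar> \<le> c * sqrt (ip u u)"
    by (rule insert.prems; assumption)+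
  have sub: "(\<lambda>x. u x - v x) \<in> X" if "u \<in> X" "v \<in> X" for u v
    using add[OF that(1) scale[OF that(2), of "-1"]] by simp
  have lsub: "ell i (\<lambda>x. u x - v x) = ell i u - ell i v" if "i \<in> insert j J" "u \<in> X" "v \<in> X" for i u v
    using la[OF that(1,2) scale[OF that(3), of "-1"]] lsc[OF that(1,3), of "-1"] by simp
  \<comment> \<open>The allowed factor is shared equally between the induction hypothesis and the
    new functional; this is why q varies in the induction.\<close>
  define q1 where "q1 = sqrt q"
  have q1: "1 < q1" "q1 * q1 = q" using insert.prems(4) by (auto simp: q1_def)
  have "\<exists>T F. finite F \<and> card F \<le> card J \<and> (\<forall>u\<in>X. T u \<in> X) \<and>
    (\<forall>u\<in>X. \<forall>v\<in>X. T (\<lambda>x. u x + v x) = (\<lambda>x. T u x + T v x)) \<and>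
    (\<forall>u\<in>X. \<forall>c. T (\<lambda>x. c * u x) = (\<lambda>x. c * T u x)) \<and>
    (\<forall>u\<in>X. \<exists>c. T u = (\<lambda>x. \<Sum>f\<in>F. c f * f x)) \<and>
    (\<forall>u\<in>X. \<forall>j\<in>J. ell j (\<lambda>x. u x - T u x) = 0) \<and>
    (\<forall>u\<in>X. ip (\<lambda>x. u x - T u x) (\<lambda>x. u x - T u x) \<le> q1 * ip u u)"
    by (rule insert.IH[OF la lsc lb q1(1)]) auto
  then obtain T F where T1: "finite F" "card F \<le> card J" "\<forall>u\<in>X. T u \<in> X"
    "\<forall>u\<in>X. \<forall>v\<in>X. T (\<lambda>x. u x + v x) = (\<lambda>x. T u x + T v x)"
    "\<forall>u\<in>X. \<forall>c. T (\<lambda>x. c * u x) = (\<lambda>x. c * T u x)"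
    "\<forall>u\<in>X. \<exists>c. T u = (\<lambda>x. \<Sum>f\<in>F. c f * f x)"
    "\<forall>u\<in>X. \<forall>j\<in>J. ell j (\<lambda>x. u x - T u x) = 0"
    "\<forall>u\<in>X. ip (\<lambda>x. u x - T u x) (\<lambda>x. u x - T u x) \<le> q1 * ip u u"
    by (elim exE conjE) (rule that)
  note T = T1(1,2) T1(3-8)[rule_format]
  define R where "R u = (\<lambda>x. u x - T u x)" for u
  define X' where "X' = {u \<in> X. \<forall>i\<in>J. ell i u = 0}"
  have R: "R u \<in> X'" if "u \<in> X" for u using that T(3,7) sub by (auto simp: R_def X'_def)
  have Radd: "R (\<lambda>x. u x + v x) = (\<lambda>x. R u x + R v x)" if "u \<in> X" "v \<in> X" for u v
    using T(4)[OF that] by (simp add: R_def fun_eq_iff)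
  have Rsc: "R (\<lambda>x. c * u x) = (\<lambda>x. c * R u x)" if "u \<in> X" for u c
    using T(5)[OF that] by (simp add: R_def fun_eq_iff algebra_simps)
  have X'X: "u \<in> X" if "u \<in> X'" for u using that by (simp add: X'_def)
  have X'sc: "(\<lambda>x. c * u x) \<in> X'" if "u \<in> X'" for u c
    using that scale lsc by (auto simp: X'_def)
  have X'add: "(\<lambda>x. u x + v x) \<in> X'" if "u \<in> X'" "v \<in> X'" for u v
    using that add la by (auto simp: X'_def)
  show ?case
  proof (cases "\<forall>u\<in>X'. ell j u = 0")
    case True
    have "ell i (\<lambda>x. u x - T u x) = 0" if "u \<in> X" "i \<in> insert j J" for u i
      using that T(7) True R[OF that(1)] by (auto simp: R_def)
    moreover have "ip (\<lambda>x. u x - T u x) (\<lambda>x. u x - T u x) \<le> q * ip u u" if "u \<in> X" for u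
    proof -
      have "q1 \<le> q" using q1 mult_left_mono[of 1 q1 q1] by linarith
      then have "q1 * ip u u \<le> q * ip u u" using ip_nonneg[OF that] by (rule mult_right_mono)
      with T(8)[OF that] show ?thesis by linarith
    qed
    moreover have "card F \<le> card (insert j J)" using T(2) insert.hyps by simp
    ultimately show ?thesis using T(1,3-6) by (intro exI[of _ T] exI[of _ F]) blast
  next
    case False
    then obtain x1 where x1: "x1 \<in> X'" "ell j x1 \<noteq> 0" by blast
    define A where "A = {x \<in> X'. ell j x = 1}"
    have "(\<lambda>x. (1 / ell j x1) * x1 x) \<in> A"
      using x1 X'sc[OF x1(1), of "1 / ell j x1"] lsc[OF insertI1 X'X[OF x1(1)], of "1 / ell j x1"] by (simp add: A_def)
    then have A: "A \<noteq> {}" by blast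
    obtain c where c: "\<And>u. u \<in> X \<Longrightarrow> \<bar>ell j u\<bar> \<le> c * sqrt (ip u u)" using lb[of j] by blast
    \<comment> \<open>Boundedness of the functional keeps the form away from 0 on A, so the infimum
      \<rho> is positive and a factor above 1 leaves room for a near minimiser.\<close>
    have low: "1 \<le> c\<^sup>2 * ip x x" if "x \<in> A" for x
    proof -
      have xX: "x \<in> X" using that X'X by (simp add: A_def)
      then have "1 \<le> c * sqrt (ip x x)" using c[OF xX] that by (simp add: A_def)
      then have "1\<^sup>2 \<le> (c * sqrt (ip x x))\<^sup>2" by (intro power_mono) auto
      then show ?thesis using ip_nonneg[OF xX] by (simp add: power_mult_distrib)
    qed
    have c0: "0 < c\<^sup>2"
    proof (rule ccontr)
      assume "\<not> 0 < c\<^sup>2"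
      then have "c\<^sup>2 = 0" by (simp add: not_less)
      with low A show False by fastforce
    qed
    define \<rho> where "\<rho> = Inf ((\<lambda>x. ip x x) ` A)"
    have bd: "bdd_below ((\<lambda>x. ip x x) ` A)"
      by (rule bdd_belowI[of _ 0]) (use ip_nonneg X'X in \<open>auto simp: A_def\<close>)
    have "1 / c\<^sup>2 \<le> \<rho>" unfolding \<rho>_def
      by (rule cInf_greatest) (use A low c0 in \<open>auto simp: field_simps\<close>)
    moreover have "0 < 1 / c\<^sup>2" using c0 by simp
    ultimately have \<rho>: "0 < \<rho>" by linarith
    have "\<rho> < q1 * \<rho>" using \<rho> q1 by simp
    then obtain x0 where x0: "x0 \<in> A" "ip x0 x0 < q1 * \<rho>"
      using cInf_lessD[of "(\<lambda>x. ip x x) ` A" "q1 * \<rho>"] A unfolding \<rho>_def by blast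
    have \<rho>le: "\<rho> \<le> ip x x" if "x \<in> A" for x unfolding \<rho>_def by (rule cInf_lower[OF _ bd]) (use that in blast)
    have x0X: "x0 \<in> X" "x0 \<in> X'" "ell j x0 = 1" using x0(1) X'X by (auto simp: A_def)
    have ip_comb: "ip (\<lambda>x. s * x0 x + w x) (\<lambda>x. s * x0 x + w x) = s\<^sup>2 * ip x0 x0 + 2 * s * ip x0 w + ip w w"
      if w: "w \<in> X" for s w
    proof -
      have sx: "(\<lambda>x. s * x0 x) \<in> X" by (rule scale[OF x0X(1)])
      have z: "(\<lambda>x. s * x0 x + w x) \<in> X" by (rule add[OF sx w])
      have e1: "ip y (\<lambda>x. s * x0 x + w x) = s * ip x0 y + ip w y" if y: "y \<in> X" for y
        using ip_sym[OF y z] ip_add[OF sx w y] ip_scale[OF x0X(1) y, of s] by simp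
      show ?thesis
        using ip_add[OF sx w z] ip_scale[OF x0X(1) z, of s] e1[OF x0X(1)] e1[OF w] ip_sym[OF w x0X(1)]
        by (simp add: power2_eq_square algebra_simps)
    qed
    have ip_comb': "ip (\<lambda>x. x0 x + t * w x) (\<lambda>x. x0 x + t * w x) = ip x0 x0 + 2 * t * ip x0 w + t\<^sup>2 * ip w w"
      if w: "w \<in> X" for t w
    proof -
      have tw: "(\<lambda>x. t * w x) \<in> X" by (rule scale[OF w])
      have "ip x0 (\<lambda>x. t * w x) = t * ip x0 w"
        using ip_sym[OF x0X(1) tw] ip_scale[OF w x0X(1), of t] ip_sym[OF w x0X(1)] by simp
      moreover have "ip (\<lambda>x. t * w x) (\<lambda>x. t * w x) = t\<^sup>2 * ip w w"
        using ip_scale[OF w tw, of t] ip_sym[OF w tw] ip_scale[OF w w, of t] by (simp add: power2_eq_square)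
      ultimately show ?thesis using ip_comb[OF tw, of 1] by simp
    qed
    \<comment> \<open>\<open>R u\<close> is written as s x0 + w with w in the kernel of
      \<open>ell j\<close>. Dropping the part along \<open>x0\<close> enlarges the form at most by
      the factor q1, since no element of A has a form below \<open>ip x0 x0 / q1\<close>.\<close>
    have key: "ip w w \<le> q1 * ip (\<lambda>x. s * x0 x + w x) (\<lambda>x. s * x0 x + w x)"
      if w: "w \<in> X'" "ell j w = 0" for s w
    proof -
      have wX: "w \<in> X" by (rule X'X[OF w(1)])
      have zX: "(\<lambda>x. s * x0 x + w x) \<in> X" by (intro add scale x0X wX)
      show ?thesis unfolding ip_comb[OF wX]
      proof (rule near_orthogonal_bound)
        show "0 < ip x0 x0" using \<rho> \<rho>le[OF x0(1)] by linarith
        show "0 \<le> ip w w" by (rule ip_nonneg[OF wX])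
        show "0 \<le> s\<^sup>2 * ip x0 x0 + 2 * s * ip x0 w + ip w w"
          using ip_nonneg[OF zX] ip_comb[OF wX] by simp
        fix t
        have "(\<lambda>x. x0 x + t * w x) \<in> A"
          using X'add[OF x0X(2) X'sc[OF w(1), of t]] la[OF insertI1 x0X(1) scale[OF wX, of t]] lsc[OF insertI1 wX, of t] w x0X
          by (simp add: A_def)
        from \<rho>le[OF this] have "\<rho> \<le> ip x0 x0 + 2 * t * ip x0 w + t\<^sup>2 * ip w w" by (simp add: ip_comb'[OF wX])
        moreover have "ip x0 x0 / q1 \<le> \<rho>" using x0(2) q1 by (simp add: field_simps)
        ultimately show "ip x0 x0 / q1 \<le> ip x0 x0 + 2 * t * ip x0 w + t\<^sup>2 * ip w w" by linarith
      qed (rule q1)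
    qed
    define T' where "T' u = (\<lambda>x. T u x + ell j (R u) * x0 x)" for u
    have RX: "R u \<in> X" if "u \<in> X" for u using R[OF that] X'X by blast
    have comp: "(\<lambda>x. u x - T' u x) = (\<lambda>x. R u x - ell j (R u) * x0 x)" for u
      by (simp add: T'_def R_def fun_eq_iff)
    have w: "(\<lambda>x. R u x - ell j (R u) * x0 x) \<in> X'" "ell j (\<lambda>x. R u x - ell j (R u) * x0 x) = 0" if "u \<in> X" for u
    proof -
      show "(\<lambda>x. R u x - ell j (R u) * x0 x) \<in> X'"
        using X'add[OF R[OF that] X'sc[OF x0X(2), of "- ell j (R u)"]] by simp
      show "ell j (\<lambda>x. R u x - ell j (R u) * x0 x) = 0"
        using lsub[OF insertI1 RX[OF that] scale[OF x0X(1), of "ell j (R u)"]]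
          lsc[OF insertI1 x0X(1), of "ell j (R u)"] x0X by simp
    qed
    show ?thesis
    proof (rule exI[of _ T'], rule exI[of _ "insert x0 F"], intro conjI ballI allI)
      show "finite (insert x0 F)" using T(1) by simp
      show "card (insert x0 F) \<le> card (insert j J)"
        using T(1,2) insert.hyps by (simp add: card_insert_if)
      fix u assume u: "u \<in> X"
      show "T' u \<in> X" unfolding T'_def by (intro add scale T(3) u x0X)
      show "T' (\<lambda>x. u x + v x) = (\<lambda>x. T' u x + T' v x)" if v: "v \<in> X" for v
        unfolding T'_def T(4)[OF u v] Radd[OF u v] la[OF insertI1 RX[OF u] RX[OF v]]
        by (simp add: algebra_simps)
      show "T' (\<lambda>x. c * u x) = (\<lambda>x. c * T' u x)" for c
        unfolding T'_def T(5)[OF u, of c] Rsc[OF u, of c] lsc[OF insertI1 RX[OF u], of c]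
        by (simp add: algebra_simps)
      obtain d where d: "T u = (\<lambda>x. \<Sum>f\<in>F. d f * f x)" using T(6)[OF u] by blast
      \<comment> \<open>\<open>x0\<close> may already belong to F; in that case its two coefficients
        are added.\<close>
      let ?e = "\<lambda>f. (if f \<in> F then d f else 0) + (if f = x0 then ell j (R u) else 0)"
      have "(\<Sum>f\<in>insert x0 F. ?e f * f x) = T' u x" for x
      proof -
        have "(\<Sum>f\<in>insert x0 F. ?e f * f x) = (\<Sum>f\<in>insert x0 F. (if f \<in> F then d f else 0) * f x)
           + (\<Sum>f\<in>insert x0 F. (if f = x0 then ell j (R u) else 0) * f x)"
          by (simp only: distrib_right sum.distrib)
        also have "(\<Sum>f\<in>insert x0 F. (if f \<in> F then d f else 0) * f x) = (\<Sum>f\<in>F. (if f \<in> F then d f else 0) * f x)"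
          by (rule sum.mono_neutral_right) (use T(1) in auto)
        also have "\<dots> = T u x" unfolding d by (rule sum.cong) auto
        also have "(\<Sum>f\<in>insert x0 F. (if f = x0 then ell j (R u) else 0) * f x)
            = (\<Sum>f\<in>{x0}. (if f = x0 then ell j (R u) else 0) * f x)"
          by (rule sum.mono_neutral_right) (use T(1) in auto)
        finally show ?thesis by (simp add: T'_def)
      qed
      then show "\<exists>c. T' u = (\<lambda>x. \<Sum>f\<in>insert x0 F. c f * f x)"
        by (intro exI[of _ ?e]) (simp add: fun_eq_iff)
      show "ell i (\<lambda>x. u x - T' u x) = 0" if "i \<in> insert j J" for i
        unfolding comp using w[OF u] that by (auto simp: X'_def)
      have "ip (\<lambda>x. u x - T' u x) (\<lambda>x. u x - T' u x) \<le> q1 * ip (R u) (R u)"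
        unfolding comp using key[OF w[OF u], of "ell j (R u)"] by simp
      also have "\<dots> \<le> q1 * (q1 * ip u u)"
        using T(8)[OF u] q1 by (intro mult_left_mono) (auto simp: R_def)
      also have "\<dots> = q * ip u u" using q1 by simp
      finally show "ip (\<lambda>x. u x - T' u x) (\<lambda>x. u x - T' u x) \<le> q * ip u u" .
    qed
  qed
qed

subsection \<open>The linear structure of V and of the harmonic spaces\<close>

lemma V_space_wd_rep:
  "u \<in> V_space kmin k \<Longrightarrow> kmin \<le> k \<Longrightarrow> mi_abs \<alpha> \<le> k \<Longrightarrow> wd (rep_list \<alpha>) u (der u \<alpha>)"
  using V_space_wd[of u kmin k "rep_list \<alpha>"] by simp

lemma V_space_add:
  assumes u: "u \<in> V_space kmin k" and v: "v \<in> V_space kmin k" and k: "kmin \<le> k"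
  shows "(\<lambda>x. u x + v x) \<in> V_space kmin k"
proof (rule V_spaceI)
  show "continuous_on UNIV (\<lambda>x. u x + v x)"
    using u v by (auto simp: V_space_def intro: continuous_on_add)
  fix \<alpha> :: "'a \<Rightarrow> nat" assume \<alpha>: "kmin \<le> mi_abs \<alpha>" "mi_abs \<alpha> \<le> k"
  have w: "wd (rep_list \<alpha>) (\<lambda>x. u x + v x) (\<lambda>x. der u \<alpha> x + der v \<alpha> x)"
    by (rule wd_add[OF V_space_wd_rep[OF u k \<alpha>(2)] V_space_wd_rep[OF v k \<alpha>(2)]])
  have iu: "integrable lborel (\<lambda>x. (der u \<alpha> x)\<^sup>2)" and iv: "integrable lborel (\<lambda>x. (der v \<alpha> x)\<^sup>2)"
    by (rule V_space_der_square_integrable; fact)+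
  have m: "der u \<alpha> \<in> borel_measurable lborel" "der v \<alpha> \<in> borel_measurable lborel"
    using V_space_l2loc_der[OF u k \<alpha>(2)] V_space_l2loc_der[OF v k \<alpha>(2)] l2loc_borel by auto
  have "set_integrable lborel UNIV (\<lambda>x. der u \<alpha> x * der v \<alpha> x)"
    by (rule set_integrable_mult_squares[OF m]) (use iu iv in \<open>simp_all add: set_integrable_def\<close>)
  then have iuv: "integrable lborel (\<lambda>x. der u \<alpha> x * der v \<alpha> x)" by (simp add: set_integrable_def)
  have "integrable lborel (\<lambda>x. (der u \<alpha> x)\<^sup>2 + (der v \<alpha> x)\<^sup>2 + 2 * (der u \<alpha> x * der v \<alpha> x))"
    by (intro Bochner_Integration.integrable_add integrable_mult_right iu iv iuv)
  then have "integrable lborel (\<lambda>x. (der u \<alpha> x + der v \<alpha> x)\<^sup>2)" by (simp add: power2_sum mult.assoc)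
  with w show "\<exists>g. wd (rep_list \<alpha>) (\<lambda>x. u x + v x) g \<and> integrable lborel (\<lambda>x. (g x)\<^sup>2)" by blast
qed

lemma V_space_scale:
  assumes u: "u \<in> V_space kmin k" and k: "kmin \<le> k"
  shows "(\<lambda>x. c * u x) \<in> V_space kmin k"
proof (rule V_spaceI)
  show "continuous_on UNIV (\<lambda>x. c * u x)"
    using u by (auto simp: V_space_def intro: continuous_on_mult_left)
  fix \<alpha> :: "'a \<Rightarrow> nat" assume \<alpha>: "kmin \<le> mi_abs \<alpha>" "mi_abs \<alpha> \<le> k"
  have "wd (rep_list \<alpha>) (\<lambda>x. c * u x) (\<lambda>x. c * der u \<alpha> x)"
    by (rule wd_cmult[OF V_space_wd_rep[OF u k \<alpha>(2)]])
  moreover have "integrable lborel (\<lambda>x. (c * der u \<alpha> x)\<^sup>2)"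
    using V_space_der_square_integrable[OF u \<alpha>] by (simp add: power_mult_distrib)
  ultimately show "\<exists>g. wd (rep_list \<alpha>) (\<lambda>x. c * u x) g \<and> integrable lborel (\<lambda>x. (g x)\<^sup>2)" by blast
qed

lemma der_add:
  assumes "u \<in> V_space kmin k" "v \<in> V_space kmin k" "kmin \<le> k" "mi_abs \<alpha> \<le> k"
  shows "AE x in lborel. der (\<lambda>x. u x + v x) \<alpha> x = der u \<alpha> x + der v \<alpha> x"
  by (rule wd_unique[OF V_space_wd_rep[OF V_space_add] wd_add[OF V_space_wd_rep V_space_wd_rep]]) fact+

lemma der_scale:
  assumes "u \<in> V_space kmin k" "kmin \<le> k" "mi_abs \<alpha> \<le> k"
  shows "AE x in lborel. der (\<lambda>x. c * u x) \<alpha> x = c * der u \<alpha> x"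
  by (rule wd_unique[OF V_space_wd_rep[OF V_space_scale] wd_cmult[OF V_space_wd_rep]]) fact+

text \<open>As \<open>der\<close> is additive almost everywhere, additivity is used under integrals.
  The factor h serves for another derivative, or for one times an indicator, or for the indicator of
  a cell.\<close>

lemma integral_der_add:
  assumes V: "u \<in> V_space kmin k" "v \<in> V_space kmin k" "kmin \<le> k" "mi_abs \<alpha> \<le> k"
    and h [measurable]: "h \<in> borel_measurable borel"
    and i: "integrable lborel (\<lambda>x. der u \<alpha> x * h x)" "integrable lborel (\<lambda>x. der v \<alpha> x * h x)"
  shows "(LINT x|lborel. der (\<lambda>x. u x + v x) \<alpha> x * h x) = (LINT x|lborel. der u \<alpha> x * h x) + (LINT x|lborel. der v \<alpha> x * h x)"
proof -
  have m [measurable]: "der (\<lambda>x. u x + v x) \<alpha> \<in> borel_measurable borel" "der u \<alpha> \<in> borel_measurable borel" "der v \<alpha> \<in> borel_measurable borel"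
    by (rule l2loc_borel[OF V_space_l2loc_der[OF V_space_add[OF V(1-3)] V(3,4)]]
        l2loc_borel[OF V_space_l2loc_der[OF V(1,3,4)]] l2loc_borel[OF V_space_l2loc_der[OF V(2,3,4)]])+
  have "(LINT x|lborel. der (\<lambda>x. u x + v x) \<alpha> x * h x) = (LINT x|lborel. der u \<alpha> x * h x + der v \<alpha> x * h x)"
    by (rule integral_cong_AE) (use der_add[OF V] in \<open>auto elim!: eventually_mono simp: distrib_right\<close>)
  also have "\<dots> = (LINT x|lborel. der u \<alpha> x * h x) + (LINT x|lborel. der v \<alpha> x * h x)"
    by (rule Bochner_Integration.integral_add[OF i])
  finally show ?thesis .
qed

lemma integral_der_scale:
  assumes V: "u \<in> V_space kmin k" "kmin \<le> k" "mi_abs \<alpha> \<le> k"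
    and h [measurable]: "h \<in> borel_measurable borel"
  shows "(LINT x|lborel. der (\<lambda>x. c * u x) \<alpha> x * h x) = c * (LINT x|lborel. der u \<alpha> x * h x)"
proof -
  have m [measurable]: "der (\<lambda>x. c * u x) \<alpha> \<in> borel_measurable borel" "der u \<alpha> \<in> borel_measurable borel"
    by (rule l2loc_borel[OF V_space_l2loc_der[OF V_space_scale[OF V(1,2)] V(2,3)]]
        l2loc_borel[OF V_space_l2loc_der[OF V]])+
  have "(LINT x|lborel. der (\<lambda>x. c * u x) \<alpha> x * h x) = (LINT x|lborel. c * (der u \<alpha> x * h x))"
    by (rule integral_cong_AE) (use der_scale[OF V, of c] in \<open>auto elim!: eventually_mono simp: mult.assoc\<close>)
  also have "\<dots> = c * (LINT x|lborel. der u \<alpha> x * h x)" by simp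
  finally show ?thesis .
qed

lemma a_form_eq:
  assumes u: "u \<in> V_space kmin k" and v: "v \<in> V_space kmin k" and k: "kmin \<le> k"
  shows "a_form kmin k \<sigma> u v = (\<Sum>l\<in>{kmin..k}. \<sigma> l * (\<Sum>\<alpha>\<in>{\<alpha>. mi_abs \<alpha> = l}. (fact l / real (mi_fact \<alpha>)) *
     (LINT x|lborel. der u \<alpha> x * der v \<alpha> x)))"
proof -
  have "l2inner UNIV (weak_deriv UNIV \<alpha> u) (weak_deriv UNIV \<alpha> v) = (LINT x|lborel. der u \<alpha> x * der v \<alpha> x)"
    if "mi_abs \<alpha> \<le> k" for \<alpha>
    using l2inner_weak_deriv[OF open_UNIV V_space_wd_rep[OF u k that] V_space_wd_rep[OF v k that]]
    by (simp add: set_lebesgue_integral_def)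
  then show ?thesis unfolding a_form_def by (intro sum.cong refl arg_cong2[where f = "(*)"]) auto
qed

lemma der_product_integrable:
  assumes u: "u \<in> V_space kmin k" and v: "v \<in> V_space kmin k" and k: "kmin \<le> k"
    and \<alpha>: "kmin \<le> mi_abs \<alpha>" "mi_abs \<alpha> \<le> k"
  shows "integrable lborel (\<lambda>x. der u \<alpha> x * der v \<alpha> x)"
proof -
  have m: "der u \<alpha> \<in> borel_measurable lborel" "der v \<alpha> \<in> borel_measurable lborel"
    using V_space_l2loc_der[OF u k \<alpha>(2)] V_space_l2loc_der[OF v k \<alpha>(2)] l2loc_borel by auto
  have "set_integrable lborel UNIV (\<lambda>x. der u \<alpha> x * der v \<alpha> x)"
    by (rule set_integrable_mult_squares[OF m])
       (use V_space_der_square_integrable[OF u \<alpha>] V_space_der_square_integrable[OF v \<alpha>] in \<open>simp_all add: set_integrable_def\<close>)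
  then show ?thesis by (simp add: set_integrable_def)
qed

lemma a_form_add:
  assumes u: "u \<in> V_space kmin k" and v: "v \<in> V_space kmin k" and w: "w \<in> V_space kmin k" and k: "kmin \<le> k"
  shows "a_form kmin k \<sigma> (\<lambda>x. u x + v x) w = a_form kmin k \<sigma> u w + a_form kmin k \<sigma> v w"
proof -
  have "(LINT x|lborel. der (\<lambda>x. u x + v x) \<alpha> x * der w \<alpha> x) = (LINT x|lborel. der u \<alpha> x * der w \<alpha> x) + (LINT x|lborel. der v \<alpha> x * der w \<alpha> x)"
    if "kmin \<le> mi_abs \<alpha>" "mi_abs \<alpha> \<le> k" for \<alpha>
    by (rule integral_der_add[OF u v k that(2) l2loc_borel[OF V_space_l2loc_der[OF w k that(2)]]
          der_product_integrable[OF u w k that] der_product_integrable[OF v w k that]])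
  then have "(\<Sum>\<alpha>\<in>{\<alpha>. mi_abs \<alpha> = l}. (fact l / real (mi_fact \<alpha>)) * (LINT x|lborel. der (\<lambda>x. u x + v x) \<alpha> x * der w \<alpha> x))
    = (\<Sum>\<alpha>\<in>{\<alpha>. mi_abs \<alpha> = l}. (fact l / real (mi_fact \<alpha>)) * (LINT x|lborel. der u \<alpha> x * der w \<alpha> x))
      + (\<Sum>\<alpha>\<in>{\<alpha>. mi_abs \<alpha> = l}. (fact l / real (mi_fact \<alpha>)) * (LINT x|lborel. der v \<alpha> x * der w \<alpha> x))"
    if "l \<in> {kmin..k}" for l
    using that by (subst sum.distrib[symmetric], intro sum.cong refl) (simp add: distrib_left)
  then show ?thesis
    unfolding a_form_eq[OF V_space_add[OF u v k] w k] a_form_eq[OF u w k] a_form_eq[OF v w k]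
    by (subst sum.distrib[symmetric], intro sum.cong refl) (simp add: distrib_left)
qed

lemma a_form_scale:
  assumes u: "u \<in> V_space kmin k" and w: "w \<in> V_space kmin k" and k: "kmin \<le> k"
  shows "a_form kmin k \<sigma> (\<lambda>x. c * u x) w = c * a_form kmin k \<sigma> u w"
proof -
  have "(LINT x|lborel. der (\<lambda>x. c * u x) \<alpha> x * der w \<alpha> x) = c * (LINT x|lborel. der u \<alpha> x * der w \<alpha> x)"
    if "mi_abs \<alpha> \<le> k" for \<alpha>
    by (rule integral_der_scale[OF u k that l2loc_borel[OF V_space_l2loc_der[OF w k that]]])
  then have "(\<Sum>\<alpha>\<in>{\<alpha>. mi_abs \<alpha> = l}. (fact l / real (mi_fact \<alpha>)) * (LINT x|lborel. der (\<lambda>x. c * u x) \<alpha> x * der w \<alpha> x))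
    = c * (\<Sum>\<alpha>\<in>{\<alpha>. mi_abs \<alpha> = l}. (fact l / real (mi_fact \<alpha>)) * (LINT x|lborel. der u \<alpha> x * der w \<alpha> x))"
    if "l \<in> {kmin..k}" for l
    using that by (subst sum_distrib_left, intro sum.cong refl) simp
  then show ?thesis
    unfolding a_form_eq[OF V_space_scale[OF u k] w k] a_form_eq[OF u w k]
    by (subst sum_distrib_left, intro sum.cong refl) simp
qed

lemma V_harm_add:
  assumes k: "kmin \<le> k" and u: "u \<in> V_harm kmin k \<sigma> P B" and v: "v \<in> V_harm kmin k \<sigma> P B"
  shows "(\<lambda>x. u x + v x) \<in> V_harm kmin k \<sigma> P B"
  using u v a_form_add[of u kmin k v] V_space_add[of u kmin k v] k by (auto simp: V_harm_def V0_space_def)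

lemma V_harm_scale:
  assumes k: "kmin \<le> k" and u: "u \<in> V_harm kmin k \<sigma> P B"
  shows "(\<lambda>x. c * u x) \<in> V_harm kmin k \<sigma> P B"
  using u a_form_scale[of u kmin k] V_space_scale[of u kmin k] k by (auto simp: V_harm_def V0_space_def)

lemma V_harm_mono: "B \<subseteq> B' \<Longrightarrow> V_harm kmin k \<sigma> P B' \<subseteq> V_harm kmin k \<sigma> P B"
  by (auto simp: V_harm_def)

lemma V_harm_zero:
  assumes k: "kmin \<le> k" shows "(\<lambda>x. 0) \<in> V_harm kmin k \<sigma> P B"
proof -
  have z: "(\<lambda>x. 0) \<in> V_space kmin k" by (rule V_spaceI) (auto intro: wd_zero)
  from a_form_scale[OF z _ k, of _ _ 0] z show ?thesis by (auto simp: V_harm_def V0_space_def)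
qed

text \<open>The form behind \<open>hk_norm\<close>, but built from the derivatives on the whole
  space instead of those chosen on U. Below it is used on bounded boxes, where derivatives of every
  order up to k are square integrable.\<close>

definition hk_inner :: "nat \<Rightarrow> (real^'n::finite) set \<Rightarrow> (real^'n \<Rightarrow> real) \<Rightarrow> (real^'n \<Rightarrow> real) \<Rightarrow> real" where
  "hk_inner k U u v = (\<Sum>\<alpha>\<in>{\<alpha>. mi_abs \<alpha> \<le> k}. (LINT x:U|lborel. der u \<alpha> x * der v \<alpha> x))"

lemma hk_inner_self: "hk_inner k U u u = (\<Sum>\<alpha>\<in>{\<alpha>. mi_abs \<alpha> \<le> k}. sqint U (der u \<alpha>))"
  by (simp add: hk_inner_def sqint_def power2_eq_square)

lemma hk_inner_nonneg: "0 \<le> hk_inner k U u u"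
  unfolding hk_inner_self by (intro sum_nonneg sqint_nonneg)

lemma hk_norm_eq:
  assumes u: "u \<in> V_space kmin k" and k: "kmin \<le> k" and U: "open U"
  shows "hk_norm k U u = sqrt (hk_inner k U u u)"
proof -
  have "l2inner U (weak_deriv U \<alpha> u) (weak_deriv U \<alpha> u) = (LINT x:U|lborel. der u \<alpha> x * der u \<alpha> x)"
    if "mi_abs \<alpha> \<le> k" for \<alpha>
    using l2inner_weak_deriv[OF U V_space_wd_rep[OF u k that] V_space_wd_rep[OF u k that]] by simp
  then show ?thesis unfolding hk_norm_def hk_inner_def by (intro arg_cong[where f = sqrt] sum.cong) auto
qed

lemma set_integral_der_add:
  assumes V: "u \<in> V_space kmin k" "v \<in> V_space kmin k" "kmin \<le> k" "mi_abs \<alpha> \<le> k"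
    and h: "l2loc h" and U: "U \<in> sets borel" "U \<subseteq> cbox c d"
  shows "(LINT x:U|lborel. der (\<lambda>x. u x + v x) \<alpha> x * h x) = (LINT x:U|lborel. der u \<alpha> x * h x) + (LINT x:U|lborel. der v \<alpha> x * h x)"
proof -
  have i: "integrable lborel (\<lambda>x. der w \<alpha> x * (indicator U x * h x))" if "w \<in> V_space kmin k" for w
    using l2loc_set_integrable[OF V_space_l2loc_der[OF that V(3,4)] h U] by (simp add: set_integrable_def mult_ac)
  have [measurable]: "h \<in> borel_measurable borel" "U \<in> sets borel" using l2loc_borel[OF h] U by auto
  have "(\<lambda>x. indicator U x * h x) \<in> borel_measurable borel" by measurable
  from integral_der_add[OF V this i[OF V(1)] i[OF V(2)]] show ?thesis
    by (simp add: set_lebesgue_integral_def mult_ac)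
qed

lemma set_integral_der_scale:
  assumes V: "u \<in> V_space kmin k" "kmin \<le> k" "mi_abs \<alpha> \<le> k"
    and h: "l2loc h" and U: "U \<in> sets borel"
  shows "(LINT x:U|lborel. der (\<lambda>x. c * u x) \<alpha> x * h x) = c * (LINT x:U|lborel. der u \<alpha> x * h x)"
proof -
  have [measurable]: "h \<in> borel_measurable borel" "U \<in> sets borel" using l2loc_borel[OF h] U by auto
  have "(\<lambda>x. indicator U x * h x) \<in> borel_measurable borel" by measurable
  from integral_der_scale[OF V this, of c] show ?thesis by (simp add: set_lebesgue_integral_def mult_ac)
qed

section \<open>Geometry of the boxes, and comparison of the energy with the H^k form\<close>

lemma side_le_diameter:
  fixes a b :: "real^'n::finite"
  assumes "\<And>i. a $ i < b $ i" shows "b $ i - a $ i \<le> diameter (box a b)"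
proof -
  have ne: "box a b \<noteq> {}" using assms by (simp add: interval_ne_empty_cart)
  have "diameter (box a b) = diameter (cbox a b)"
    using diameter_closure[OF bounded_box, of a b] closure_box[OF ne] by simp
  moreover have "a \<in> cbox a b" "b \<in> cbox a b" using assms by (auto simp: mem_box_cart less_imp_le)
  then have "dist a b \<le> diameter (cbox a b)" by (intro diameter_bounded_bound bounded_cbox)
  moreover have "\<bar>(b - a) $ i\<bar> \<le> norm (b - a)" by (rule component_le_norm_cart)
  ultimately show ?thesis by (simp add: dist_norm norm_minus_commute)
qed

lemma box_ext_0: "box_ext a b 0 = box a b"
proof -
  have "(\<chi> i. 0) = (0 :: real^'a)" by (simp add: vec_eq_iff)
  then show ?thesis by (simp add: box_ext_def)
qed

lemma box_ext_mono:
  assumes "s \<le> t" shows "box_ext a b s \<subseteq> box_ext a b t"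
proof
  fix x assume x: "x \<in> box_ext a b s"
  have "a $ i - t < x $ i \<and> x $ i < b $ i + t" for i
    using x[unfolded box_ext_def mem_box_cart, rule_format, of i] assms by simp
  then show "x \<in> box_ext a b t" by (simp add: box_ext_def mem_box_cart)
qed

lemma energy_le_hk_inner:
  assumes \<delta>: "0 < \<delta>" "\<delta> \<le> \<delta>bar"
  shows "energy \<delta> k U u \<le> (max 1 \<delta>bar) ^ (2 * k) * hk_inner k U u u"
  unfolding energy_def hk_inner_self sum_distrib_left
proof (rule sum_mono, rule mult_right_mono[OF _ sqint_nonneg])
  fix \<alpha> :: "'a \<Rightarrow> nat" assume "\<alpha> \<in> {\<alpha>. mi_abs \<alpha> \<le> k}"
  then have \<alpha>: "mi_abs \<alpha> \<le> k" by simp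
  have "\<delta> ^ (2 * mi_abs \<alpha>) \<le> (max 1 \<delta>bar) ^ (2 * mi_abs \<alpha>)" using \<delta> by (intro power_mono) auto
  also have "\<dots> \<le> (max 1 \<delta>bar) ^ (2 * k)" using \<alpha> by (intro power_increasing) auto
  finally show "\<delta> ^ (2 * mi_abs \<alpha>) \<le> (max 1 \<delta>bar) ^ (2 * k)" .
qed

text \<open>The only comparison that loses a power of \<delta>: its square root is the factor
  \<delta>^(-k) of the error bound.\<close>

lemma hk_inner_le_energy:
  assumes \<delta>: "0 < \<delta>" "\<delta> \<le> \<delta>bar"
  shows "\<delta> ^ (2 * k) * hk_inner k U u u \<le> (max 1 \<delta>bar) ^ (2 * k) * energy \<delta> k U u"
  unfolding energy_def hk_inner_self sum_distrib_left
proof (rule sum_mono)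
  fix \<alpha> :: "'a \<Rightarrow> nat" assume "\<alpha> \<in> {\<alpha>. mi_abs \<alpha> \<le> k}"
  then have \<alpha>: "mi_abs \<alpha> \<le> k" by simp
  have "2 * k = 2 * (k - mi_abs \<alpha>) + 2 * mi_abs \<alpha>" using \<alpha> by simp
  then have "\<delta> ^ (2 * k) = \<delta> ^ (2 * (k - mi_abs \<alpha>)) * \<delta> ^ (2 * mi_abs \<alpha>)" by (metis power_add)
  also have "\<dots> \<le> (max 1 \<delta>bar) ^ (2 * k) * \<delta> ^ (2 * mi_abs \<alpha>)"
  proof (rule mult_right_mono)
    have "\<delta> ^ (2 * (k - mi_abs \<alpha>)) \<le> (max 1 \<delta>bar) ^ (2 * (k - mi_abs \<alpha>))" using \<delta> by (intro power_mono) auto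
    also have "\<dots> \<le> (max 1 \<delta>bar) ^ (2 * k)" by (intro power_increasing) auto
    finally show "\<delta> ^ (2 * (k - mi_abs \<alpha>)) \<le> (max 1 \<delta>bar) ^ (2 * k)" .
  qed (use \<delta> in simp)
  finally have "\<delta> ^ (2 * k) \<le> (max 1 \<delta>bar) ^ (2 * k) * \<delta> ^ (2 * mi_abs \<alpha>)" .
  from mult_right_mono[OF this sqint_nonneg]
  show "\<delta> ^ (2 * k) * sqint U (der u \<alpha>) \<le> (max 1 \<delta>bar) ^ (2 * k) * (\<delta> ^ (2 * mi_abs \<alpha>) * sqint U (der u \<alpha>))"
    by (simp add: mult.assoc)
qed

text \<open>Cauchy-Schwarz against the constant 1 on the cell. This is the boundedness of the
  functionals that \<open>near_projection\<close> requires, also for the smaller boxes, whose cells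
  lie in the largest one.\<close>

lemma cell_mean_bounded:
  assumes u: "u \<in> V_space kmin k" and k: "kmin \<le> k" and \<alpha>: "mi_abs \<alpha> \<le> k"
    and C: "C \<in> sets borel" "C \<subseteq> box a b"
  shows "\<bar>LINT x:C|lborel. der u \<alpha> x\<bar> \<le> sqrt (LINT x:C|lborel. 1) * sqrt (hk_inner k (box a b) u u)"
proof -
  have l: "l2loc (der u \<alpha>)" by (rule V_space_l2loc_der[OF u k \<alpha>])
  have Cc: "C \<subseteq> cbox a b" using C box_subset_cbox[of a b] by blast
  have "\<bar>LINT x:C|lborel. der u \<alpha> x * 1\<bar> \<le> sqrt (LINT x:C|lborel. (der u \<alpha> x)\<^sup>2) * sqrt (LINT x:C|lborel. 1\<^sup>2)"
    by (rule Cauchy_Schwarz_set_integral)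
       (use l2loc_borel[OF l] C l2loc_set_integrable[OF l l C(1) Cc]
          l2loc_set_integrable[OF l2loc_const[of 1] l2loc_const[of 1] C(1) Cc] in \<open>simp_all add: power2_eq_square\<close>)
  also have "sqrt (LINT x:C|lborel. (der u \<alpha> x)\<^sup>2) \<le> sqrt (hk_inner k (box a b) u u)"
  proof (rule real_sqrt_le_mono)
    have "sqint C (der u \<alpha>) \<le> sqint (box a b) (der u \<alpha>)"
      by (rule sqint_mono[OF l C(1,2) _ box_subset_cbox]) simp
    also have "\<dots> \<le> hk_inner k (box a b) u u"
      unfolding hk_inner_self by (rule member_le_sum) (use \<alpha> finite_mi_abs_le sqint_nonneg in auto)
    finally show "(LINT x:C|lborel. (der u \<alpha> x)\<^sup>2) \<le> hk_inner k (box a b) u u" by (simp add: sqint_def)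
  qed
  then have "sqrt (LINT x:C|lborel. (der u \<alpha> x)\<^sup>2) * sqrt (LINT x:C|lborel. 1\<^sup>2)
      \<le> sqrt (hk_inner k (box a b) u u) * sqrt (LINT x:C|lborel. 1\<^sup>2)"
    by (rule mult_right_mono) (simp add: set_lebesgue_integral_def)
  finally show ?thesis by (simp add: mult.commute)
qed

text \<open>Of the factor 3, a 2 stems from enlarging at both ends of a side and a 1 from rounding
  up, which L / \<theta> \<ge> 1 absorbs.\<close>

lemma card_cells_bound:
  fixes a b :: "real^'n::finite"
  assumes ab: "\<And>i. a $ i < b $ i" and \<delta>: "0 < \<delta>" and \<theta>: "0 < \<theta>" "\<theta> \<le> 1" and m: "m \<le> L" "1 \<le> L"
  shows "real (\<Prod>i\<in>(UNIV::'n set). nat \<lceil>((b + (\<chi> i. \<delta> * real m)) $ i - (a - (\<chi> i. \<delta> * real m)) $ i) / (\<theta> * \<delta>)\<rceil>)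
    \<le> (3 / \<theta> * (real L + diameter (box a b) / \<delta>)) ^ CARD('n)"
proof -
  have "real (nat \<lceil>((b + (\<chi> i. \<delta> * real m)) $ i - (a - (\<chi> i. \<delta> * real m)) $ i) / (\<theta> * \<delta>)\<rceil>)
    \<le> 3 / \<theta> * (real L + diameter (box a b) / \<delta>)" for i
  proof -
    let ?y = "((b + (\<chi> i. \<delta> * real m)) $ i - (a - (\<chi> i. \<delta> * real m)) $ i) / (\<theta> * \<delta>)"
    let ?D = "diameter (box a b)"
    have s: "0 < b $ i - a $ i" "b $ i - a $ i \<le> ?D" using ab side_le_diameter[OF ab] by auto
    have y: "?y = (b $ i - a $ i + 2 * \<delta> * real m) / (\<theta> * \<delta>)" by (simp add: algebra_simps)
    have "0 \<le> ?y" unfolding y using s \<delta> \<theta> by simp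
    then have "real (nat \<lceil>?y\<rceil>) \<le> ?y + 1" by linarith
    also have "?y \<le> (?D + 2 * \<delta> * real L) / (\<theta> * \<delta>)"
      unfolding y using s m \<delta> \<theta> by (intro divide_right_mono add_mono mult_left_mono) auto
    also have "(?D + 2 * \<delta> * real L) / (\<theta> * \<delta>) = 1 / \<theta> * (?D / \<delta> + 2 * real L)"
      using \<delta> \<theta> by (simp add: field_simps)
    also have "1 / \<theta> * (?D / \<delta> + 2 * real L) + 1 \<le> 1 / \<theta> * (?D / \<delta> + 2 * real L) + 1 / \<theta> * real L"
    proof -
      have "1 \<le> 1 / \<theta>" using \<theta> by simp
      then have "1 * 1 \<le> 1 / \<theta> * real L" using m \<theta> by (intro mult_mono) auto
      then show ?thesis by simp
    qed
    also have "\<dots> = 1 / \<theta> * (?D / \<delta> + 3 * real L)" by (simp add: algebra_simps)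
    also have "\<dots> \<le> 1 / \<theta> * (3 * (?D / \<delta>) + 3 * real L)"
      using s \<delta> \<theta> by (intro mult_left_mono add_right_mono) (auto simp: field_simps)
    also have "\<dots> = 3 / \<theta> * (real L + ?D / \<delta>)" by (simp add: algebra_simps)
    finally show ?thesis by simp
  qed
  then have "(\<Prod>i\<in>(UNIV::'n set). real (nat \<lceil>((b + (\<chi> i. \<delta> * real m)) $ i - (a - (\<chi> i. \<delta> * real m)) $ i) / (\<theta> * \<delta>)\<rceil>))
    \<le> (\<Prod>i\<in>(UNIV::'n set). 3 / \<theta> * (real L + diameter (box a b) / \<delta>))"
    by (intro prod_mono conjI) auto
  then show ?thesis by simp
qed

section \<open>Choice of the constants and assembly of the operator\<close>

theorem mainTheorem19:
  fixes \<sigma> :: "nat \<Rightarrow> real" and kmin k :: nat and \<delta>bar :: real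
  assumes "2 * k > CARD('n::finite)" and "kmin \<le> k"
    and "\<forall>l\<in>{kmin..k}. \<sigma> l \<ge> 0" and "\<sigma> kmin > 0" and "\<sigma> k > 0"
    and "\<delta>bar > 0"
  shows "\<exists>C>0. \<forall>(P :: (real^'n) set) (a :: real^'n) (b :: real^'n) (\<delta>::real) (L::nat).
     finite P \<longrightarrow> (\<forall>i. a $ i < b $ i) \<longrightarrow> 0 < \<delta> \<longrightarrow> \<delta> \<le> \<delta>bar \<longrightarrow>
     (\<exists>T. lin_op_on T (V_harm kmin k \<sigma> P (box_ext a b (\<delta> * real L))) (V_harm kmin k \<sigma> P (box a b)) \<and>
        op_rank T (V_harm kmin k \<sigma> P (box_ext a b (\<delta> * real L)))
          \<le> enat (nat \<lfloor>C * (real L + diameter (box a b) / \<delta>) ^ (CARD('n) + 1)\<rfloor>) \<and>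
        (\<forall>u \<in> V_harm kmin k \<sigma> P (box_ext a b (\<delta> * real L)).
           hk_norm k (box a b) (\<lambda>x. u x - T u x)
             \<le> C * (1 / \<delta> ^ k) * (1 / 2 ^ L) * hk_norm k (box_ext a b (\<delta> * real L)) u))"
proof -
  note k = assms(2)
  have \<sigma>nn: "0 \<le> \<sigma> l" if "l \<in> {kmin..k}" for l using assms(3) that by blast
  obtain C0 where C0: "0 < C0" and decay: "\<And>(P :: (real^'n) set) a b \<delta> \<theta> u \<C>.
     (\<forall>i. a $ i < b $ i) \<Longrightarrow> 0 < \<delta> \<Longrightarrow> \<delta> \<le> \<delta>bar \<Longrightarrow> 0 < \<theta> \<Longrightarrow> \<theta> \<le> 1 \<Longrightarrow>
     u \<in> V_harm kmin k \<sigma> P (box_ext a b \<delta>) \<Longrightarrow>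
     cell_partition (\<theta> * \<delta>) (a - (\<chi> i. \<delta>)) (b + (\<chi> i. \<delta>)) \<C> \<Longrightarrow>
     (\<forall>C\<in>\<C>. \<forall>\<alpha>. mi_abs \<alpha> < k \<longrightarrow> (LINT x:C|lborel. der u \<alpha> x) = 0) \<Longrightarrow>
     energy \<delta> k (box a b) u \<le> C0 * \<theta> * energy \<delta> k (box_ext a b \<delta>) u"
    using energy_decay[where ?'n = 'n and \<sigma> = \<sigma>, OF k \<sigma>nn assms(5,6)] by blast
  \<comment> \<open>The cell ratio is chosen so that one enlargement by \<delta> reduces the energy
    by the factor 4; it depends on \<open>C0\<close> alone.\<close>
  define \<theta> where "\<theta> = min 1 (1 / (4 * C0))"
  have \<theta>: "0 < \<theta>" "\<theta> \<le> 1" "C0 * \<theta> \<le> 1 / 4"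
  proof -
    show "0 < \<theta>" "\<theta> \<le> 1" using C0 by (auto simp: \<theta>_def)
    have "C0 * \<theta> \<le> C0 * (1 / (4 * C0))" using C0 by (intro mult_left_mono) (auto simp: \<theta>_def)
    then show "C0 * \<theta> \<le> 1 / 4" using C0 by simp
  qed
  define I where "I = {\<alpha>::'n \<Rightarrow> nat. mi_abs \<alpha> < k}"
  have finI: "finite I" unfolding I_def by (rule finite_subset[OF _ finite_mi_abs_le[of k]]) auto
  define Dm where "Dm = (max 1 \<delta>bar) ^ (2 * k)"
  have Dm: "1 \<le> Dm" unfolding Dm_def by (rule one_le_power) simp
  \<comment> \<open>The first summand serves the error bound, the second the rank, where
    \<open>card I\<close> counts the derivatives of order below k.\<close>
  define C where "C = 2 * Dm + real (card I) * (3 / \<theta>) ^ CARD('n)"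
  have C: "0 < C" "2 * Dm \<le> C" "real (card I) * (3 / \<theta>) ^ CARD('n) \<le> C"
    unfolding C_def using Dm \<theta>(1) by (auto intro: add_pos_nonneg)
  have main: "\<exists>T. lin_op_on T (V_harm kmin k \<sigma> P (box_ext a b (\<delta> * real L))) (V_harm kmin k \<sigma> P (box a b)) \<and>
        op_rank T (V_harm kmin k \<sigma> P (box_ext a b (\<delta> * real L)))
          \<le> enat (nat \<lfloor>C * (real L + diameter (box a b) / \<delta>) ^ (CARD('n) + 1)\<rfloor>) \<and>
        (\<forall>u \<in> V_harm kmin k \<sigma> P (box_ext a b (\<delta> * real L)).
           hk_norm k (box a b) (\<lambda>x. u x - T u x)
             \<le> C * (1 / \<delta> ^ k) * (1 / 2 ^ L) * hk_norm k (box_ext a b (\<delta> * real L)) u)"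
    if ab: "\<forall>i. a $ i < b $ i" and \<delta>: "0 < \<delta>" "\<delta> \<le> \<delta>bar"
    for P :: "(real^'n) set" and a b \<delta> L
  proof -
    define am where "am m = a - (\<chi> i. \<delta> * real m)" for m
    define bm where "bm m = b + (\<chi> i. \<delta> * real m)" for m
    define U where "U m = box (am m) (bm m)" for m
    have U_ext: "box_ext a b (\<delta> * real m) = U m" for m by (simp add: U_def am_def bm_def box_ext_def)
    have U0: "U 0 = box a b" using box_ext_0[of a b] U_ext[of 0] by simp
    have Umono: "U m \<subseteq> U n" if "m \<le> n" for m n
      unfolding U_ext[symmetric] using that \<delta> by (intro box_ext_mono) simp
    have Ub: "U m \<in> sets borel" "open (U m)" "U m \<subseteq> cbox (am m) (bm m)" for m
      by (auto simp: U_def box_subset_cbox open_box)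
    have abm: "am m $ i < bm m $ i" for m i
    proof -
      have "0 \<le> \<delta> * real m" using \<delta> by simp
      then show ?thesis using ab[rule_format, of i] by (simp add: am_def bm_def)
    qed
    define X where "X = V_harm kmin k \<sigma> P (U L)"
    have XV: "u \<in> V_space kmin k" if "u \<in> X" for u using that by (simp add: X_def V_harm_def)
    have "\<exists>\<C>. cell_partition (\<theta> * \<delta>) (am m) (bm m) \<C> \<and> card \<C> \<le> (\<Prod>i\<in>UNIV. nat \<lceil>(bm m $ i - am m $ i) / (\<theta> * \<delta>)\<rceil>)" for m
      by (rule box_cells[OF abm]) (use \<theta> \<delta> in simp)
    then obtain cells where cells: "\<And>m. cell_partition (\<theta> * \<delta>) (am m) (bm m) (cells m)"
      "\<And>m. card (cells m) \<le> (\<Prod>i\<in>UNIV. nat \<lceil>(bm m $ i - am m $ i) / (\<theta> * \<delta>)\<rceil>)" by metis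
    have fcell: "finite (cells m)" for m using cells(1)[of m] by (simp add: cell_partition_def)
    have cellD: "Q \<in> sets borel" "Q \<subseteq> U m" if "Q \<in> cells m" for Q m
      using cells(1)[of m] that by (auto simp: cell_partition_def U_def)
    \<comment> \<open>The step between \<open>U m\<close> and \<open>U (Suc m)\<close> uses means
      over the cells of the larger box, so m runs from 1 to L. For L = 0 the index set is
      empty.\<close>
    define J where "J = (SIGMA m:{1..L}. I \<times> cells m)"
    define ell where "ell = (\<lambda>(m::nat, \<alpha>::'n \<Rightarrow> nat, Q) u. LINT x:Q|lborel. der u \<alpha> x)"
    have fJ: "finite J" unfolding J_def by (intro finite_SigmaI finite_cartesian_product finI fcell) auto
    have ell_eq: "ell (m, \<alpha>, Q) u = (LINT x:Q|lborel. der u \<alpha> x * 1)" for m \<alpha> Q u by (simp add: ell_def)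
    have JD: "\<exists>m \<alpha> Q. j = (m, \<alpha>, Q) \<and> mi_abs \<alpha> \<le> k \<and> Q \<in> sets borel \<and> Q \<subseteq> U L" if "j \<in> J" for j
      using that cellD Umono by (fastforce simp: J_def I_def)
    have addX: "(\<lambda>x. u x + v x) \<in> X" if "u \<in> X" "v \<in> X" for u v
      using that unfolding X_def by (rule V_harm_add[OF k])
    have scaleX: "(\<lambda>x. c * u x) \<in> X" if "u \<in> X" for u c
      using that unfolding X_def by (rule V_harm_scale[OF k])
    have sqX: "hk_inner k (U L) (\<lambda>x. u x + v x) w = hk_inner k (U L) u w + hk_inner k (U L) v w"
      if "u \<in> X" "v \<in> X" "w \<in> X" for u v w
      unfolding hk_inner_def
      by (subst sum.distrib[symmetric], intro sum.cong refl,
          rule set_integral_der_add[OF XV[OF that(1)] XV[OF that(2)] k _ V_space_l2loc_der[OF XV[OF that(3)] k] Ub(1,3)])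
         simp_all
    have scX: "hk_inner k (U L) (\<lambda>x. c * u x) v = c * hk_inner k (U L) u v" if "u \<in> X" "v \<in> X" for u v c
      unfolding hk_inner_def
      by (subst sum_distrib_left, intro sum.cong refl,
          rule set_integral_der_scale[OF XV[OF that(1)] k _ V_space_l2loc_der[OF XV[OF that(2)] k] Ub(1)])
         simp_all
    have "\<exists>T F. finite F \<and> card F \<le> card J \<and> (\<forall>u\<in>X. T u \<in> X) \<and>
      (\<forall>u\<in>X. \<forall>v\<in>X. T (\<lambda>x. u x + v x) = (\<lambda>x. T u x + T v x)) \<and>
      (\<forall>u\<in>X. \<forall>c. T (\<lambda>x. c * u x) = (\<lambda>x. c * T u x)) \<and>
      (\<forall>u\<in>X. \<exists>c. T u = (\<lambda>x. \<Sum>f\<in>F. c f * f x)) \<and>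
      (\<forall>u\<in>X. \<forall>j\<in>J. ell j (\<lambda>x. u x - T u x) = 0) \<and>
      (\<forall>u\<in>X. hk_inner k (U L) (\<lambda>x. u x - T u x) (\<lambda>x. u x - T u x) \<le> 4 * hk_inner k (U L) u u)"
    proof (rule near_projection[OF addX scaleX _ _ sqX scX hk_inner_nonneg fJ])
      show "(\<lambda>x. 0) \<in> X" unfolding X_def by (rule V_harm_zero[OF k])
      show "hk_inner k (U L) u v = hk_inner k (U L) v u" for u v by (simp add: hk_inner_def mult.commute)
      \<comment> \<open>The choice of this factor is free above 1; the square root of 4 is the 2 in
        \<open>2 * Dm\<close>. It is unrelated to the decay by 1/4.\<close>
      show "(1::real) < 4" by simp
    next
      fix j u v assume j: "j \<in> J" and u: "u \<in> X" and v: "v \<in> X"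
      obtain m \<alpha> Q where jq: "j = (m, \<alpha>, Q)" "mi_abs \<alpha> \<le> k" "Q \<in> sets borel" "Q \<subseteq> U L" using JD[OF j] by blast
      have "Q \<subseteq> cbox (am L) (bm L)" using jq(4) Ub(3) by blast
      from set_integral_der_add[OF XV[OF u] XV[OF v] k jq(2) l2loc_const[of 1] jq(3) this]
      show "ell j (\<lambda>x. u x + v x) = ell j u + ell j v" unfolding jq(1) ell_eq .
    next
      fix j u c assume j: "j \<in> J" and u: "u \<in> X"
      obtain m \<alpha> Q where jq: "j = (m, \<alpha>, Q)" "mi_abs \<alpha> \<le> k" "Q \<in> sets borel" "Q \<subseteq> U L" using JD[OF j] by blast
      from set_integral_der_scale[OF XV[OF u] k jq(2) l2loc_const[of 1] jq(3), of c]
      show "ell j (\<lambda>x. c * u x) = c * ell j u" unfolding jq(1) ell_eq .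
    next
      fix j assume j: "j \<in> J"
      obtain m \<alpha> Q where jq: "j = (m, \<alpha>, Q)" "mi_abs \<alpha> \<le> k" "Q \<in> sets borel" "Q \<subseteq> U L" using JD[OF j] by blast
      have "\<bar>ell j u\<bar> \<le> sqrt (LINT x:Q|lborel. 1) * sqrt (hk_inner k (U L) u u)" if "u \<in> X" for u
        using cell_mean_bounded[OF XV[OF that] k jq(2,3) jq(4)[unfolded U_def]] by (simp add: jq(1) ell_def U_def)
      then show "\<exists>c. \<forall>u\<in>X. \<bar>ell j u\<bar> \<le> c * sqrt (hk_inner k (U L) u u)" by blast
    qed
    then obtain T F where T: "finite F" "card F \<le> card J" "\<forall>u\<in>X. T u \<in> X"
      "\<forall>u\<in>X. \<forall>v\<in>X. T (\<lambda>x. u x + v x) = (\<lambda>x. T u x + T v x)"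
      "\<forall>u\<in>X. \<forall>c. T (\<lambda>x. c * u x) = (\<lambda>x. c * T u x)"
      "\<forall>u\<in>X. \<exists>c. T u = (\<lambda>x. \<Sum>f\<in>F. c f * f x)"
      "\<forall>u\<in>X. \<forall>j\<in>J. ell j (\<lambda>x. u x - T u x) = 0"
      "\<forall>u\<in>X. hk_inner k (U L) (\<lambda>x. u x - T u x) (\<lambda>x. u x - T u x) \<le> 4 * hk_inner k (U L) u u"
      by (elim exE conjE) (rule that)
    \<comment> \<open>A larger box imposes more conditions on a function, so T, which maps X into
      itself, also lands in the space of the smallest box.\<close>
    have "X \<subseteq> V_harm kmin k \<sigma> P (box a b)"
      unfolding X_def U0[symmetric] by (rule V_harm_mono[OF Umono]) simp
    with T(3,4,5) have "lin_op_on T X (V_harm kmin k \<sigma> P (box a b))"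
      unfolding lin_op_on_def by blast
    moreover have "op_rank T X \<le> enat (nat \<lfloor>C * (real L + diameter (box a b) / \<delta>) ^ (CARD('n) + 1)\<rfloor>)"
    proof -
      let ?y = "real L + diameter (box a b) / \<delta>"
      have "0 < diameter (box a b)"
        using side_le_diameter[of a b] ab by (metis diff_gt_0_iff_gt less_le_trans)
      then have y: "0 \<le> ?y" "real L \<le> ?y" using \<delta> by simp_all
      have "T ` X \<subseteq> fspan F" using T(6) by (auto simp: fspan_def)
      then have "op_rank T X \<le> enat (card F)"
        unfolding op_rank_def using T(1) by (intro Inf_lower) blast
      also have "enat (card F) \<le> enat (card J)" using T(2) by simp
      also have "\<dots> \<le> enat (nat \<lfloor>C * ?y ^ (CARD('n) + 1)\<rfloor>)"
      proof -
        have "card J = (\<Sum>m\<in>{1..L}. card I * card (cells m))"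
          unfolding J_def by (subst card_SigmaI) (simp_all add: finI fcell card_cartesian_product)
        then have "real (card J) = (\<Sum>m\<in>{1..L}. real (card I) * real (card (cells m)))" by simp
        also have "\<dots> \<le> (\<Sum>m\<in>{1..L}. real (card I) * (3 / \<theta> * ?y) ^ CARD('n))"
        proof (intro sum_mono mult_left_mono)
          fix m assume "m \<in> {1..L}"
          then have m: "m \<le> L" "1 \<le> L" by auto
          have "real (card (cells m)) \<le> real (\<Prod>i\<in>UNIV. nat \<lceil>(bm m $ i - am m $ i) / (\<theta> * \<delta>)\<rceil>)"
            by (rule of_nat_mono[OF cells(2)])
          also have "\<dots> \<le> (3 / \<theta> * ?y) ^ CARD('n)"
            unfolding am_def bm_def
            by (rule card_cells_bound[OF _ \<delta>(1) \<theta>(1,2) m]) (use ab in blast)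
          finally show "real (card (cells m)) \<le> (3 / \<theta> * ?y) ^ CARD('n)" .
        qed simp
        also have "\<dots> = real L * ((real (card I) * (3 / \<theta>) ^ CARD('n)) * ?y ^ CARD('n))"
          unfolding power_mult_distrib[of "3 / \<theta>" ?y] by (simp add: mult_ac)
        \<comment> \<open>One factor \<open>?y\<close> absorbs the number L of boxes; this is the
          additional power in the rank bound.\<close>
        also have "\<dots> \<le> ?y * (C * ?y ^ CARD('n))"
          using y C(3) \<theta>(1) by (intro mult_mono mult_right_mono mult_nonneg_nonneg) auto
        also have "\<dots> = C * ?y ^ (CARD('n) + 1)" by simp
        finally have "card J \<le> nat \<lfloor>C * ?y ^ (CARD('n) + 1)\<rfloor>" by (rule le_nat_floor)
        then show ?thesis by simp
      qed
      finally show ?thesis .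
    qed
    moreover have "hk_norm k (box a b) (\<lambda>x. u x - T u x) \<le> C * (1 / \<delta> ^ k) * (1 / 2 ^ L) * hk_norm k (U L) u"
      if u: "u \<in> X" for u
    proof -
      define w where "w = (\<lambda>x. u x - T u x)"
      have wX: "w \<in> X"
        using addX[OF u scaleX[OF T(3)[rule_format, OF u], of "-1"]] by (simp add: w_def)
      have w0: "(LINT x:Q|lborel. der w \<alpha> x) = 0" if "m \<in> {1..L}" "mi_abs \<alpha> < k" "Q \<in> cells m" for m \<alpha> Q
      proof -
        have "(m, \<alpha>, Q) \<in> J" using that by (simp add: J_def I_def)
        with T(7) u have "ell (m, \<alpha>, Q) w = 0" unfolding w_def by blast
        then show ?thesis by (simp add: ell_def)
      qed
      have step: "energy \<delta> k (U m) w \<le> 1 / 4 * energy \<delta> k (U (Suc m)) w" if m: "m < L" for m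
      proof -
        have ext: "am m - (\<chi> i. \<delta>) = am (Suc m)" "bm m + (\<chi> i. \<delta>) = bm (Suc m)"
          by (simp_all add: am_def bm_def vec_eq_iff algebra_simps)
        have be: "box_ext (am m) (bm m) \<delta> = U (Suc m)" unfolding box_ext_def ext U_def ..
        have "X \<subseteq> V_harm kmin k \<sigma> P (U (Suc m))"
          unfolding X_def by (rule V_harm_mono[OF Umono]) (use m in simp)
        then have "w \<in> V_harm kmin k \<sigma> P (box_ext (am m) (bm m) \<delta>)"
          unfolding be using wX by blast
        moreover have "cell_partition (\<theta> * \<delta>) (am m - (\<chi> i. \<delta>)) (bm m + (\<chi> i. \<delta>)) (cells (Suc m))"
          unfolding ext by (rule cells)
        moreover have "\<forall>Q\<in>cells (Suc m). \<forall>\<alpha>. mi_abs \<alpha> < k \<longrightarrow> (LINT x:Q|lborel. der w \<alpha> x) = 0"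
          using w0[of "Suc m"] m by auto
        ultimately have "energy \<delta> k (box (am m) (bm m)) w \<le> C0 * \<theta> * energy \<delta> k (box_ext (am m) (bm m) \<delta>) w"
          using abm by (intro decay[OF _ \<delta> \<theta>(1,2)]) blast+
        also have "\<dots> \<le> 1 / 4 * energy \<delta> k (box_ext (am m) (bm m) \<delta>) w"
        proof (rule mult_right_mono[OF \<theta>(3)])
          show "0 \<le> energy \<delta> k (box_ext (am m) (bm m) \<delta>) w"
            unfolding energy_def by (intro sum_nonneg mult_nonneg_nonneg sqint_nonneg) (use \<delta> in simp)
        qed
        finally show ?thesis unfolding be by (simp add: U_def)
      qed
      have iter: "energy \<delta> k (U 0) w \<le> (1 / 4) ^ m * energy \<delta> k (U m) w" if "m \<le> L" for m
        using that
      proof (induction m)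
        case (Suc m)
        then have "energy \<delta> k (U 0) w \<le> (1 / 4) ^ m * energy \<delta> k (U m) w" by simp
        also have "\<dots> \<le> (1 / 4) ^ m * (1 / 4 * energy \<delta> k (U (Suc m)) w)"
          using step[of m] Suc.prems by (intro mult_left_mono) auto
        finally show ?case by (simp add: mult_ac)
      qed simp
      let ?h = "\<lambda>U u. hk_inner k U u u"
      \<comment> \<open>From the H^k form to the energy, L decay steps, back to the H^k form and the
        near projection: the factors Dm, 4^(-L), Dm and 4 form a square whose root is 2 Dm
        2^(-L).\<close>
      have "\<delta> ^ (2 * k) * ?h (U 0) w \<le> Dm * energy \<delta> k (U 0) w"
        unfolding Dm_def by (rule hk_inner_le_energy[OF \<delta>])
      also have "\<dots> \<le> Dm * ((1 / 4) ^ L * energy \<delta> k (U L) w)"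
        using iter[of L] Dm by (intro mult_left_mono) auto
      also have "\<dots> \<le> Dm * ((1 / 4) ^ L * (Dm * ?h (U L) w))"
        using energy_le_hk_inner[OF \<delta>, of k "U L" w] Dm by (intro mult_left_mono) (auto simp: Dm_def)
      also have "\<dots> \<le> Dm * ((1 / 4) ^ L * (Dm * (4 * ?h (U L) u)))"
        using T(8) u Dm by (intro mult_left_mono) (auto simp: w_def)
      also have "\<dots> = (2 * Dm * (1 / 2 ^ L))\<^sup>2 * ?h (U L) u"
        by (simp add: power2_eq_square power_divide power_mult_distrib[symmetric])
      finally have le: "(\<delta> ^ k)\<^sup>2 * ?h (U 0) w \<le> (2 * Dm * (1 / 2 ^ L))\<^sup>2 * ?h (U L) u"
        by (simp add: power_mult[symmetric] mult.commute)
      have "\<delta> ^ k * sqrt (?h (U 0) w) = sqrt ((\<delta> ^ k)\<^sup>2 * ?h (U 0) w)"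
        using \<delta> by (simp add: real_sqrt_mult)
      also have "\<dots> \<le> sqrt ((2 * Dm * (1 / 2 ^ L))\<^sup>2 * ?h (U L) u)" by (rule real_sqrt_le_mono[OF le])
      also have "\<dots> = 2 * Dm * (1 / 2 ^ L) * sqrt (?h (U L) u)" using Dm by (simp add: real_sqrt_mult)
      also have "\<dots> \<le> C * (1 / 2 ^ L) * sqrt (?h (U L) u)"
        using C hk_inner_nonneg by (intro mult_right_mono) auto
      finally have "sqrt (?h (U 0) w) \<le> C * (1 / 2 ^ L) * sqrt (?h (U L) u) / \<delta> ^ k"
        using \<delta> by (simp add: pos_le_divide_eq mult_ac)
      then show ?thesis
        using hk_norm_eq[OF XV[OF wX] k Ub(2), of 0] hk_norm_eq[OF XV[OF u] k Ub(2), of L]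
        by (simp add: U0 w_def mult.commute)
    qed
    ultimately show ?thesis unfolding U_ext X_def[symmetric] by blast
  qed
  show ?thesis
    by (rule exI[of _ C]) (use C(1) main in blast)
qed

end
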